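(* Let $m,N\geq 1$ be integers, let $\Omega\subset\mathbb{R}^N$ be a bounded open set with Lipschitz boundary, let $\mathbb{M}$ be the space of real $m\times N$ matrices, let $p\in\,]1,\infty[$, and let $L:\mathbb{M}\to[0,\infty]$ be continuous. Assume that $L$ is $W^{1,q}$-quasiconvex and that there exist $\alpha,\beta>0$ with $\beta|\xi|^q\leq L(\xi)\leq\alpha(1+|\xi|^q)$ for all $\xi\in\mathbb{M}$ (where $q$ is as in (i) or (ii) below). Let $I:W^{1,p}(\Omega;\mathbb{R}^m)\to[0,\infty]$ be defined by $I(u):=\int_\Omega L(\nabla u(x))\,dx$. (i) If $p\in\,]1,N[$ and $q\in\,]1,p^*]$ with $p^*:=\frac{Np}{N-p}$, then $I$ is sequentially weakly lower semicontinuous on $W^{1,p}(\Omega;\mathbb{R}^m)$. (ii) If $p\in[N,\infty[$ and $q\in\,]1,\infty[$, then $I$ is sequentially weakly lower semicontinuous on $W^{1,p}(\Omega;\mathbb{R}^m)$.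
   Context: $Y:=\,]-\tfrac12,\tfrac12[^N$ is the open unit cube of $\mathbb{R}^N$, and for $\xi\in\mathbb{M}$, $l_\xi(y):=\xi y$. $W^{1,q}$-quasiconvexity: $L$ is $W^{1,q}$-quasiconvex if for every $\xi\in\mathbb{M}$, $\int_Y L(\nabla u(y))\,dy\geq L(\xi)$ for all $u\in l_\xi+W^{1,q}_0(Y;\mathbb{R}^m)$. Sequential weak lower semicontinuity of $I$ on $W^{1,p}(\Omega;\mathbb{R}^m)$: $u_n\rightharpoonup u$ weakly in $W^{1,p}(\Omega;\mathbb{R}^m)$ implies $\liminf_{n\to\infty}I(u_n)\geq I(u)$. *)

theory Defs
  imports "HOL-Analysis.Analysis"
begin

text \<open>
  Elements of Lebesgue and Sobolev spaces on \<open>\<Omega>\<close> are represented by functions on all of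
  \<open>\<real>\<^sup>N\<close>, whose values outside \<open>\<Omega>\<close> play no role; two functions that agree almost everywhere
  on \<open>\<Omega>\<close> represent the same element.  An \<open>m \<times> N\<close> matrix has type \<^typ>\<open>real^'n^'m\<close>, and its
  norm is the Euclidean (Frobenius) norm.
\<close>

definition partial_deriv :: "'n \<Rightarrow> (real^'n \<Rightarrow> real) \<Rightarrow> (real^'n \<Rightarrow> real)" where
  "partial_deriv j \<phi> x = frechet_derivative \<phi> (at x) (axis j 1)"

primrec C_k :: "nat \<Rightarrow> (real^'n \<Rightarrow> real) \<Rightarrow> bool" where
  "C_k 0 \<phi> \<longleftrightarrow> continuous_on UNIV \<phi>"
| "C_k (Suc k) \<phi> \<longleftrightarrow> (\<forall>x. \<phi> differentiable (at x)) \<and> (\<forall>j. C_k k (partial_deriv j \<phi>))"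

definition test_function :: "(real^'n) set \<Rightarrow> (real^'n \<Rightarrow> real) \<Rightarrow> bool" where
  "test_function \<Omega> \<phi> \<longleftrightarrow>
     (\<forall>k. C_k k \<phi>) \<and> compact (closure {x. \<phi> x \<noteq> 0}) \<and> closure {x. \<phi> x \<noteq> 0} \<subseteq> \<Omega>"

definition locally_integrable :: "(real^'n) set \<Rightarrow> (real^'n \<Rightarrow> 'b::euclidean_space) \<Rightarrow> bool" where
  "locally_integrable \<Omega> f \<longleftrightarrow> (\<forall>K. compact K \<and> K \<subseteq> \<Omega> \<longrightarrow> set_integrable lebesgue K f)"

definition has_weak_gradient ::
  "(real^'n) set \<Rightarrow> (real^'n \<Rightarrow> real^'m) \<Rightarrow> (real^'n \<Rightarrow> real^'n^'m) \<Rightarrow> bool" where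
  "has_weak_gradient \<Omega> u G \<longleftrightarrow>
     locally_integrable \<Omega> u \<and> locally_integrable \<Omega> G \<and>
     (\<forall>\<phi> i j. test_function \<Omega> \<phi> \<longrightarrow>
        (LINT x:\<Omega>|lebesgue. u x $ i * partial_deriv j \<phi> x) =
        - (LINT x:\<Omega>|lebesgue. G x $ i $ j * \<phi> x))"

text \<open>For open \<open>\<Omega>\<close> the weak gradient is unique up to null sets, so the choice of a
  representative is immaterial in the integrals below.\<close>

definition weak_gradient ::
  "(real^'n) set \<Rightarrow> (real^'n \<Rightarrow> real^'m) \<Rightarrow> (real^'n \<Rightarrow> real^'n^'m)" where
  "weak_gradient \<Omega> u = (SOME G. has_weak_gradient \<Omega> u G)"

definition Lp_space :: "real \<Rightarrow> (real^'n) set \<Rightarrow> (real^'n \<Rightarrow> 'b::euclidean_space) set" where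
  "Lp_space p \<Omega> = {f. f \<in> borel_measurable (lebesgue_on \<Omega>) \<and>
                      integrable (lebesgue_on \<Omega>) (\<lambda>x. norm (f x) powr p)}"

definition W1p :: "real \<Rightarrow> (real^'n) set \<Rightarrow> (real^'n \<Rightarrow> real^'m) set" where
  "W1p p \<Omega> = {u. u \<in> Lp_space p \<Omega> \<and> (\<exists>G. has_weak_gradient \<Omega> u G \<and> G \<in> Lp_space p \<Omega>)}"

definition W1p_norm :: "real \<Rightarrow> (real^'n) set \<Rightarrow> (real^'n \<Rightarrow> real^'m) \<Rightarrow> real" where
  "W1p_norm p \<Omega> u =
     ((LINT x|lebesgue_on \<Omega>. norm (u x) powr p) +
      (LINT x|lebesgue_on \<Omega>. norm (weak_gradient \<Omega> u x) powr p)) powr (1 / p)"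

text \<open>The closure of \<open>C\<^sub>c\<^sup>\<infinity>(\<Omega>; \<real>\<^sup>m)\<close> in \<open>W\<^sup>1\<^sup>,\<^sup>p(\<Omega>; \<real>\<^sup>m)\<close>.\<close>

definition W1p_0 :: "real \<Rightarrow> (real^'n) set \<Rightarrow> (real^'n \<Rightarrow> real^'m) set" where
  "W1p_0 p \<Omega> = {u \<in> W1p p \<Omega>. \<forall>\<epsilon>>0. \<exists>\<phi>. (\<forall>i. test_function \<Omega> (\<lambda>x. \<phi> x $ i)) \<and>
                                       W1p_norm p \<Omega> (\<lambda>x. u x - \<phi> x) < \<epsilon>}"

text \<open>The continuous dual of \<open>W\<^sup>1\<^sup>,\<^sup>p(\<Omega>; \<real>\<^sup>m)\<close>.  The norm bound forces a functional to agree on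
  functions that represent the same element.\<close>

definition W1p_dual :: "real \<Rightarrow> (real^'n) set \<Rightarrow> ((real^'n \<Rightarrow> real^'m) \<Rightarrow> real) set" where
  "W1p_dual p \<Omega> = {F.
     (\<forall>u\<in>W1p p \<Omega>. \<forall>v\<in>W1p p \<Omega>. F (\<lambda>x. u x + v x) = F u + F v) \<and>
     (\<forall>c. \<forall>u\<in>W1p p \<Omega>. F (\<lambda>x. c *\<^sub>R u x) = c * F u) \<and>
     (\<exists>C. \<forall>u\<in>W1p p \<Omega>. \<bar>F u\<bar> \<le> C * W1p_norm p \<Omega> u)}"

definition W1p_weakly_tendsto ::
  "real \<Rightarrow> (real^'n) set \<Rightarrow> (nat \<Rightarrow> real^'n \<Rightarrow> real^'m) \<Rightarrow> (real^'n \<Rightarrow> real^'m) \<Rightarrow> bool" where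
  "W1p_weakly_tendsto p \<Omega> u v \<longleftrightarrow>
     (\<forall>n. u n \<in> W1p p \<Omega>) \<and> v \<in> W1p p \<Omega> \<and> (\<forall>F\<in>W1p_dual p \<Omega>. (\<lambda>n. F (u n)) \<longlonglongrightarrow> F v)"

definition seq_weakly_lsc_W1p ::
  "real \<Rightarrow> (real^'n) set \<Rightarrow> ((real^'n \<Rightarrow> real^'m) \<Rightarrow> ennreal) \<Rightarrow> bool" where
  "seq_weakly_lsc_W1p p \<Omega> J \<longleftrightarrow>
     (\<forall>u v. W1p_weakly_tendsto p \<Omega> u v \<longrightarrow> liminf (\<lambda>n. J (u n)) \<ge> J v)"

definition gradient_integral ::
  "(real^'n^'m \<Rightarrow> ennreal) \<Rightarrow> (real^'n) set \<Rightarrow> (real^'n \<Rightarrow> real^'m) \<Rightarrow> ennreal" where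
  "gradient_integral L \<Omega> u = (\<integral>\<^sup>+x. L (weak_gradient \<Omega> u x) \<partial>lebesgue_on \<Omega>)"

definition unit_cube :: "(real^'n) set" where
  "unit_cube = box (\<chi> i. - (1/2)) (\<chi> i. 1/2)"

text \<open>Membership of \<open>u - l\<^sub>\<xi>\<close> in \<open>W\<^sup>1\<^sup>,\<^sup>q\<^sub>0(Y; \<real>\<^sup>m)\<close> expresses \<open>u \<in> l\<^sub>\<xi> + W\<^sup>1\<^sup>,\<^sup>q\<^sub>0(Y; \<real>\<^sup>m)\<close>.\<close>

definition W1q_quasiconvex :: "real \<Rightarrow> (real^'n^'m \<Rightarrow> ennreal) \<Rightarrow> bool" where
  "W1q_quasiconvex q L \<longleftrightarrow>
     (\<forall>\<xi> u. (\<lambda>y. u y - \<xi> *v y) \<in> W1p_0 q unit_cube \<longrightarrow> gradient_integral L unit_cube u \<ge> L \<xi>)"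

text \<open>Near each boundary point, \<open>\<Omega>\<close> is the strict epigraph of a Lipschitz function over the
  hyperplane orthogonal to some unit vector \<open>e\<close>; the vector \<open>x - (x \<bullet> e) e\<close> is the orthogonal
  projection of \<open>x\<close> to this hyperplane.\<close>

definition lipschitz_boundary :: "(real^'n) set \<Rightarrow> bool" where
  "lipschitz_boundary \<Omega> \<longleftrightarrow>
     (\<forall>x0\<in>frontier \<Omega>. \<exists>r>0. \<exists>e \<gamma> C. norm e = 1 \<and> C-lipschitz_on {y. y \<bullet> e = 0} \<gamma> \<and>
        \<Omega> \<inter> ball x0 r = {x \<in> ball x0 r. \<gamma> (x - (x \<bullet> e) *\<^sub>R e) < x \<bullet> e})"

end

theory Submission
  imports Defs
begin

text \<open>
  Coercivity bounds the gradients of a sequence of bounded energy in \<open>L\<^sup>q\<close>, so weak convergence is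
  used only through test functions.

  After mollification, the sequence \<open>w\<^sub>n\<close> is smooth, has gradients bounded in \<open>L\<^sup>q\<close>, and is close in
  \<open>L\<^sup>q\<close> on a compact set \<open>K\<close> to a mollification \<open>U\<close> of the limit.  Quasiconvexity on the unit cube
  \<open>Y\<close>, with a cutoff of \<open>w - \<xi> y\<close> in a thin boundary layer \<open>S\<close> of \<open>Y\<close>, bounds \<open>L \<xi>\<close> by
  \<open>\<integral>\<^sub>Y L(\<nabla>w)\<close> plus a term on \<open>S\<close> and a multiple of \<open>\<integral>\<^sub>Y |w - \<xi> y|\<^sup>q\<close>.  This is applied, for each
  \<open>x \<in> K\<close>, to \<open>w(y) = (w\<^sub>n(x + h y) - U(x)) / h\<close> and to the gradient \<open>\<xi>\<close> of the limit at \<open>x\<close>, and then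
  integrated over \<open>x\<close>.  The layer term becomes \<open>O(|S|)\<close> even if \<open>|\<nabla>w\<^sub>n|\<^sup>q\<close> concentrates, since
  \<open>\<integral>\<^sub>K \<integral>\<^sub>S |\<nabla>w\<^sub>n(x + h y)|\<^sup>q dy dx \<le> |S| \<integral> |\<nabla>w\<^sub>n|\<^sup>q\<close>, and the last term is small because translations are
  continuous in \<open>L\<^sup>q\<close>.  One chooses \<open>S\<close>, then \<open>h\<close>, then the mollification scale, then \<open>n\<close>.
\<close>

section \<open>Smooth functions and mollifiers\<close>

text \<open>Quasiconvexity can be tested only with fields that are affine on the boundary of the
  cube, while a sequence of bounded energy may concentrate its gradients in any fixed boundary
  layer. Averaging over all centres \<open>x\<close> avoids both the selection of a good layer and a
  blow-up at single points. Closeness in L^q is obtained by comparison with mollifications: a smooth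
  map differs from its mollification at scale \<open>\<eta>\<close> by at most \<open>\<eta>\<close>
  times its gradient in L^q, and at a fixed scale the mollified sequence converges uniformly. The
  order of the choices is forced by the constants: a thin layer makes the factor of |w - \<xi> y|^q
  large, a small \<open>h\<close> produces (1/h)^q, and the uniform convergence is available only
  once the scale is fixed. Mollifying needs room around each point, hence compact subsets first.
  Fubini's theorem and translations are applied to Borel functions and \<open>lborel\<close>,
  whereas Sobolev functions live on \<open>lebesgue\<close>, hence the Borel
  representatives.\<close>

lemma C_k_continuous: "C_k k \<phi> \<Longrightarrow> continuous_on UNIV \<phi>"
  by (cases k) (auto simp: continuous_on_eq_continuous_at differentiable_imp_continuous_within)

lemma C_k_SucD: "C_k (Suc k) \<phi> \<Longrightarrow> C_k k \<phi>"
proof (induction k arbitrary: \<phi>)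
  case 0
  then show ?case by (metis C_k.simps(1) C_k_continuous)
next
  case (Suc k)
  then show ?case by simp
qed

lemma partial_deriv_eqI:
  "(\<phi> has_derivative D) (at x) \<Longrightarrow> partial_deriv j \<phi> x = D (axis j 1)"
  unfolding partial_deriv_def by (metis frechet_derivative_at)

lemma has_derivative_partial_deriv:
  fixes \<phi> :: "real^'n \<Rightarrow> real"
  assumes "\<phi> differentiable (at x)"
  shows "(\<phi> has_derivative (\<lambda>h. \<Sum>j\<in>UNIV. h $ j * partial_deriv j \<phi> x)) (at x)"
proof -
  let ?D = "frechet_derivative \<phi> (at x)"
  have D: "(\<phi> has_derivative ?D) (at x)"
    using assms frechet_derivative_works by blast
  then have lin: "linear ?D" by (rule has_derivative_linear)
  have "?D h = (\<Sum>j\<in>UNIV. h $ j * partial_deriv j \<phi> x)" for h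
  proof -
    have "?D h = ?D (\<Sum>j\<in>UNIV. h $ j *\<^sub>R axis j 1)"
      by (metis (no_types, lifting) basis_expansion scalar_mult_eq_scaleR sum.cong)
    also have "\<dots> = (\<Sum>j\<in>UNIV. h $ j *\<^sub>R ?D (axis j 1))"
      by (simp add: linear_sum[OF lin] linear_cmul[OF lin])
    finally show ?thesis by (simp add: partial_deriv_def)
  qed
  then have "?D = (\<lambda>h. \<Sum>j\<in>UNIV. h $ j * partial_deriv j \<phi> x)" by (rule ext)
  with D show ?thesis by simp
qed

lemma C_k_const [simp]: "C_k k (\<lambda>x. c)"
proof (induction k arbitrary: c)
  case (Suc k)
  have "partial_deriv j (\<lambda>x. c) = (\<lambda>x. 0)" for j :: 'a
    by (rule ext, subst partial_deriv_eqI[OF has_derivative_const]) simp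
  with Suc show ?case by simp
qed simp

lemma partial_deriv_add:
  assumes "\<And>x. f differentiable (at x)" "\<And>x. g differentiable (at x)"
  shows "partial_deriv j (\<lambda>x. f x + g x) = (\<lambda>x. partial_deriv j f x + partial_deriv j g x)"
proof
  fix x
  have "((\<lambda>x. f x + g x) has_derivative
      (\<lambda>h. frechet_derivative f (at x) h + frechet_derivative g (at x) h)) (at x)"
    using assms frechet_derivative_works by (intro has_derivative_add) blast+
  from partial_deriv_eqI[OF this, of j]
  show "partial_deriv j (\<lambda>x. f x + g x) x = partial_deriv j f x + partial_deriv j g x"
    by (simp add: partial_deriv_def)
qed

lemma partial_deriv_mult:
  assumes "\<And>x. f differentiable (at x)" "\<And>x. g differentiable (at x)"
  shows "partial_deriv j (\<lambda>x. f x * g x) = (\<lambda>x. f x * partial_deriv j g x + partial_deriv j f x * g x)"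
proof
  fix x
  have "((\<lambda>x. f x * g x) has_derivative
      (\<lambda>h. f x * frechet_derivative g (at x) h + frechet_derivative f (at x) h * g x)) (at x)"
    using assms frechet_derivative_works by (intro has_derivative_mult) blast+
  from partial_deriv_eqI[OF this, of j]
  show "partial_deriv j (\<lambda>x. f x * g x) x = f x * partial_deriv j g x + partial_deriv j f x * g x"
    by (simp add: partial_deriv_def)
qed

lemma C_k_add: "C_k k f \<Longrightarrow> C_k k g \<Longrightarrow> C_k k (\<lambda>x. f x + g x)"
  by (induction k arbitrary: f g) (auto intro: continuous_intros simp: partial_deriv_add)

lemma C_k_mult: "C_k k f \<Longrightarrow> C_k k g \<Longrightarrow> C_k k (\<lambda>x. f x * g x)"
proof (induction k arbitrary: f g)
  case (Suc k)
  from Suc.prems(1) C_k_SucD have f: "C_k k f" "\<And>x. f differentiable (at x)" "\<And>j. C_k k (partial_deriv j f)"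
    by auto
  from Suc.prems(2) C_k_SucD have g: "C_k k g" "\<And>x. g differentiable (at x)" "\<And>j. C_k k (partial_deriv j g)"
    by auto
  show ?case
    unfolding C_k.simps partial_deriv_mult[OF f(2) g(2)] using f g by (auto intro!: C_k_add Suc.IH)
qed (auto intro: continuous_intros)

lemma C_k_sum: "(\<And>i. i \<in> A \<Longrightarrow> C_k k (f i)) \<Longrightarrow> C_k k (\<lambda>x. \<Sum>i\<in>A. f i x)"
  by (induction A rule: infinite_finite_induct) (auto intro: C_k_add)

lemma partial_deriv_coordinate: "partial_deriv j (\<lambda>x::real^'n. x $ i) = (\<lambda>x. if i = j then 1 else 0)"
proof
  fix x :: "real^'n"
  have "((\<lambda>x::real^'n. x $ i) has_derivative (\<lambda>x. x $ i)) (at x)"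
    by (rule bounded_linear_imp_has_derivative[OF bounded_linear_vec_nth])
  from partial_deriv_eqI[OF this, of j]
  show "partial_deriv j (\<lambda>x. x $ i) x = (if i = j then 1 else 0)" by (simp add: axis_def eq_commute)
qed

lemma C_k_coordinate: "C_k k (\<lambda>x. x $ i)"
proof (cases k)
  case 0
  then show ?thesis by (simp add: continuous_on_component)
next
  case (Suc k)
  then show ?thesis
    by (simp add: partial_deriv_coordinate bounded_linear_imp_differentiable bounded_linear_vec_nth)
qed

lemma C_k_minus: "C_k k f \<Longrightarrow> C_k k g \<Longrightarrow> C_k k (\<lambda>x. f x - g x)"
  using C_k_add[OF _ C_k_mult[OF C_k_const[of k "-1"]], of f g] by simp

lemma partial_deriv_affine:
  assumes "\<And>x. f differentiable (at x)"
  shows "partial_deriv j (\<lambda>x. f (b + a *\<^sub>R x)) = (\<lambda>x. a * partial_deriv j f (b + a *\<^sub>R x))"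
proof
  fix x
  let ?D = "frechet_derivative f (at (b + a *\<^sub>R x))"
  have D: "(f has_derivative ?D) (at (b + a *\<^sub>R x))"
    using assms frechet_derivative_works by blast
  have "((\<lambda>x. f (b + a *\<^sub>R x)) has_derivative (\<lambda>h. ?D (a *\<^sub>R h))) (at x)"
    by (rule has_derivative_compose[where g = f and f = "\<lambda>x. b + a *\<^sub>R x", OF _ D])
      (auto intro!: derivative_eq_intros)
  from partial_deriv_eqI[OF this, of j]
  show "partial_deriv j (\<lambda>x. f (b + a *\<^sub>R x)) x = a * partial_deriv j f (b + a *\<^sub>R x)"
    by (simp add: partial_deriv_def linear_cmul[OF has_derivative_linear[OF D]])
qed

lemma differentiable_affine:
  fixes f :: "real^'n \<Rightarrow> 'b::real_normed_vector"
  assumes "\<And>x. f differentiable (at x)"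
  shows "(\<lambda>x. f (b + a *\<^sub>R x)) differentiable (at x)"
proof -
  have "(\<lambda>x. b + a *\<^sub>R x) differentiable (at x)" by simp
  from differentiable_chain_at[OF this assms] show ?thesis by (simp add: o_def)
qed

lemma C_k_affine: "C_k k f \<Longrightarrow> C_k k (\<lambda>x. f (b + a *\<^sub>R x))"
proof (induction k arbitrary: f)
  case 0
  have "continuous_on UNIV (\<lambda>x. b + a *\<^sub>R x)" by (intro continuous_intros)
  then show ?case using 0 by (auto intro: continuous_on_compose2)
next
  case (Suc k)
  then show ?case by (auto simp: partial_deriv_affine intro!: C_k_mult differentiable_affine)
qed

text \<open>The family is closed under differentiation up to linear combinations, which gives the
  smoothness of all its members by one induction.\<close>

definition flat :: "nat \<Rightarrow> real \<Rightarrow> real" where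
  "flat n t = (if t \<le> 0 then 0 else exp (- (1 / t)) / t ^ n)"

text \<open>The substitution t -> 1/t reduces the right-hand limit to the decay of x^n / exp x, and
  on the left the values vanish. Applied to \<open>Suc n\<close> it also gives the derivative at 0,
  because there the difference quotient of \<open>flat n\<close> is
  \<open>flat (Suc n)\<close>.\<close>

lemma flat_tendsto_0: "(flat n \<longlongrightarrow> 0) (at 0)"
proof -
  have "((\<lambda>x::real. x ^ n / exp x) \<longlongrightarrow> 0) at_top" by (rule tendsto_power_div_exp_0)
  then have "((\<lambda>t::real. inverse t ^ n / exp (inverse t)) \<longlongrightarrow> 0) (at_right 0)"
    using filterlim_compose filterlim_inverse_at_top_right by blast
  then have r: "(flat n \<longlongrightarrow> 0) (at_right 0)"
  proof (rule Lim_transform_eventually)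
    show "\<forall>\<^sub>F t in at_right 0. inverse t ^ n / exp (inverse t) = flat n t"
      unfolding eventually_at_right_field
      by (intro exI[of _ 1]) (auto simp: flat_def exp_minus field_simps)
  qed
  have "(flat n \<longlongrightarrow> 0) (at_left 0)"
  proof (rule Lim_transform_eventually[OF tendsto_const[of 0]])
    show "\<forall>\<^sub>F t in at_left 0. 0 = flat n t"
      unfolding eventually_at_left_field by (intro exI[of _ "-1"]) (auto simp: flat_def)
  qed
  with r show ?thesis by (simp add: filterlim_split_at)
qed

lemma DERIV_flat: "(flat n has_real_derivative (flat (n + 2) t - n * flat (n + 1) t)) (at t)"
proof -
  consider "t < 0" | "t = 0" | "t > 0" by linarith
  then show ?thesis
  proof cases
    case 1
    have "((\<lambda>t. 0) has_real_derivative 0) (at t)" by simp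
    then have "(flat n has_real_derivative 0) (at t)"
      by (rule has_field_derivative_transform_within_open[where S = "{..<0}"]) (use 1 in \<open>auto simp: flat_def\<close>)
    then show ?thesis using 1 by (simp add: flat_def)
  next
    case 2
    have "((\<lambda>h. (flat n (0 + h) - flat n 0) / h) \<longlongrightarrow> 0) (at 0)"
    proof (rule Lim_transform_eventually[OF flat_tendsto_0[of "Suc n"]])
      show "\<forall>\<^sub>F h in at 0. flat (Suc n) h = (flat n (0 + h) - flat n 0) / h"
        by (auto simp: flat_def eventually_at_filter)
    qed
    then show ?thesis using 2 by (simp add: DERIV_def flat_def)
  next
    case 3
    have "((\<lambda>t. exp (- (1 / t)) / t ^ n) has_real_derivative
       (exp (- (1 / t)) / t ^ (n + 2) - n * (exp (- (1 / t)) / t ^ (n + 1)))) (at t)"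
    \<comment> \<open>The derivative of \<open>t ^ n\<close> carries the truncated exponent
      \<open>n - Suc 0\<close>, so n = 0 is treated apart.\<close>
    proof (cases n)
      case 0
      then show ?thesis
        using 3 by (auto intro!: derivative_eq_intros simp: field_simps power2_eq_square)
    next
      case (Suc k)
      have "t ^ n = t ^ k * t" "t ^ (n - Suc 0) = t ^ k" by (auto simp: Suc)
      then show ?thesis
        using 3 by (auto intro!: derivative_eq_intros simp: field_simps power2_eq_square)
    qed
    then have "(flat n has_real_derivative
       (exp (- (1 / t)) / t ^ (n + 2) - n * (exp (- (1 / t)) / t ^ (n + 1)))) (at t)"
      by (rule has_field_derivative_transform_within_open[where S = "{0<..}"]) (use 3 in \<open>auto simp: flat_def\<close>)
    then show ?thesis using 3 by (simp add: flat_def)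
  qed
qed

lemma C_k_flat_compose: "(\<And>k. C_k k s) \<Longrightarrow> C_k k (\<lambda>x. flat n (s x))"
proof (induction k arbitrary: n)
  case 0
  have "continuous_on UNIV (flat n)"
    using DERIV_flat DERIV_isCont continuous_at_imp_continuous_on by blast
  moreover have "continuous_on UNIV s" using 0 C_k_continuous by blast
  ultimately show ?case by (auto intro: continuous_on_compose2)
next
  case (Suc k)
  have ds: "s differentiable (at x)" for x using Suc.prems[of 1] by simp
  have der: "((\<lambda>x. flat n (s x)) has_derivative
      (\<lambda>h. frechet_derivative s (at x) h * (flat (n + 2) (s x) - n * flat (n + 1) (s x)))) (at x)" for x
  proof (rule DERIV_compose_FDERIV[OF DERIV_flat])
    show "(s has_derivative frechet_derivative s (at x)) (at x)" using ds frechet_derivative_works by blast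
  qed
  have "partial_deriv j (\<lambda>x. flat n (s x)) =
     (\<lambda>x. partial_deriv j s x * (flat (n + 2) (s x) - n * flat (n + 1) (s x)))" for j
    using partial_deriv_eqI[OF der] by (auto simp: partial_deriv_def)
  moreover have "C_k k (partial_deriv j s)" for j using Suc.prems[of "Suc k"] by simp
  ultimately show ?case
    using der Suc by (auto simp: differentiable_def intro!: C_k_mult C_k_minus Suc.IH)
qed

section \<open>Mollifiers\<close>

definition mollifier :: "real \<Rightarrow> (real^'n \<Rightarrow> real) \<Rightarrow> bool" where
  "mollifier r \<rho> \<longleftrightarrow> (\<forall>k. C_k k \<rho>) \<and> (\<forall>x. 0 \<le> \<rho> x) \<and> (\<forall>x. \<rho> x \<noteq> 0 \<longrightarrow> norm x < r) \<and>
     (LINT x|lborel. \<rho> x) = 1"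

lemma integrable_continuous_bounded_support:
  fixes f :: "'a::euclidean_space \<Rightarrow> 'b::{banach,second_countable_topology}"
  assumes "continuous_on UNIV f" and "\<And>x. f x \<noteq> 0 \<Longrightarrow> norm x \<le> R"
  shows "integrable lborel f"
proof -
  have "integrable lborel (\<lambda>x. indicator (cball 0 R) x *\<^sub>R f x)"
    by (rule borel_integrable_compact) (use assms in \<open>auto intro: continuous_on_subset\<close>)
  moreover have "indicator (cball 0 R) x *\<^sub>R f x = f x" for x
    using assms(2)[of x] by (auto simp: indicator_def)
  ultimately show ?thesis by simp
qed

text \<open>The normalized bump exp(-1 / (r^2 - |x|^2)). The inner function \<open>s\<close> is
  written as a polynomial in the coordinates so that the closure rules for \<open>C_k\<close> apply
  to it.\<close>

lemma exists_mollifier: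
  assumes "0 < r"
  shows "\<exists>\<rho> :: real^'n \<Rightarrow> real. mollifier r \<rho>"
proof -
  define s where "s x = r\<^sup>2 - (\<Sum>i\<in>UNIV. x $ i * x $ i)" for x :: "real^'n"
  have s: "s x = r\<^sup>2 - (norm x)\<^sup>2" for x
    by (simp add: s_def dot_square_norm[symmetric] inner_vec_def)
  have "C_k k s" for k
    unfolding s_def by (intro C_k_minus C_k_const C_k_sum C_k_mult C_k_coordinate)
  then have C: "C_k k (\<lambda>x. flat 0 (s x))" for k by (rule C_k_flat_compose)
  define b where "b x = flat 0 (s x)" for x
  have supp: "norm x < r" if "b x \<noteq> 0" for x
  proof -
    have "s x > 0" using that by (auto simp: b_def flat_def split: if_splits)
    then show ?thesis using assms by (simp add: s) (metis less_eq_real_def power2_less_imp_less)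
  qed
  have nonneg: "b x \<ge> 0" for x by (auto simp: b_def flat_def)
  have cont: "continuous_on UNIV b" using C[of 0] by (simp add: b_def)
  have int: "integrable lborel b"
    by (rule integrable_continuous_bounded_support[OF cont, of r]) (use supp in force)
  have b0: "b 0 > 0" using assms by (simp add: b_def flat_def s)
  \<comment> \<open>With integral 0 the bump would vanish almost everywhere, but by continuity it is
    positive on a ball around 0.\<close>
  have pos: "(LINT x|lborel. b x) > 0"
  proof (rule ccontr)
    assume "\<not> (LINT x|lborel. b x) > 0"
    then have "(LINT x|lborel. b x) = 0" using nonneg by (simp add: order_less_le)
    then have ae: "AE x in lborel. b x = 0"
      using integral_nonneg_eq_0_iff_AE[OF int] nonneg by simp
    have "open (b -` {0<..})" using cont open_vimage[of "{0<..}" b] by auto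
    then obtain e where "e > 0" "ball 0 e \<subseteq> b -` {0<..}"
      using b0 openE[of "b -` {0<..}" 0] by auto
    then have "b x \<noteq> 0" if "x \<in> ball 0 e" for x using that by fastforce
    then have "AE x in lborel. x \<notin> ball (0::real^'n) e" using ae by (auto elim!: eventually_mono)
    then have "emeasure lborel (ball (0::real^'n) e) = 0"
      by (subst (asm) AE_iff_measurable[where N = "ball 0 e"]) auto
    then show False using emeasure_lborel_ball_finite[of "0::real^'n" e] content_ball_pos[OF \<open>e > 0\<close>, of "0::real^'n"]
      by (simp add: emeasure_eq_ennreal_measure measure_def)
  qed
  show ?thesis
  proof (intro exI[of _ "\<lambda>x. (1 / (LINT x|lborel. b x)) * b x"])
    show "mollifier r (\<lambda>x. (1 / (LINT x|lborel. b x)) * b x)"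
      unfolding mollifier_def
    proof (intro conjI allI impI)
      have "C_k k b" for k using C by (simp add: b_def[abs_def])
      then show "C_k k (\<lambda>x. (1 / (LINT x|lborel. b x)) * b x)" for k by (rule C_k_mult[OF C_k_const])
    qed (use pos nonneg supp in auto)
  qed
qed

section \<open>Integration on Euclidean space\<close>

lemma nn_integral_lborel_affine:
  fixes f :: "'a::euclidean_space \<Rightarrow> ennreal"
  assumes "f \<in> borel_measurable borel" "c \<noteq> 0"
  shows "(\<integral>\<^sup>+x. f x \<partial>lborel) = ennreal (\<bar>c\<bar> ^ DIM('a)) * (\<integral>\<^sup>+x. f (t + c *\<^sub>R x) \<partial>lborel)"
proof -
  note [measurable] = assms(1)
  have "(\<integral>\<^sup>+x. f x \<partial>lborel) = (\<integral>\<^sup>+x. f x \<partial>density (distr lborel borel (\<lambda>x. t + c *\<^sub>R x)) (\<lambda>_. \<bar>c\<bar>^DIM('a)))"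
    using lborel_affine[OF assms(2), of t] by simp
  also have "\<dots> = (\<integral>\<^sup>+x. ennreal (\<bar>c\<bar>^DIM('a)) * f (t + c *\<^sub>R x) \<partial>lborel)"
    by (simp add: nn_integral_density nn_integral_distr)
  also have "\<dots> = ennreal (\<bar>c\<bar> ^ DIM('a)) * (\<integral>\<^sup>+x. f (t + c *\<^sub>R x) \<partial>lborel)"
    by (subst nn_integral_cmult) auto
  finally show ?thesis .
qed

lemma nn_integral_lborel_shift:
  fixes f :: "'a::euclidean_space \<Rightarrow> ennreal"
  assumes "f \<in> borel_measurable borel"
  shows "(\<integral>\<^sup>+x. f (x + z) \<partial>lborel) = (\<integral>\<^sup>+x. f x \<partial>lborel)"
  using nn_integral_lborel_affine[OF assms, of 1 z] by (simp add: add.commute)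

lemma nn_integral_lborel_reflect:
  fixes f :: "'a::euclidean_space \<Rightarrow> ennreal"
  assumes "f \<in> borel_measurable borel"
  shows "(\<integral>\<^sup>+x. f (z - x) \<partial>lborel) = (\<integral>\<^sup>+x. f x \<partial>lborel)"
  using nn_integral_lborel_affine[OF assms, of "-1" z] by simp

lemma integrable_lborel_shift:
  fixes f :: "'a::euclidean_space \<Rightarrow> 'b::{banach,second_countable_topology}"
  assumes "integrable lborel f"
  shows "integrable lborel (\<lambda>x. f (x + z))"
proof -
  have [measurable]: "f \<in> borel_measurable borel" using assms by auto
  show ?thesis
    using assms nn_integral_lborel_shift[of "\<lambda>x. ennreal (norm (f x))" z] by (simp add: integrable_iff_bounded)
qed

lemma integrable_lborel_reflect:
  fixes f :: "'a::euclidean_space \<Rightarrow> 'b::{banach,second_countable_topology}"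
  assumes "integrable lborel f"
  shows "integrable lborel (\<lambda>x. f (z - x))"
proof -
  have [measurable]: "f \<in> borel_measurable borel" using assms by auto
  show ?thesis
    using assms nn_integral_lborel_reflect[of "\<lambda>x. ennreal (norm (f x))" z] by (simp add: integrable_iff_bounded)
qed

lemma integral_lborel_shift:
  fixes f :: "'a::euclidean_space \<Rightarrow> 'b::{banach,second_countable_topology}"
  assumes [measurable]: "f \<in> borel_measurable borel"
  shows "(LINT x|lborel. f (x + z)) = (LINT x|lborel. f x)"
proof -
  have "(LINT x|lborel. f x) = (LINT x|density (distr lborel borel (\<lambda>x. z + 1 *\<^sub>R x)) (\<lambda>_. 1). f x)"
    using lborel_affine[of 1 z] by simp
  also have "\<dots> = (LINT x|lborel. f (x + z))"
    by (simp add: integral_density integral_distr density_1 add.commute)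
  finally show ?thesis ..
qed

lemma integral_lborel_reflect:
  fixes f :: "'a::euclidean_space \<Rightarrow> 'b::{banach,second_countable_topology}"
  assumes [measurable]: "f \<in> borel_measurable borel"
  shows "(LINT x|lborel. f (z - x)) = (LINT x|lborel. f x)"
proof -
  have "(LINT x|lborel. f x) = (LINT x|density (distr lborel borel (\<lambda>x. z + (-1) *\<^sub>R x)) (\<lambda>_. 1). f x)"
    using lborel_affine[of "-1" z] by simp
  also have "\<dots> = (LINT x|lborel. f (z - x))"
    by (simp add: integral_density integral_distr density_1)
  finally show ?thesis ..
qed

text \<open>The q-th power of the norm takes values in \<open>ennreal\<close>, so that integrals of
  it can be added, compared and interchanged before anything is known to be finite.\<close>

definition pw :: "real \<Rightarrow> 'a::real_normed_vector \<Rightarrow> ennreal" where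
  "pw q v = ennreal (norm v powr q)"

lemma pw_zero [simp]: "pw q 0 = 0" by (simp add: pw_def)

lemma pw_minus: "pw q (- v) = pw q v" by (simp add: pw_def)

lemma pw_commute: "pw q (v - w) = pw q (w - v)" by (simp add: pw_def norm_minus_commute)

lemma pw_measurable [measurable]:
  "f \<in> borel_measurable M \<Longrightarrow> (\<lambda>x. pw q (f x)) \<in> borel_measurable M"
  unfolding pw_def by measurable

lemma pw_mono: "0 \<le> q \<Longrightarrow> norm v \<le> norm w \<Longrightarrow> pw q v \<le> pw q w"
  by (auto simp: pw_def powr_mono2 intro!: ennreal_leI)

lemma pw_scaleR: "pw q (c *\<^sub>R v) = ennreal (\<bar>c\<bar> powr q) * pw q v"
  by (simp add: pw_def powr_mult ennreal_mult)

text \<open>From |v + w| <= 2 max(|v|, |w|), whence the constant 2^q.\<close>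

lemma pw_add:
  assumes "0 \<le> q"
  shows "pw q (v + w) \<le> ennreal (2 powr q) * (pw q v + pw q w)"
proof -
  have "norm (v + w) powr q \<le> (2 * max (norm v) (norm w)) powr q"
    using norm_triangle_ineq[of v w] assms by (intro powr_mono2) auto
  also have "\<dots> = 2 powr q * max (norm v) (norm w) powr q" by (simp add: powr_mult)
  also have "\<dots> \<le> 2 powr q * (norm v powr q + norm w powr q)" by (auto simp: max_def)
  finally show ?thesis by (simp add: pw_def ennreal_leI flip: ennreal_plus ennreal_mult)
qed

text \<open>With \<open>m\<close> the norm of the mean, \<open>m \<le> \<integral> W |g|\<close>; integrating Young's inequality
  \<open>|g| m\<^bsup>q-1\<^esup> \<le> |g|\<^sup>q / q + (1 - 1/q) m\<^sup>q\<close> against \<open>W\<close> gives the claim.\<close>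

lemma weighted_Jensen_pw:
  fixes g :: "'a \<Rightarrow> 'b::{banach,second_countable_topology}"
  assumes q: "1 \<le> q" and W: "\<And>x. 0 \<le> W x" "integrable M W" "(LINT x|M. W x) = 1"
    and g: "g \<in> borel_measurable M" "integrable M (\<lambda>x. W x *\<^sub>R g x)"
  shows "pw q (LINT x|M. W x *\<^sub>R g x) \<le> (\<integral>\<^sup>+x. ennreal (W x) * pw q (g x) \<partial>M)"
\<comment> \<open>Excluding these two trivial cases makes W |g|^q integrable and \<open>m\<close>
  positive, as required for the power m^(q-1).\<close>
proof (cases "(\<integral>\<^sup>+x. ennreal (W x) * pw q (g x) \<partial>M) = \<infinity> \<or> (LINT x|M. W x *\<^sub>R g x) = 0")
  case True
  then show ?thesis by auto
next
  case False
  define m where "m = norm (LINT x|M. W x *\<^sub>R g x)"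
  have m: "m > 0" using False by (simp add: m_def)
  have [measurable]: "W \<in> borel_measurable M" "g \<in> borel_measurable M" using W g by auto
  have eq: "ennreal (W x) * pw q (g x) = ennreal (W x * norm (g x) powr q)" for x
    by (simp add: pw_def ennreal_mult W)
  have int: "integrable M (\<lambda>x. W x * norm (g x) powr q)"
    using False W by (intro integrableI_bounded) (auto simp: eq top.not_eq_extremum)
  have J: "(\<integral>\<^sup>+x. ennreal (W x) * pw q (g x) \<partial>M) = ennreal (LINT x|M. W x * norm (g x) powr q)"
    unfolding eq by (rule nn_integral_eq_integral[OF int]) (simp add: W)
  have young: "t * m powr (q - 1) \<le> t powr q / q + (1 - 1 / q) * m powr q" if "t \<ge> 0" for t
  proof (cases "t = 0")
    case True
    then show ?thesis using q by auto
  next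
    case False
    then have "(t powr q) powr (1 / q) * (m powr q) powr (1 - 1 / q) \<le> 1 / q * t powr q + (1 - 1 / q) * m powr q"
      using q m that by (intro Youngs_inequality_0) auto
    moreover have "q * (1 - 1 / q) = q - 1" using q by (simp add: field_simps)
    ultimately show ?thesis using q m that False by (simp add: powr_powr)
  qed
  have intn: "integrable M (\<lambda>x. W x * norm (g x))"
    using integrable_norm[OF g(2)] W(1) by (simp add: abs_of_nonneg)
  have "m powr q = m * m powr (q - 1)" using m by (simp add: powr_mult_base)
  also have "m \<le> (LINT x|M. W x * norm (g x))"
    unfolding m_def using integral_norm_bound[of M "\<lambda>x. W x *\<^sub>R g x"] W(1) by (simp add: abs_of_nonneg)
  then have "m * m powr (q - 1) \<le> (LINT x|M. W x * norm (g x)) * m powr (q - 1)"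
    by (rule mult_right_mono) simp
  also have "\<dots> = (LINT x|M. W x * (norm (g x) * m powr (q - 1)))"
    by (simp add: mult.assoc flip: integral_mult_left_zero)
  also have "\<dots> \<le> (LINT x|M. (1 / q) * (W x * norm (g x) powr q) + ((1 - 1 / q) * m powr q) * W x)"
  proof (rule integral_mono)
    show "integrable M (\<lambda>x. W x * (norm (g x) * m powr (q - 1)))"
      using integrable_mult_left[OF intn, of "m powr (q - 1)"] by (simp add: mult.assoc)
    show "W x * (norm (g x) * m powr (q - 1)) \<le> (1 / q) * (W x * norm (g x) powr q) + ((1 - 1 / q) * m powr q) * W x" for x
      using mult_left_mono[OF young[of "norm (g x)"] W(1)[of x]] by (simp add: algebra_simps)
  qed (use int W in auto)
  also have "\<dots> = (1 / q) * (LINT x|M. W x * norm (g x) powr q) + ((1 - 1 / q) * m powr q) * 1"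
    using int W by (simp del: mult_1_right)
  \<comment> \<open>The term (1 - 1/q) m^q is absorbed on the left, and the remaining factors 1/q
    cancel.\<close>
  finally have "m powr q \<le> (LINT x|M. W x * norm (g x) powr q)"
    using q by (simp add: field_simps)
  then show ?thesis unfolding J by (simp add: pw_def m_def[symmetric] ennreal_leI)
qed

subsection \<open>Continuity of translations\<close>

text \<open>Induction over integrable functions. For an indicator, the set is squeezed between a
  compact and an open set whose difference has small measure; the compact set has positive distance
  to the complement of the open one, and shorter translations stay between them.\<close>

lemma translation_continuous_L1:
  fixes f :: "'a::euclidean_space \<Rightarrow> 'b::{banach,second_countable_topology}"
  assumes "integrable lborel f" and "0 < \<epsilon>"
  shows "\<exists>\<delta>>0. \<forall>z. norm z < \<delta> \<longrightarrow> (\<integral>\<^sup>+x. norm (f (x + z) - f x) \<partial>lborel) \<le> ennreal \<epsilon>"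
  using assms
proof (induction arbitrary: \<epsilon> rule: integrable_induct)
  case (base A c)
  have [measurable]: "A \<in> sets borel" using base(1) by simp
  \<comment> \<open>\<open>U - C\<close> will have measure at most 2e and enters twice, once
    translated, whence the 4; the summand 1 covers c = 0.\<close>
  define e where "e = \<epsilon> / (4 * (norm c + 1))"
  have e: "e > 0" using base(3) by (simp add: e_def add_nonneg_pos)
  have A: "A \<in> sets lebesgue" using base(1) by auto
  obtain U where U: "open U" "A \<subseteq> U" "emeasure lebesgue (U - A) < ennreal e"
    using sets_lebesgue_outer_open[OF A e] by metis
  have e2: "e / 2 > 0" using e by simp
  obtain C' where C': "closed C'" "C' \<subseteq> A" "emeasure lebesgue (A - C') < ennreal (e / 2)"
    using sets_lebesgue_inner_closed[OF A e2] by metis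
  \<comment> \<open>The far part of the closed set decreases to the empty set, so removing it for
    large n makes the inner approximation compact at little cost.\<close>
  define D where "D n = C' - ball 0 (real n)" for n
  have "(\<lambda>n. emeasure lborel (D n)) \<longlonglongrightarrow> emeasure lborel (\<Inter>n. D n)"
  proof (rule Lim_emeasure_decseq)
    show "range D \<subseteq> sets lborel" using C'(1) by (auto simp: D_def)
    show "decseq D" by (force simp: D_def decseq_def)
    have "emeasure lborel (D n) \<le> emeasure lborel A" for n
      using C'(2) base(1) by (intro emeasure_mono) (auto simp: D_def)
    then show "emeasure lborel (D n) \<noteq> \<infinity>" for n
      using base(2) by (metis infinity_ennreal_def leD top.not_eq_extremum)
  qed
  moreover have "(\<Inter>n. D n) = {}"
    by (auto simp: D_def not_less) (meson not_le reals_Archimedean2)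
  ultimately have "\<forall>\<^sub>F n in sequentially. emeasure lborel (D n) < ennreal (e / 2)"
    using e by (intro order_tendstoD(2)[where y = 0]) auto
  then obtain n where n: "emeasure lborel (D n) < ennreal (e / 2)"
    by (auto simp: eventually_sequentially)
  define C where "C = C' \<inter> cball 0 (real n)"
  have C: "compact C" "C \<subseteq> A" using C' by (auto simp: C_def closed_Int_compact)
  note [measurable] = borel_open[OF U(1)] borel_closed[OF C'(1)] borel_compact[OF C(1)]
  have [measurable]: "D n \<in> sets borel" by (simp add: D_def)
  have "A - C \<subseteq> (A - C') \<union> D n" by (auto simp: C_def D_def)
  then have "emeasure lborel (A - C) \<le> emeasure lborel ((A - C') \<union> D n)"
    by (intro emeasure_mono) auto
  also have "\<dots> \<le> emeasure lborel (A - C') + emeasure lborel (D n)"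
    by (intro emeasure_subadditive) auto
  also have "\<dots> \<le> ennreal (e / 2) + ennreal (e / 2)"
    using C'(3) n by (intro add_mono) auto
  also have "\<dots> = ennreal e" using e by (simp flip: ennreal_plus)
  finally have AC: "emeasure lborel (A - C) \<le> ennreal e" .
  have "emeasure lborel (U - C) \<le> emeasure lborel ((U - A) \<union> (A - C))"
    by (intro emeasure_mono) auto
  also have "\<dots> \<le> emeasure lborel (U - A) + emeasure lborel (A - C)"
    by (intro emeasure_subadditive) auto
  also have "\<dots> \<le> ennreal e + ennreal e"
    using U(3) AC by (intro add_mono) auto
  finally have UC: "emeasure lborel (U - C) \<le> ennreal (2 * e)"
    using e by (simp flip: ennreal_plus)
  have "C \<inter> - U = {}" using C(2) U(2) by auto
  then obtain d where d: "d > 0" "\<And>x y. x \<in> C \<Longrightarrow> y \<in> - U \<Longrightarrow> d \<le> dist x y"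
    using separate_compact_closed[OF C(1) closed_Compl[OF U(1)]] by blast
  show ?case
  proof (intro exI[of _ d] conjI allI impI)
    fix z :: 'a assume z: "norm z < d"
    \<comment> \<open>so \<open>A\<close> and its translate differ only inside \<open>U - C\<close> and its translate\<close>
    have near: "x + z \<in> U" "x - z \<in> U" if "x \<in> C" for x
      using d(2)[OF that, of "x + z"] d(2)[OF that, of "x - z"] z by (auto simp: dist_norm)
    have pt: "norm (indicator A (x + z) *\<^sub>R c - indicator A x *\<^sub>R c)
        \<le> norm c * (indicator (U - C) x + indicator (U - C) (x + z))" for x
    proof (cases "x \<in> A \<longleftrightarrow> x + z \<in> A")
      case True
      then show ?thesis by (auto simp: indicator_def)
    next
      case False
      have "x + z \<in> C \<Longrightarrow> x \<in> U" using near(2)[of "x + z"] by simp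
      with False near(1)[of x] C(2) U(2) have "x \<in> U - C \<or> x + z \<in> U - C" by blast
      moreover have "norm (indicator A (x + z) *\<^sub>R c - indicator A x *\<^sub>R c) = norm c"
        using False by (auto simp: indicator_def)
      ultimately show ?thesis by (auto simp: indicator_def)
    qed
    have "(\<integral>\<^sup>+x. norm (indicator A (x + z) *\<^sub>R c - indicator A x *\<^sub>R c) \<partial>lborel)
       \<le> (\<integral>\<^sup>+x. ennreal (norm c) * (indicator (U - C) x + indicator (U - C) (x + z)) \<partial>lborel)"
    proof (rule nn_integral_mono)
      fix x
      have "ennreal (norm (indicator A (x + z) *\<^sub>R c - indicator A x *\<^sub>R c))
         \<le> ennreal (norm c * (indicator (U - C) x + indicator (U - C) (x + z)))"
        by (rule ennreal_leI[OF pt])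
      also have "\<dots> = ennreal (norm c) * (indicator (U - C) x + indicator (U - C) (x + z))"
        by (subst ennreal_mult) (auto simp: ennreal_indicator)
      finally show "ennreal (norm (indicator A (x + z) *\<^sub>R c - indicator A x *\<^sub>R c))
         \<le> ennreal (norm c) * (indicator (U - C) x + indicator (U - C) (x + z))" .
    qed
    also have "\<dots> = ennreal (norm c) * (emeasure lborel (U - C) + emeasure lborel (U - C))"
      using nn_integral_lborel_shift[of "indicator (U - C)" z]
      by (subst nn_integral_cmult, simp, subst nn_integral_add) auto
    also have "\<dots> \<le> ennreal (norm c) * (ennreal (2 * e) + ennreal (2 * e))"
      using UC by (intro mult_left_mono add_mono) auto
    also have "\<dots> = ennreal (norm c * (4 * e))" using e by (simp flip: ennreal_plus ennreal_mult)
    also have "\<dots> \<le> ennreal \<epsilon>"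
    proof (rule ennreal_leI)
      show "norm c * (4 * e) \<le> \<epsilon>"
        using base(3) norm_ge_zero[of c] by (simp add: e_def divide_le_eq add_nonneg_pos not_less algebra_simps)
    qed
    finally show "(\<integral>\<^sup>+x. norm (indicator A (x + z) *\<^sub>R c - indicator A x *\<^sub>R c) \<partial>lborel) \<le> ennreal \<epsilon>" .
  qed (rule d(1))
next
  case (add f g)
  have [measurable]: "f \<in> borel_measurable borel" "g \<in> borel_measurable borel" using add by auto
  obtain d1 where d1: "d1 > 0" "\<And>z. norm z < d1 \<Longrightarrow> (\<integral>\<^sup>+x. norm (f (x + z) - f x) \<partial>lborel) \<le> ennreal (\<epsilon> / 2)"
    using add.IH(1)[of "\<epsilon> / 2"] add.prems by auto
  obtain d2 where d2: "d2 > 0" "\<And>z. norm z < d2 \<Longrightarrow> (\<integral>\<^sup>+x. norm (g (x + z) - g x) \<partial>lborel) \<le> ennreal (\<epsilon> / 2)"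
    using add.IH(2)[of "\<epsilon> / 2"] add.prems by auto
  show ?case
  proof (intro exI[of _ "min d1 d2"] conjI allI impI)
    fix z :: 'a assume z: "norm z < min d1 d2"
    have "(\<integral>\<^sup>+x. norm (f (x + z) + g (x + z) - (f x + g x)) \<partial>lborel)
       \<le> (\<integral>\<^sup>+x. ennreal (norm (f (x + z) - f x)) + ennreal (norm (g (x + z) - g x)) \<partial>lborel)"
      by (intro nn_integral_mono) (simp add: ennreal_leI norm_diff_triangle_ineq flip: ennreal_plus)
    also have "\<dots> \<le> ennreal (\<epsilon> / 2) + ennreal (\<epsilon> / 2)"
      using z d1(2) d2(2) by (subst nn_integral_add) (auto intro!: add_mono)
    also have "\<dots> = ennreal \<epsilon>" using add.prems by (simp flip: ennreal_plus)
    finally show "(\<integral>\<^sup>+x. norm (f (x + z) + g (x + z) - (f x + g x)) \<partial>lborel) \<le> ennreal \<epsilon>" .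
  qed (use d1 d2 in auto)
next
  case (lim f s)
  have [measurable]: "f \<in> borel_measurable borel" "\<And>i. s i \<in> borel_measurable borel" using lim by auto
  have "(\<lambda>i. \<integral>\<^sup>+x. norm (f x - s i x) \<partial>lborel) \<longlonglongrightarrow> 0"
  proof (rule nn_integral_dominated_convergence_norm[where w = "\<lambda>x. 2 * norm (f x)"])
    show "(\<integral>\<^sup>+x. ennreal (2 * norm (f x)) \<partial>lborel) < \<infinity>"
    proof -
      have "integrable lborel (\<lambda>x. 2 *\<^sub>R f x)" using lim.hyps by simp
      then show ?thesis unfolding integrable_iff_bounded by simp
    qed
  qed (use lim in auto)
  then have "\<forall>\<^sub>F i in sequentially. (\<integral>\<^sup>+x. norm (f x - s i x) \<partial>lborel) < ennreal (\<epsilon> / 3)"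
    using lim.prems by (intro order_tendstoD(2)[where y = 0]) auto
  then obtain i where i: "(\<integral>\<^sup>+x. norm (f x - s i x) \<partial>lborel) < ennreal (\<epsilon> / 3)"
    by (auto simp: eventually_sequentially)
  obtain d where d: "d > 0" "\<And>z. norm z < d \<Longrightarrow> (\<integral>\<^sup>+x. norm (s i (x + z) - s i x) \<partial>lborel) \<le> ennreal (\<epsilon> / 3)"
    using lim.IH[of "\<epsilon> / 3" i] lim.prems by auto
  show ?case
  proof (intro exI[of _ d] conjI allI impI)
    fix z :: 'a assume z: "norm z < d"
    have "(\<integral>\<^sup>+x. norm (f (x + z) - f x) \<partial>lborel)
       \<le> (\<integral>\<^sup>+x. ennreal (norm (f (x + z) - s i (x + z))) + (ennreal (norm (s i (x + z) - s i x)) + ennreal (norm (f x - s i x))) \<partial>lborel)"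
    proof (intro nn_integral_mono)
      fix x
      have "norm (f (x + z) - f x) \<le> norm (f (x + z) - s i (x + z)) + (norm (s i (x + z) - s i x) + norm (f x - s i x))"
        using norm_triangle_ineq[of "f (x + z) - s i (x + z)" "(s i (x + z) - s i x) - (f x - s i x)"]
          norm_triangle_ineq4[of "s i (x + z) - s i x" "f x - s i x"] by simp
      then show "ennreal (norm (f (x + z) - f x)) \<le> ennreal (norm (f (x + z) - s i (x + z))) + (ennreal (norm (s i (x + z) - s i x)) + ennreal (norm (f x - s i x)))"
        by (simp add: ennreal_leI flip: ennreal_plus)
    qed
    also have "\<dots> \<le> ennreal (\<epsilon> / 3) + (ennreal (\<epsilon> / 3) + ennreal (\<epsilon> / 3))"
      using z i d(2) nn_integral_lborel_shift[of "\<lambda>x. ennreal (norm (f x - s i x))" z]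
      by (subst nn_integral_add, simp, simp, subst nn_integral_add) (auto intro!: add_mono)
    also have "\<dots> = ennreal \<epsilon>" using lim.prems by (simp flip: ennreal_plus)
    finally show "(\<integral>\<^sup>+x. norm (f (x + z) - f x) \<partial>lborel) \<le> ennreal \<epsilon>" .
  qed (rule d(1))
qed

text \<open>Truncation reduces this to L^1. For the bounded part, |a|^q <= (2B)^(q-1) |a| as soon as
  |a| <= 2B; the remainder is small in L^q by dominated convergence.\<close>

lemma translation_continuous_Lq:
  fixes f :: "'a::euclidean_space \<Rightarrow> 'b::euclidean_space"
  assumes q: "1 \<le> q" and f: "integrable lborel f" "(\<integral>\<^sup>+x. pw q (f x) \<partial>lborel) < \<infinity>" and \<epsilon>: "0 < \<epsilon>"
  shows "\<exists>\<delta>>0. \<forall>z. norm z < \<delta> \<longrightarrow> (\<integral>\<^sup>+x. pw q (f (x + z) - f x) \<partial>lborel) \<le> ennreal \<epsilon>"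
proof -
  have [measurable]: "f \<in> borel_measurable borel" using f by auto
  define T where "T B x = indicator {x. norm (f x) \<le> B} x *\<^sub>R f x" for B x
  define R where "R B x = f x - T B x" for B x
  have [measurable]: "T B \<in> borel_measurable borel" "R B \<in> borel_measurable borel" for B
    unfolding T_def R_def by measurable
  have dom: "(\<lambda>n. \<integral>\<^sup>+x. pw q (R (real n) x) \<partial>lborel) \<longlonglongrightarrow> (\<integral>\<^sup>+x. 0 \<partial>(lborel :: 'a measure))"
  proof (rule nn_integral_dominated_convergence[where w = "\<lambda>x. pw q (f x)"])
    show "AE x in lborel. pw q (R (real n) x) \<le> pw q (f x)" for n
      by (auto simp: R_def T_def indicator_def)
    show "AE x in lborel. (\<lambda>n. pw q (R (real n) x)) \<longlonglongrightarrow> 0"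
    proof (rule AE_I2)
      fix x
      obtain N where "norm (f x) \<le> real N" using real_arch_simple by blast
      then have "\<forall>n\<ge>N. pw q (R (real n) x) = 0" by (auto simp: R_def T_def)
      then show "(\<lambda>n. pw q (R (real n) x)) \<longlonglongrightarrow> 0"
        by (intro tendsto_eventually) (auto simp: eventually_sequentially)
    qed
  qed (use f in auto)
  \<comment> \<open>Three pieces, the truncated difference once and the remainder twice, each with a
    factor of at most \<open>2 powr q * 2 powr q\<close>.\<close>
  define e where "e = \<epsilon> / (3 * (2 powr q * 2 powr q))"
  have e: "e > 0" using \<epsilon> by (simp add: e_def)
  have "\<forall>\<^sub>F n in sequentially. (\<integral>\<^sup>+x. pw q (R (real n) x) \<partial>lborel) < ennreal e"
    using dom e by (intro order_tendstoD(2)[where y = 0]) auto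
  then obtain n where n: "(\<integral>\<^sup>+x. pw q (R (real n) x) \<partial>lborel) < ennreal e"
    by (auto simp: eventually_sequentially)
  \<comment> \<open>The added 1 makes the level positive even if n = 0; raising the level can only
    shrink the remainder.\<close>
  define B where "B = real n + 1"
  have RB: "(\<integral>\<^sup>+x. pw q (R B x) \<partial>lborel) \<le> ennreal e"
  proof -
    have "(\<integral>\<^sup>+x. pw q (R B x) \<partial>lborel) \<le> (\<integral>\<^sup>+x. pw q (R (real n) x) \<partial>lborel)"
      by (intro nn_integral_mono) (auto simp: R_def T_def B_def indicator_def)
    with n show ?thesis by simp
  qed
  have B: "B > 0" by (simp add: B_def)
  have "integrable lborel (T B)"
    by (rule Bochner_Integration.integrable_bound[OF f(1)]) (auto simp: T_def indicator_def)
  then obtain \<delta> where \<delta>: "\<delta> > 0"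
    "\<And>z. norm z < \<delta> \<Longrightarrow> (\<integral>\<^sup>+x. norm (T B (x + z) - T B x) \<partial>lborel) \<le> ennreal (e / (2 * B) powr (q - 1))"
    using translation_continuous_L1[of "T B" "e / (2 * B) powr (q - 1)"] e B by auto
  show ?thesis
  proof (intro exI[of _ \<delta>] conjI allI impI)
    fix z :: 'a assume z: "norm z < \<delta>"
    have T_le: "pw q (T B (x + z) - T B x) \<le> ennreal ((2 * B) powr (q - 1)) * ennreal (norm (T B (x + z) - T B x))" for x
    proof -
      define t where "t = norm (T B (x + z) - T B x)"
      have "norm (T B y) \<le> B" for y using B by (auto simp: T_def indicator_def)
      then have "t \<le> 2 * B"
        unfolding t_def using norm_triangle_ineq4[of "T B (x + z)" "T B x"] by (smt (verit))
      then have "t powr (q - 1) * t \<le> (2 * B) powr (q - 1) * t"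
        using q by (intro mult_right_mono powr_mono2) (auto simp: t_def)
      moreover have "t powr (q - 1) * t = t powr q"
        by (cases "t = 0") (use powr_mult_base[of t "q - 1"] in \<open>auto simp: t_def mult.commute\<close>)
      ultimately show ?thesis unfolding pw_def t_def[symmetric]
        by (simp add: ennreal_leI t_def flip: ennreal_mult)
    qed
    have pt: "pw q (f (x + z) - f x) \<le> ennreal (2 powr q) * (pw q (T B (x + z) - T B x) +
         ennreal (2 powr q) * (pw q (R B (x + z)) + pw q (R B x)))" for x
    proof -
      have "f (x + z) - f x = (T B (x + z) - T B x) + (R B (x + z) + - R B x)" by (simp add: R_def)
      then have "pw q (f (x + z) - f x) \<le> ennreal (2 powr q) * (pw q (T B (x + z) - T B x) + pw q (R B (x + z) + - R B x))"
        using pw_add[of q "T B (x + z) - T B x" "R B (x + z) + - R B x"] q by simp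
      also have "\<dots> \<le> ennreal (2 powr q) * (pw q (T B (x + z) - T B x) +
         ennreal (2 powr q) * (pw q (R B (x + z)) + pw q (R B x)))"
        using pw_add[of q "R B (x + z)" "- R B x"] q by (intro mult_left_mono add_left_mono) (auto simp: pw_minus)
      finally show ?thesis .
    qed
    have IT: "(\<integral>\<^sup>+x. pw q (T B (x + z) - T B x) \<partial>lborel) \<le> ennreal e"
    proof -
      have "(\<integral>\<^sup>+x. pw q (T B (x + z) - T B x) \<partial>lborel)
         \<le> (\<integral>\<^sup>+x. ennreal ((2 * B) powr (q - 1)) * ennreal (norm (T B (x + z) - T B x)) \<partial>lborel)"
        by (intro nn_integral_mono T_le)
      also have "\<dots> = ennreal ((2 * B) powr (q - 1)) * (\<integral>\<^sup>+x. norm (T B (x + z) - T B x) \<partial>lborel)"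
        by (rule nn_integral_cmult) simp
      also have "\<dots> \<le> ennreal ((2 * B) powr (q - 1)) * ennreal (e / (2 * B) powr (q - 1))"
        using \<delta>(2)[OF z] by (rule mult_left_mono) simp
      also have "\<dots> = ennreal e" using B by (simp flip: ennreal_mult')
      finally show ?thesis .
    qed
    have "(\<integral>\<^sup>+x. pw q (f (x + z) - f x) \<partial>lborel)
       \<le> (\<integral>\<^sup>+x. ennreal (2 powr q) * (pw q (T B (x + z) - T B x) +
         ennreal (2 powr q) * (pw q (R B (x + z)) + pw q (R B x))) \<partial>lborel)"
      by (intro nn_integral_mono pt)
    also have "\<dots> = ennreal (2 powr q) * ((\<integral>\<^sup>+x. pw q (T B (x + z) - T B x) \<partial>lborel) +
         ennreal (2 powr q) * ((\<integral>\<^sup>+x. pw q (R B (x + z)) \<partial>lborel) + (\<integral>\<^sup>+x. pw q (R B x) \<partial>lborel)))"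
      by (simp add: nn_integral_cmult nn_integral_add)
    also have "(\<integral>\<^sup>+x. pw q (R B (x + z)) \<partial>lborel) = (\<integral>\<^sup>+x. pw q (R B x) \<partial>lborel)"
      using nn_integral_lborel_shift[of "\<lambda>x. pw q (R B x)" z] by simp
    also have "ennreal (2 powr q) * ((\<integral>\<^sup>+x. pw q (T B (x + z) - T B x) \<partial>lborel) +
         ennreal (2 powr q) * ((\<integral>\<^sup>+x. pw q (R B x) \<partial>lborel) + (\<integral>\<^sup>+x. pw q (R B x) \<partial>lborel)))
       \<le> ennreal (2 powr q) * (ennreal e + ennreal (2 powr q) * (ennreal e + ennreal e))"
      by (intro mult_left_mono add_mono IT RB) auto
    also have "\<dots> = ennreal (2 powr q * (e + 2 powr q * (e + e)))"
      using e by (simp flip: ennreal_plus ennreal_mult)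
    also have "\<dots> \<le> ennreal \<epsilon>"
    proof (rule ennreal_leI)
      have "1 \<le> 2 powr q" using q by (intro ge_one_powr_ge_zero) auto
      then have "2 powr q * (e + 2 powr q * (e + e)) \<le> 2 powr q * (2 powr q * e + 2 powr q * (e + e))"
        using e by (intro mult_left_mono add_mono) auto
      also have "\<dots> = \<epsilon>" by (simp add: e_def field_simps)
      finally show "2 powr q * (e + 2 powr q * (e + e)) \<le> \<epsilon>" .
    qed
    finally show "(\<integral>\<^sup>+x. pw q (f (x + z) - f x) \<partial>lborel) \<le> ennreal \<epsilon>" .
  qed (rule \<delta>(1))
qed

section \<open>Convolution\<close>

definition grad :: "(real^'n \<Rightarrow> real) \<Rightarrow> real^'n \<Rightarrow> real^'n" where
  "grad \<phi> x = (\<chi> j. partial_deriv j \<phi> x)"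

text \<open>Compact support is recorded through a radius, which for a mollifier is its scale and
  hence the margin it needs inside a domain.\<close>

definition smooth_supp :: "real \<Rightarrow> (real^'n \<Rightarrow> real) \<Rightarrow> bool" where
  "smooth_supp R \<phi> \<longleftrightarrow> (\<forall>k. C_k k \<phi>) \<and> (\<forall>x. \<phi> x \<noteq> 0 \<longrightarrow> norm x \<le> R)"

lemma smooth_suppD:
  assumes "smooth_supp R \<phi>"
  shows "C_k k \<phi>" "\<phi> differentiable (at x)" "continuous_on UNIV \<phi>" "\<phi> x \<noteq> 0 \<Longrightarrow> norm x \<le> R"
proof -
  have "C_k 1 \<phi>" "C_k 0 \<phi>" using assms unfolding smooth_supp_def by blast+
  then show "C_k k \<phi>" "\<phi> differentiable (at x)" "continuous_on UNIV \<phi>" "\<phi> x \<noteq> 0 \<Longrightarrow> norm x \<le> R"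
    using assms by (auto simp: smooth_supp_def)
qed

lemma has_derivative_grad:
  assumes "\<phi> differentiable (at x)"
  shows "(\<phi> has_derivative (\<lambda>h. h \<bullet> grad \<phi> x)) (at x)"
  using has_derivative_partial_deriv[OF assms] by (simp add: grad_def inner_vec_def)

lemma smooth_supp_partial_deriv:
  assumes "smooth_supp R \<phi>"
  shows "smooth_supp R (partial_deriv j \<phi>)"
  unfolding smooth_supp_def
proof (intro conjI allI impI)
  show "C_k k (partial_deriv j \<phi>)" for k using smooth_suppD(1)[OF assms, of "Suc k"] by simp
  show "norm x \<le> R" if "partial_deriv j \<phi> x \<noteq> 0" for x
  proof (rule ccontr)
    assume x: "\<not> norm x \<le> R"
    have "((\<lambda>x. 0) has_derivative (\<lambda>h. 0)) (at x)" by simp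
    then have "(\<phi> has_derivative (\<lambda>h. 0)) (at x)"
      by (rule has_derivative_transform_within_open[where s = "- cball 0 R"])
        (use x smooth_suppD(4)[OF assms] in \<open>auto simp: open_Compl\<close>)
    with that show False by (simp add: partial_deriv_eqI)
  qed
qed

text \<open>Two points at distance less than 1 either both lie in the ball of radius R + 1, where
  compactness applies, or both lie outside the ball of radius R, where f vanishes.\<close>

lemma uniformly_continuous_bounded_support:
  fixes f :: "'a::euclidean_space \<Rightarrow> 'b::real_normed_vector"
  assumes "continuous_on UNIV f" "\<And>x. f x \<noteq> 0 \<Longrightarrow> norm x \<le> R"
  shows "uniformly_continuous_on UNIV f"
  unfolding uniformly_continuous_on_def
proof (intro allI impI)
  fix e :: real assume "e > 0"
  have "uniformly_continuous_on (cball 0 (R + 1)) f"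
    using assms(1) by (intro compact_uniformly_continuous) (auto intro: continuous_on_subset)
  then obtain d where d: "d > 0" "\<And>x y. x \<in> cball 0 (R + 1) \<Longrightarrow> y \<in> cball 0 (R + 1) \<Longrightarrow> dist y x < d \<Longrightarrow> dist (f y) (f x) < e"
    using \<open>e > 0\<close> unfolding uniformly_continuous_on_def by metis
  have "dist (f y) (f x) < e" if "dist y x < min d 1" for x y
  proof (cases "norm x \<le> R + 1 \<and> norm y \<le> R + 1")
    case True
    then show ?thesis using d(2)[of x y] that by simp
  next
    case False
    have "norm x > R" "norm y > R"
      using False that norm_triangle_ineq2[of x y] norm_triangle_ineq2[of y x]
      by (auto simp: dist_norm norm_minus_commute)
    then have "f x = 0" "f y = 0" using assms(2) by (meson not_le)+
    then show ?thesis using \<open>e > 0\<close> by simp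
  qed
  then show "\<exists>d>0. \<forall>x\<in>UNIV. \<forall>x'\<in>UNIV. dist x' x < d \<longrightarrow> dist (f x') (f x) < e"
    using d(1) by (intro exI[of _ "min d 1"]) auto
qed

lemma bounded_bounded_support:
  fixes f :: "'a::euclidean_space \<Rightarrow> 'b::real_normed_vector"
  assumes "continuous_on UNIV f" "\<And>x. f x \<noteq> 0 \<Longrightarrow> norm x \<le> R"
  shows "\<exists>B\<ge>0. \<forall>x. norm (f x) \<le> B"
proof -
  have "bounded (f ` cball 0 R)"
    using assms(1) by (intro compact_imp_bounded compact_continuous_image) (auto intro: continuous_on_subset)
  then obtain B where "\<forall>y\<in>f ` cball 0 R. norm y \<le> B" unfolding bounded_iff by blast
  then have "norm (f x) \<le> max B 0" for x
    using assms(2)[of x] by (cases "f x = 0") (auto simp: le_max_iff_disj)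
  then show ?thesis by (intro exI[of _ "max B 0"]) auto
qed

lemma smooth_supp_bounded: "smooth_supp R \<phi> \<Longrightarrow> \<exists>B\<ge>0. \<forall>x. \<bar>\<phi> x\<bar> \<le> B"
  using bounded_bounded_support[of \<phi> R] smooth_suppD(3,4)[of R \<phi>] by auto

lemma smooth_supp_measurable: "smooth_supp R \<phi> \<Longrightarrow> \<phi> \<in> borel_measurable borel"
  using smooth_suppD(3) borel_measurable_continuous_onI by blast

lemma continuous_on_grad: "smooth_supp R \<phi> \<Longrightarrow> continuous_on UNIV (grad \<phi>)"
  unfolding grad_def
  by (intro continuous_on_vec_lambda smooth_suppD(3)[OF smooth_supp_partial_deriv])

lemma grad_supp:
  assumes "smooth_supp R \<phi>" "grad \<phi> x \<noteq> 0"
  shows "norm x \<le> R"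
proof -
  obtain j where "grad \<phi> x $ j \<noteq> 0" using assms(2) by (auto simp: vec_eq_iff)
  then show ?thesis using smooth_suppD(4)[OF smooth_supp_partial_deriv[OF assms(1), of j]] by (simp add: grad_def)
qed

text \<open>The remainder of the first-order expansion is uniform in z because the gradient is
  uniformly continuous. This uniformity is what allows the expansion to be integrated.\<close>

lemma uniformly_differentiable:
  assumes \<phi>: "smooth_supp R \<phi>" and "0 < e"
  shows "\<exists>d>0. \<forall>z h. norm h < d \<longrightarrow> \<bar>\<phi> (z + h) - \<phi> z - h \<bullet> grad \<phi> z\<bar> \<le> e * norm h"
proof -
  obtain d where d: "d > 0" "\<And>x y. dist y x < d \<Longrightarrow> dist (grad \<phi> y) (grad \<phi> x) < e"
    using uniformly_continuous_bounded_support[OF continuous_on_grad[OF \<phi>] grad_supp[OF \<phi>]] \<open>0 < e\<close>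
    unfolding uniformly_continuous_on_def by auto
  have "\<bar>\<phi> (z + h) - \<phi> z - h \<bullet> grad \<phi> z\<bar> \<le> e * norm h" if h: "norm h < d" for z h
  proof -
    have "norm (\<phi> (z + h) - \<phi> z - (z + h - z) \<bullet> grad \<phi> z) \<le> norm (z + h - z) * e"
    proof (rule differentiable_bound_linearization[where S = "ball z d" and f' = "\<lambda>x h. h \<bullet> grad \<phi> x"])
      show "z + t *\<^sub>R (z + h - z) \<in> ball z d" if "t \<in> {0..1}" for t
      proof -
        have "\<bar>t\<bar> * norm h \<le> 1 * norm h" using that by (intro mult_right_mono) auto
        then show ?thesis using h by (simp add: dist_norm)
      qed
      show "(\<phi> has_derivative (\<lambda>h. h \<bullet> grad \<phi> x)) (at x within ball z d)" for x
        using has_derivative_grad[OF smooth_suppD(2)[OF \<phi>]] has_derivative_at_withinI by blast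
      show "onorm ((\<lambda>h. h \<bullet> grad \<phi> x) - (\<lambda>h. h \<bullet> grad \<phi> z)) \<le> e" if "x \<in> ball z d" for x
      proof (rule onorm_bound)
        show "norm (((\<lambda>h. h \<bullet> grad \<phi> x) - (\<lambda>h. h \<bullet> grad \<phi> z)) k) \<le> e * norm k" for k
        proof -
          have "\<bar>k \<bullet> (grad \<phi> x - grad \<phi> z)\<bar> \<le> norm k * norm (grad \<phi> x - grad \<phi> z)"
            by (rule Cauchy_Schwarz_ineq2)
          also have "\<dots> \<le> norm k * e"
            using d(2)[of x z] that by (intro mult_left_mono) (auto simp: dist_norm norm_minus_commute)
          finally show ?thesis by (simp add: inner_diff_right mult.commute)
        qed
      qed (use \<open>0 < e\<close> in auto)
    qed (use d in auto)
    then show ?thesis by (simp add: mult.commute)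
  qed
  with d(1) show ?thesis by blast
qed

section \<open>Convolution with a smooth kernel\<close>

definition conv :: "(real^'n \<Rightarrow> real) \<Rightarrow> (real^'n \<Rightarrow> 'b::euclidean_space) \<Rightarrow> real^'n \<Rightarrow> 'b" where
  "conv \<phi> f x = (LINT y|lborel. \<phi> (x - y) *\<^sub>R f y)"

lemma integrable_bounded_scaleR:
  fixes f :: "'a::euclidean_space \<Rightarrow> 'b::{banach,second_countable_topology}"
  assumes "g \<in> borel_measurable borel" "\<And>x. \<bar>g x\<bar> \<le> B" "integrable lborel f"
  shows "integrable lborel (\<lambda>x. g x *\<^sub>R f x)"
proof (rule Bochner_Integration.integrable_bound[where f = "\<lambda>x. B *\<^sub>R f x"])
  show "(\<lambda>x. g x *\<^sub>R f x) \<in> borel_measurable lborel" using assms by measurable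
  have "\<bar>g x\<bar> * norm (f x) \<le> \<bar>B\<bar> * norm (f x)" for x
    using assms(2)[of x] by (intro mult_right_mono) auto
  then show "AE x in lborel. norm (g x *\<^sub>R f x) \<le> norm (B *\<^sub>R f x)" by simp
qed (use assms in auto)

lemma integrable_conv:
  fixes f :: "real^'n \<Rightarrow> 'b::euclidean_space"
  assumes "smooth_supp R \<phi>" "integrable lborel f"
  shows "integrable lborel (\<lambda>y. \<phi> (x - y) *\<^sub>R f y)"
proof -
  note [measurable] = smooth_supp_measurable[OF assms(1)]
  obtain B where "\<And>x. \<bar>\<phi> x\<bar> \<le> B" using smooth_supp_bounded[OF assms(1)] by auto
  then show ?thesis
    by (intro integrable_bounded_scaleR[where g = "\<lambda>y. \<phi> (x - y)" and B = B] assms(2)) auto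
qed

text \<open>The definition puts the translation on the kernel, as differentiation requires; this
  form puts it on \<open>f\<close>, as Jensen's inequality and the continuity of translations
  require.\<close>

lemma conv_alt:
  assumes "smooth_supp R \<phi>" "integrable lborel f"
  shows "conv \<phi> f x = (LINT z|lborel. \<phi> z *\<^sub>R f (x - z))"
proof -
  note [measurable] = smooth_supp_measurable[OF assms(1)]
  have [measurable]: "f \<in> borel_measurable borel" using assms by auto
  show ?thesis
    unfolding conv_def by (subst integral_lborel_reflect[of _ x, symmetric]) simp_all
qed

lemma integrable_conv_alt:
  fixes f :: "real^'n \<Rightarrow> 'b::euclidean_space"
  assumes "smooth_supp R \<phi>" "integrable lborel f"
  shows "integrable lborel (\<lambda>z. \<phi> z *\<^sub>R f (x - z))"
  using integrable_lborel_reflect[where f = "\<lambda>y. \<phi> (x - y) *\<^sub>R f y" and z = x] integrable_conv[OF assms]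
  by simp

lemma conv_norm_le:
  assumes "smooth_supp R \<phi>" "integrable lborel f" "\<And>x. \<bar>\<phi> x\<bar> \<le> B"
  shows "norm (conv \<phi> f x) \<le> B * (LINT y|lborel. norm (f y))"
proof -
  have "norm (conv \<phi> f x) \<le> (LINT y|lborel. norm (\<phi> (x - y) *\<^sub>R f y))"
    unfolding conv_def by (rule integral_norm_bound)
  also have "\<dots> \<le> (LINT y|lborel. B * norm (f y))"
    using integrable_norm[OF integrable_conv[OF assms(1,2), of x]] assms(2,3)
    by (intro integral_mono) (auto intro!: mult_right_mono)
  finally show ?thesis by simp
qed

lemma conv_diff:
  assumes "smooth_supp R \<phi>" "integrable lborel f" "integrable lborel g"
  shows "conv \<phi> (\<lambda>x. f x - g x) x = conv \<phi> f x - conv \<phi> g x"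
  unfolding conv_def using assms by (simp add: scaleR_diff_right integrable_conv)

lemma conv_nth:
  fixes f :: "real^'n \<Rightarrow> 'b::euclidean_space^'m"
  assumes "smooth_supp R \<phi>" "integrable lborel f"
  shows "conv \<phi> f x $ i = conv \<phi> (\<lambda>x. f x $ i) x"
proof -
  have "conv \<phi> f x $ i = (LINT y|lborel. (\<phi> (x - y) *\<^sub>R f y) $ i)"
    unfolding conv_def using integral_bounded_linear[OF bounded_linear_vec_nth integrable_conv[OF assms]] by metis
  then show ?thesis by (simp add: conv_def)
qed

text \<open>The uniform expansion of the kernel is integrated against \<open>f\<close>, so the error
  is controlled by the L^1 norm of \<open>f\<close>.\<close>

lemma conv_has_derivative:
  assumes \<phi>: "smooth_supp R \<phi>" and f: "integrable lborel f"
  shows "(conv \<phi> f has_derivative (\<lambda>h. \<Sum>j\<in>UNIV. h $ j *\<^sub>R conv (partial_deriv j \<phi>) f x)) (at x)"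
  unfolding has_derivative_at_alt
proof (intro conjI allI impI)
  show "bounded_linear (\<lambda>h. \<Sum>j\<in>UNIV. h $ j *\<^sub>R conv (partial_deriv j \<phi>) f x)"
    by (intro bounded_linear_sum bounded_linear_scaleR_const bounded_linear_vec_nth)
  fix e :: real assume e: "e > 0"
  \<comment> \<open>The summand 1 keeps the divisor positive when f = 0.\<close>
  define F where "F = (LINT y|lborel. norm (f y)) + 1"
  have F: "F > 0" unfolding F_def by (intro add_nonneg_pos) auto
  obtain d where d: "d > 0" "\<And>z h. norm h < d \<Longrightarrow> \<bar>\<phi> (z + h) - \<phi> z - h \<bullet> grad \<phi> z\<bar> \<le> e / F * norm h"
    using uniformly_differentiable[OF \<phi>, of "e / F"] e F by (metis divide_pos_pos)
  have "norm (conv \<phi> f y - conv \<phi> f x - (\<Sum>j\<in>UNIV. (y - x) $ j *\<^sub>R conv (partial_deriv j \<phi>) f x)) \<le> e * norm (y - x)"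
    if y: "norm (y - x) < d" for y
  proof -
    define h where "h = y - x"
    have y_eq: "y = x + h" by (simp add: h_def)
    note ints = integrable_conv[OF \<phi> f] integrable_conv[OF smooth_supp_partial_deriv[OF \<phi>] f]
    have "conv \<phi> f y - conv \<phi> f x - (\<Sum>j\<in>UNIV. h $ j *\<^sub>R conv (partial_deriv j \<phi>) f x) =
      (LINT z|lborel. \<phi> (x + h - z) *\<^sub>R f z - \<phi> (x - z) *\<^sub>R f z - (\<Sum>j\<in>UNIV. h $ j *\<^sub>R partial_deriv j \<phi> (x - z) *\<^sub>R f z))"
      using ints by (simp add: conv_def y_eq del: scaleR_scaleR)
    also have "\<dots> = (LINT z|lborel. (\<phi> ((x - z) + h) - \<phi> (x - z) - h \<bullet> grad \<phi> (x - z)) *\<^sub>R f z)"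
      by (intro Bochner_Integration.integral_cong)
         (simp_all add: algebra_simps inner_vec_def grad_def scaleR_sum_left)
    finally have eq: "conv \<phi> f y - conv \<phi> f x - (\<Sum>j\<in>UNIV. h $ j *\<^sub>R conv (partial_deriv j \<phi>) f x) =
      (LINT z|lborel. (\<phi> ((x - z) + h) - \<phi> (x - z) - h \<bullet> grad \<phi> (x - z)) *\<^sub>R f z)" .
    have "norm (LINT z|lborel. (\<phi> ((x - z) + h) - \<phi> (x - z) - h \<bullet> grad \<phi> (x - z)) *\<^sub>R f z)
      \<le> (LINT z|lborel. (e / F * norm h) * norm (f z))"
    proof (rule order_trans[OF integral_norm_bound integral_mono])
      show "norm ((\<phi> ((x - z) + h) - \<phi> (x - z) - h \<bullet> grad \<phi> (x - z)) *\<^sub>R f z) \<le> (e / F * norm h) * norm (f z)" for z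
        unfolding norm_scaleR real_norm_def using y d(2)[of h "x - z"]
        by (intro mult_right_mono) (auto simp: h_def)
      show "integrable lborel (\<lambda>z. norm ((\<phi> ((x - z) + h) - \<phi> (x - z) - h \<bullet> grad \<phi> (x - z)) *\<^sub>R f z))"
      proof (rule integrable_norm)
        have "integrable lborel (\<lambda>z. \<phi> (x + h - z) *\<^sub>R f z - \<phi> (x - z) *\<^sub>R f z - (\<Sum>j\<in>UNIV. h $ j *\<^sub>R partial_deriv j \<phi> (x - z) *\<^sub>R f z))"
          using ints by (auto simp del: scaleR_scaleR)
        then show "integrable lborel (\<lambda>z. (\<phi> ((x - z) + h) - \<phi> (x - z) - h \<bullet> grad \<phi> (x - z)) *\<^sub>R f z)"
          by (simp add: algebra_simps inner_vec_def grad_def scaleR_sum_left)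
      qed
    qed (use f in auto)
    also have "\<dots> = (e / F * norm h) * (F - 1)" by (simp add: F_def)
    also have "\<dots> \<le> (e / F * norm h) * F" using e F by (intro mult_left_mono) auto
    also have "\<dots> = e * norm h" using F by simp
    finally show ?thesis using eq by (simp add: h_def)
  qed
  with d(1) show "\<exists>d>0. \<forall>y. norm (y - x) < d \<longrightarrow>
     norm (conv \<phi> f y - conv \<phi> f x - (\<Sum>j\<in>UNIV. (y - x) $ j *\<^sub>R conv (partial_deriv j \<phi>) f x)) \<le> e * norm (y - x)"
    by blast
qed

lemma continuous_on_conv:
  assumes "smooth_supp R \<phi>" "integrable lborel f"
  shows "continuous_on A (conv \<phi> f)"
  by (intro continuous_at_imp_continuous_on ballI has_derivative_continuous[OF conv_has_derivative[OF assms]])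

lemma partial_deriv_conv:
  fixes f :: "real^'n \<Rightarrow> real"
  assumes "smooth_supp R \<phi>" "integrable lborel f"
  shows "partial_deriv j (conv \<phi> f) = conv (partial_deriv j \<phi>) f"
proof
  fix x
  have "(\<Sum>i\<in>UNIV. axis j 1 $ i * conv (partial_deriv i \<phi>) f x) = (\<Sum>i\<in>UNIV. if i = j then conv (partial_deriv i \<phi>) f x else 0)"
    by (intro sum.cong) (auto simp: axis_def)
  then show "partial_deriv j (conv \<phi> f) x = conv (partial_deriv j \<phi>) f x"
    by (subst partial_deriv_eqI[OF conv_has_derivative[OF assms]]) simp
qed

lemma C_k_conv:
  fixes f :: "real^'n \<Rightarrow> real"
  assumes "smooth_supp R \<phi>" "integrable lborel f"
  shows "C_k k (conv \<phi> f)"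
  using assms
proof (induction k arbitrary: \<phi>)
  case 0
  then show ?case by (simp add: continuous_on_conv)
next
  case (Suc k)
  show ?case
    using conv_has_derivative[OF Suc.prems] Suc
    by (auto simp: partial_deriv_conv differentiable_def intro: smooth_supp_partial_deriv)
qed

lemma mollifier_smooth_supp: "mollifier r \<rho> \<Longrightarrow> smooth_supp r \<rho>"
  unfolding mollifier_def smooth_supp_def by (auto intro: less_imp_le)

text \<open>Since the kernel has integral 1, the constant c can be moved under the integral before
  Jensen's inequality is applied.\<close>

lemma Jensen_conv:
  assumes q: "1 \<le> q" and \<rho>: "mollifier r \<rho>" and f: "integrable lborel f"
  shows "pw q (conv \<rho> f x - c) \<le> (\<integral>\<^sup>+z. ennreal (\<rho> z) * pw q (f (x - z) - c) \<partial>lborel)"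
proof -
  have s: "smooth_supp r \<rho>" by (rule mollifier_smooth_supp[OF \<rho>])
  have int: "integrable lborel \<rho>"
    using \<rho> integrable_continuous_bounded_support[OF smooth_suppD(3)[OF s] smooth_suppD(4)[OF s]] by blast
  have [measurable]: "f \<in> borel_measurable borel" using f by auto
  have eq: "conv \<rho> f x - c = (LINT z|lborel. \<rho> z *\<^sub>R (f (x - z) - c))"
    unfolding conv_alt[OF s f] scaleR_diff_right using \<rho> int integrable_conv_alt[OF s f]
    by (subst Bochner_Integration.integral_diff) (auto simp: mollifier_def)
  show ?thesis
    unfolding eq
  proof (rule weighted_Jensen_pw[OF q])
    show "integrable lborel (\<lambda>z. \<rho> z *\<^sub>R (f (x - z) - c))"
      unfolding scaleR_diff_right using int integrable_conv_alt[OF s f] by auto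
  qed (use \<rho> int in \<open>auto simp: mollifier_def\<close>)
qed

text \<open>A mollification is an average of translates by \<open>z\<close> with |z| < r, so by
  Jensen and Fubini a bound uniform in these translates survives. The freedom in \<open>S\<close>,
  \<open>a\<close> and \<open>g\<close> covers the convergence of mollifications, their contraction
  property in L^q (g = 0), and comparison with a shifted limit on a compact set.\<close>

lemma conv_Lq_le:
  fixes f :: "real^'n \<Rightarrow> 'b::euclidean_space"
  assumes q: "1 \<le> q" and \<rho>: "mollifier r \<rho>" and f: "integrable lborel f"
    and [measurable]: "g \<in> borel_measurable borel" "S \<in> sets borel"
    and le: "\<And>z. norm z < r \<Longrightarrow> (\<integral>\<^sup>+x. indicator S x * pw q (f (x + a - z) - g x) \<partial>lborel) \<le> E"
  shows "(\<integral>\<^sup>+x. indicator S x * pw q (conv \<rho> f (x + a) - g x) \<partial>lborel) \<le> E"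
proof -
  have s: "smooth_supp r \<rho>" by (rule mollifier_smooth_supp[OF \<rho>])
  note [measurable] = smooth_supp_measurable[OF s]
  have [measurable]: "f \<in> borel_measurable borel" using f by auto
  have \<rho>1: "(\<integral>\<^sup>+z. ennreal (\<rho> z) \<partial>lborel) = 1"
  proof -
    have "integrable lborel \<rho>"
      using integrable_continuous_bounded_support[of \<rho> r] smooth_suppD(3,4)[OF s] by simp
    then show ?thesis using \<rho> by (simp add: nn_integral_eq_integral mollifier_def)
  qed
  have "(\<integral>\<^sup>+x. indicator S x * pw q (conv \<rho> f (x + a) - g x) \<partial>lborel)
     \<le> (\<integral>\<^sup>+x. (\<integral>\<^sup>+z. indicator S x * (ennreal (\<rho> z) * pw q (f (x + a - z) - g x)) \<partial>lborel) \<partial>lborel)"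
    using Jensen_conv[OF q \<rho> f] by (intro nn_integral_mono) (simp add: nn_integral_cmult mult_left_mono)
  also have "\<dots> = (\<integral>\<^sup>+z. (\<integral>\<^sup>+x. indicator S x * (ennreal (\<rho> z) * pw q (f (x + a - z) - g x)) \<partial>lborel) \<partial>lborel)"
    by (intro lborel_pair.Fubini'[symmetric]) measurable
  also have "\<dots> = (\<integral>\<^sup>+z. ennreal (\<rho> z) * (\<integral>\<^sup>+x. indicator S x * pw q (f (x + a - z) - g x) \<partial>lborel) \<partial>lborel)"
    by (intro nn_integral_cong) (simp add: nn_integral_cmult mult.left_commute flip: nn_integral_cmult)
  also have "\<dots> \<le> (\<integral>\<^sup>+z. ennreal (\<rho> z) * E \<partial>lborel)"
  proof (rule nn_integral_mono)
    fix z
    show "ennreal (\<rho> z) * (\<integral>\<^sup>+x. indicator S x * pw q (f (x + a - z) - g x) \<partial>lborel) \<le> ennreal (\<rho> z) * E"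
      using le[of z] \<rho> by (cases "\<rho> z = 0") (auto simp: mollifier_def intro: mult_left_mono)
  qed
  also have "\<dots> = E" by (simp add: nn_integral_multc \<rho>1)
  finally show ?thesis .
qed

lemma conv_tendsto_Lq:
  fixes f :: "real^'n \<Rightarrow> 'b::euclidean_space"
  assumes q: "1 \<le> q" and f: "integrable lborel f" "(\<integral>\<^sup>+x. pw q (f x) \<partial>lborel) < \<infinity>" and "0 < \<epsilon>"
  shows "\<exists>\<delta>>0. \<forall>r \<rho>. mollifier r \<rho> \<and> r \<le> \<delta> \<longrightarrow> (\<integral>\<^sup>+x. pw q (conv \<rho> f x - f x) \<partial>lborel) \<le> ennreal \<epsilon>"
proof -
  have [measurable]: "f \<in> borel_measurable borel" using f by auto
  obtain \<delta> where \<delta>: "\<delta> > 0" "\<And>z. norm z < \<delta> \<Longrightarrow> (\<integral>\<^sup>+x. pw q (f (x + z) - f x) \<partial>lborel) \<le> ennreal \<epsilon>"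
    using translation_continuous_Lq[OF q f \<open>0 < \<epsilon>\<close>] by metis
  have "(\<integral>\<^sup>+x. pw q (conv \<rho> f x - f x) \<partial>lborel) \<le> ennreal \<epsilon>" if "mollifier r \<rho>" "r \<le> \<delta>" for r \<rho>
    using conv_Lq_le[OF q that(1) f(1), of f UNIV 0 "ennreal \<epsilon>"] \<delta>(2)[of "- z" for z] that(2) by simp
  with \<delta>(1) show ?thesis by blast
qed

section \<open>Weak gradients\<close>

lemma smooth_supp_integrable: "smooth_supp R g \<Longrightarrow> integrable lborel g"
  using integrable_continuous_bounded_support[of g R] smooth_suppD(3,4)[of R g] by simp

text \<open>By translation invariance the integral of \<open>g (x + h) - g x\<close> is 0, and this
  difference is t times the partial derivative up to an error that is small relative to t, uniformly
  in x.\<close>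

lemma integral_partial_deriv_eq_0:
  assumes g: "smooth_supp R g"
  shows "(LINT x|lborel. partial_deriv j g x) = 0"
proof -
  have supp': "smooth_supp R (partial_deriv j g)" by (rule smooth_supp_partial_deriv[OF g])
  note int = smooth_supp_integrable[OF g] smooth_supp_integrable[OF supp']
  note [measurable] = smooth_supp_measurable[OF g]
  define V where "V = measure lborel (cball (0::real^'a) (R + 1)) + 1"
  have V: "V > 0" by (simp add: V_def add_nonneg_pos)
  have "\<bar>LINT x|lborel. partial_deriv j g x\<bar> \<le> e" if e: "e > 0" for e
  proof -
    obtain d where d: "d > 0" "\<And>z h. norm h < d \<Longrightarrow> \<bar>g (z + h) - g z - h \<bullet> grad g z\<bar> \<le> e / V * norm h"
      using uniformly_differentiable[OF g, of "e / V"] e V by (metis divide_pos_pos)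
    \<comment> \<open>With t <= 1 the translate of \<open>g\<close> is still supported in the ball
      of radius R + 1 whose volume enters \<open>V\<close>.\<close>
    define t where "t = min (d / 2) 1"
    define h where "h = t *\<^sub>R (axis j 1 :: real^'a)"
    have t: "0 < t" "t \<le> 1" "t < d" using d(1) by (auto simp: t_def)
    have nh: "norm h = t" using t by (simp add: h_def)
    have hg: "h \<bullet> grad g x = t * partial_deriv j g x" for x
      by (simp add: h_def grad_def inner_axis')
    have "\<bar>g (x + h) - g x - t * partial_deriv j g x\<bar> \<le> e / V * t * indicator (cball 0 (R + 1)) x" for x
    proof (cases "norm x \<le> R + 1")
      case True
      then show ?thesis using d(2)[of h x] t nh hg[of x] by simp
    next
      case False
      then have "norm (x + h) > R" using norm_triangle_ineq4[of "x + h" h] nh t by simp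
      then have "g (x + h) = 0" "g x = 0" "partial_deriv j g x = 0"
        using False smooth_suppD(4)[OF g, of "x + h"] smooth_suppD(4)[OF g, of x] smooth_suppD(4)[OF supp', of x] by force+
      then show ?thesis using e V t by simp
    qed
    note pt = this
    have i: "integrable lborel (\<lambda>x. \<bar>g (x + h) - g x - t * partial_deriv j g x\<bar>)"
      "integrable lborel (\<lambda>x. e / V * t * indicator (cball (0::real^'a) (R + 1)) x)"
      using int integrable_lborel_shift[OF int(1), of h]
      by (auto intro!: integrable_mult_right integrable_real_indicator emeasure_lborel_cball_finite simp del: times_divide_eq_left)
    have "\<bar>LINT x|lborel. (g (x + h) - g x - t * partial_deriv j g x)\<bar> \<le> (LINT x|lborel. \<bar>g (x + h) - g x - t * partial_deriv j g x\<bar>)"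
      by (rule integral_abs_bound)
    also have "\<dots> \<le> (LINT x|lborel. e / V * t * indicator (cball (0::real^'a) (R + 1)) x)"
      by (rule integral_mono[OF i]) (rule pt)
    also have "\<dots> = e / V * t * (V - 1)" by (simp add: V_def)
    also have "\<dots> \<le> e / V * t * V" using e V t by (intro mult_left_mono) auto
    also have "\<dots> = t * e" using V by simp
    also have "(LINT x|lborel. (g (x + h) - g x - t * partial_deriv j g x)) = - t * (LINT x|lborel. partial_deriv j g x)"
      using int integrable_lborel_shift[OF int(1), of h] by (simp add: integral_lborel_shift)
    finally show ?thesis using t by (simp add: abs_mult)
  qed
  then have "\<bar>LINT x|lborel. partial_deriv j g x\<bar> \<le> 0" by (rule dense_ge)
  then show ?thesis by simp
qed

lemma smooth_supp_mult:
  "smooth_supp R g \<Longrightarrow> (\<And>k. C_k k f) \<Longrightarrow> smooth_supp R (\<lambda>x. f x * g x)"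
  by (auto simp: smooth_supp_def intro: C_k_mult)

lemma integration_by_parts:
  assumes f: "\<And>k. C_k k f" and g: "smooth_supp R g"
  shows "(LINT x|lborel. f x * partial_deriv j g x) = - (LINT x|lborel. partial_deriv j f x * g x)"
proof -
  have "C_k (Suc k) f" for k by (rule f)
  then have f': "C_k k (partial_deriv j f)" "f differentiable (at x)" for k x by auto
  have s: "smooth_supp R (\<lambda>x. f x * partial_deriv j g x)" "smooth_supp R (\<lambda>x. partial_deriv j f x * g x)"
    using f f' g by (auto intro!: smooth_supp_mult smooth_supp_partial_deriv)
  have i: "integrable lborel (\<lambda>x. f x * partial_deriv j g x)" "integrable lborel (\<lambda>x. partial_deriv j f x * g x)"
    using s by (auto intro: smooth_supp_integrable)
  have "(LINT x|lborel. f x * partial_deriv j g x + partial_deriv j f x * g x) = 0"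
    using integral_partial_deriv_eq_0[OF smooth_supp_mult[OF g f], of j]
    by (simp add: partial_deriv_mult f'(2) smooth_suppD(2)[OF g])
  then show ?thesis using i by simp
qed

section \<open>Test functions and Borel representatives\<close>

lemma test_function_smooth_supp:
  assumes "test_function \<Omega> \<phi>"
  obtains R where "smooth_supp R \<phi>"
proof -
  have "bounded (closure {x. \<phi> x \<noteq> 0})"
    using assms compact_imp_bounded unfolding test_function_def by blast
  then obtain R where "\<forall>x\<in>closure {x. \<phi> x \<noteq> 0}. norm x \<le> R" unfolding bounded_iff by blast
  then have "\<forall>x. \<phi> x \<noteq> 0 \<longrightarrow> norm x \<le> R" using closure_subset[of "{x. \<phi> x \<noteq> 0}"] by blast
  moreover have "\<forall>k. C_k k \<phi>" using assms unfolding test_function_def by blast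
  ultimately have "smooth_supp R \<phi>" unfolding smooth_supp_def by blast
  then show ?thesis by (rule that)
qed

lemma smooth_supp_imp_test_function:
  assumes "\<And>k. C_k k \<phi>" "closed S" "bounded S" "S \<subseteq> \<Omega>" "\<And>x. \<phi> x \<noteq> 0 \<Longrightarrow> x \<in> S"
  shows "test_function \<Omega> \<phi>"
proof -
  have "closure {x. \<phi> x \<noteq> 0} \<subseteq> S" using assms(2,5) by (intro closure_minimal) auto
  then show ?thesis
    using assms bounded_subset[of S] by (auto simp: test_function_def compact_eq_bounded_closed)
qed

text \<open>This is the kernel of \<open>conv \<phi> f x\<close> as a function of the integration
  variable. It lets identities and limits against test functions pass to mollifications at points
  with room r.\<close>

lemma test_function_translate:
  assumes "smooth_supp r \<phi>" "cball x r \<subseteq> \<Omega>"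
  shows "test_function \<Omega> (\<lambda>y. \<phi> (x - y))"
proof (rule smooth_supp_imp_test_function[where S = "cball x r"])
  show "C_k k (\<lambda>y. \<phi> (x - y))" for k
    using C_k_affine[OF smooth_suppD(1)[OF assms(1)], of k x "-1"] by simp
  show "y \<in> cball x r" if "\<phi> (x - y) \<noteq> 0" for y
    using smooth_suppD(4)[OF assms(1) that] by (simp add: dist_norm)
qed (use assms in auto)

lemma test_function_eq_0: "test_function \<Omega> \<phi> \<Longrightarrow> x \<notin> \<Omega> \<Longrightarrow> \<phi> x = 0"
  unfolding test_function_def using closure_subset[of "{x. \<phi> x \<noteq> 0}"] by blast

lemma partial_deriv_test_function:
  assumes "test_function \<Omega> \<phi>"
  shows "test_function \<Omega> (partial_deriv j \<phi>)"
proof (rule smooth_supp_imp_test_function[where S = "closure {x. \<phi> x \<noteq> 0}"])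
  show "C_k k (partial_deriv j \<phi>)" for k
    using assms unfolding test_function_def by (metis C_k.simps(2))
  show "x \<in> closure {x. \<phi> x \<noteq> 0}" if "partial_deriv j \<phi> x \<noteq> 0" for x
  proof (rule ccontr)
    assume x: "x \<notin> closure {x. \<phi> x \<noteq> 0}"
    have "((\<lambda>x. 0) has_derivative (\<lambda>h. 0)) (at x)" by simp
    then have "(\<phi> has_derivative (\<lambda>h. 0)) (at x)"
      by (rule has_derivative_transform_within_open[where s = "- closure {x. \<phi> x \<noteq> 0}"])
        (use x closure_subset[of "{x. \<phi> x \<noteq> 0}"] in auto)
    with that show False by (simp add: partial_deriv_eqI)
  qed
qed (use assms in \<open>auto simp: test_function_def compact_imp_bounded\<close>)

lemma test_function_measurable: "test_function \<Omega> \<phi> \<Longrightarrow> \<phi> \<in> borel_measurable borel"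
  by (metis test_function_smooth_supp smooth_supp_measurable)

text \<open>The real-valued case is applied to each coordinate, and finitely many null sets are
  discarded.\<close>

lemma borel_representative:
  fixes f :: "'a::euclidean_space \<Rightarrow> 'b::euclidean_space"
  assumes "f \<in> borel_measurable lebesgue"
  shows "\<exists>g. g \<in> borel_measurable borel \<and> (AE x in lebesgue. f x = g x)"
proof -
  have "\<exists>g\<in>borel_measurable lborel. AE x in lborel. f x \<bullet> b = g x" for b
    by (rule completion_ex_borel_measurable_real) (use assms in measurable)
  then obtain g where g: "\<And>b. g b \<in> borel_measurable lborel" "\<And>b. AE x in lborel. f x \<bullet> b = g b x" by metis
  have [measurable]: "g b \<in> borel_measurable borel" for b using g(1) by simp
  have "AE x in lborel. \<forall>b\<in>Basis. f x \<bullet> b = g b x"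
    using g(2) by (intro AE_finite_allI) auto
  then have "AE x in lborel. f x = (\<Sum>b\<in>Basis. g b x *\<^sub>R b)"
    by (rule AE_mp) (intro AE_I2 impI, simp add: euclidean_eq_iff[where 'a = 'b])
  then have "AE x in lebesgue. f x = (\<Sum>b\<in>Basis. g b x *\<^sub>R b)" by (rule AE_completion)
  moreover have "(\<lambda>x. \<Sum>b\<in>Basis. g b x *\<^sub>R b) \<in> borel_measurable borel" by measurable
  ultimately show ?thesis by blast
qed

lemma integrable_borel_representative:
  fixes f :: "'a::euclidean_space \<Rightarrow> 'b::euclidean_space"
  assumes "integrable lebesgue f"
  shows "\<exists>g. integrable lborel g \<and> (AE x in lebesgue. f x = g x)"
proof -
  obtain g where g: "g \<in> borel_measurable borel" "AE x in lebesgue. f x = g x"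
    using borel_representative[OF borel_measurable_integrable[OF assms]] by blast
  have "integrable lebesgue g"
    using assms g by (subst integrable_cong_AE[of g _ f]) (auto simp: measurable_completion)
  then have "integrable lborel g" using g(1) by (subst (asm) integrable_completion) auto
  with g(2) show ?thesis by blast
qed

section \<open>Neighbourhoods of compact sets and uniqueness of weak gradients\<close>

lemma compact_neighbourhood:
  fixes K :: "'a::euclidean_space set"
  assumes "compact K" "open \<Omega>" "K \<subseteq> \<Omega>"
  obtains r where "0 < r" "\<And>x. x \<in> K \<Longrightarrow> cball x r \<subseteq> \<Omega>"
proof -
  obtain d where d: "d > 0" "\<forall>x\<in>K. \<forall>y\<in>- \<Omega>. d \<le> dist x y"
    using separate_compact_closed[OF assms(1) closed_Compl[OF assms(2)]] assms(3) by blast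
  have "cball x (d / 2) \<subseteq> \<Omega>" if "x \<in> K" for x
  proof
    fix y assume "y \<in> cball x (d / 2)"
    then have "\<not> d \<le> dist x y" using d(1) by simp
    then show "y \<in> \<Omega>" using d(2) that by blast
  qed
  with d(1) show ?thesis by (intro that[of "d / 2"]) auto
qed

text \<open>The neighbourhood is written as a Minkowski sum with a closed ball, which makes its
  compactness immediate.\<close>

definition nbhd :: "'a::euclidean_space set \<Rightarrow> real \<Rightarrow> 'a set" where
  "nbhd K r = {x + y |x y. x \<in> K \<and> y \<in> cball 0 r}"

lemma nbhdI: "x \<in> K \<Longrightarrow> norm z \<le> r \<Longrightarrow> x + z \<in> nbhd K r"
  by (auto simp: nbhd_def)

lemma compact_nbhd: "compact K \<Longrightarrow> compact (nbhd K r)"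
  unfolding nbhd_def by (intro compact_sums) auto

lemma nbhd_nbhd: "x \<in> nbhd K r \<Longrightarrow> norm z \<le> s \<Longrightarrow> x + z \<in> nbhd K (r + s)"
  unfolding nbhd_def
proof safe
  fix k y :: 'a assume "norm z \<le> s" "k \<in> K" "y \<in> cball 0 r"
  then show "\<exists>x' y'. k + y + z = x' + y' \<and> x' \<in> K \<and> y' \<in> cball 0 (r + s)"
    using norm_triangle_mono[of y r z s] by (intro exI[of _ k] exI[of _ "y + z"]) auto
qed

lemma nbhd_mono:
  assumes "r \<le> s"
  shows "nbhd K r \<subseteq> nbhd K s"
proof
  fix x assume "x \<in> nbhd K r"
  then obtain k z where "x = k + z" "k \<in> K" "norm z \<le> r" by (auto simp: nbhd_def)
  then show "x \<in> nbhd K s" using nbhdI[of k K z s] assms by simp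
qed

lemma subset_nbhd: "0 \<le> r \<Longrightarrow> K \<subseteq> nbhd K r"
  using nbhdI[of _ K 0 r] by auto

lemma nbhd_borel: "compact K \<Longrightarrow> nbhd K r \<in> sets borel"
  using compact_nbhd borel_compact by blast

text \<open>The fundamental lemma of the calculus of variations. At points of a compact set,
  mollifications of f at a small scale are integrals against test functions and hence 0, while they
  converge to f in L^1.\<close>

lemma AE_zero_if_test_integrals_zero:
  fixes f :: "real^'n \<Rightarrow> real"
  assumes \<Omega>: "open \<Omega>" and f: "locally_integrable \<Omega> f"
    and zero: "\<And>\<phi>. test_function \<Omega> \<phi> \<Longrightarrow> (LINT x:\<Omega>|lebesgue. f x * \<phi> x) = 0"
  shows "AE x in lebesgue. x \<in> \<Omega> \<longrightarrow> f x = 0"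
proof -
  have compact_case: "AE x in lebesgue. x \<in> K \<longrightarrow> f x = 0" if K: "compact K" "K \<subseteq> \<Omega>" for K
  proof -
    obtain r where r: "0 < r" "\<And>x. x \<in> K \<Longrightarrow> cball x r \<subseteq> \<Omega>"
      using compact_neighbourhood[OF K(1) \<Omega> K(2)] by metis
    have sub: "nbhd K r \<subseteq> \<Omega>"
    proof
      fix w assume "w \<in> nbhd K r"
      then obtain x y where "w = x + y" "x \<in> K" "norm y \<le> r" by (auto simp: nbhd_def)
      then have "w \<in> cball x r" by (simp add: dist_norm)
      then show "w \<in> \<Omega>" using r(2) \<open>x \<in> K\<close> by blast
    qed
    \<comment> \<open>Cutting f off outside a neighbourhood of \<open>K\<close> makes it integrable
      on the whole space; kernels of radius at most r centred in \<open>K\<close> do not see the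
      cut.\<close>
    have "integrable lebesgue (\<lambda>x. indicator (nbhd K r) x *\<^sub>R f x)"
      using f compact_nbhd[OF K(1)] sub by (auto simp: locally_integrable_def set_integrable_def)
    then obtain g where g: "integrable lborel g" "AE x in lebesgue. indicator (nbhd K r) x *\<^sub>R f x = g x"
      using integrable_borel_representative by blast
    have [measurable]: "g \<in> borel_measurable borel" "K \<in> sets borel" using g(1) K borel_compact by auto
    have conv0: "conv \<rho> g x = 0" if \<rho>: "mollifier s \<rho>" "s \<le> r" and x: "x \<in> K" for \<rho> s x
    proof -
      have s: "smooth_supp s \<rho>" by (rule mollifier_smooth_supp[OF \<rho>(1)])
      note [measurable] = smooth_supp_measurable[OF s]
      have "cball x s \<subseteq> cball x r" using \<rho>(2) by auto
      then have "test_function \<Omega> (\<lambda>y. \<rho> (x - y))"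
        using test_function_translate[OF s] r(2)[OF x] by blast
      from zero[OF this] have 0: "(LINT y|lebesgue. indicator \<Omega> y *\<^sub>R (f y * \<rho> (x - y))) = 0"
        by (simp add: set_lebesgue_integral_def)
      have "conv \<rho> g x = (LINT y|lebesgue. \<rho> (x - y) *\<^sub>R g y)"
        unfolding conv_def by (rule integral_completion[symmetric]) measurable
      also have "\<dots> = (LINT y|lebesgue. \<rho> (x - y) *\<^sub>R (indicator (nbhd K r) y *\<^sub>R f y))"
      proof (rule integral_cong_AE)
        have m: "(\<lambda>y. \<rho> (x - y)) \<in> borel_measurable lebesgue" by (rule measurable_completion) measurable
        have "g \<in> borel_measurable lebesgue" by (rule measurable_completion) measurable
        with m show "(\<lambda>y. \<rho> (x - y) *\<^sub>R g y) \<in> borel_measurable lebesgue" by (rule borel_measurable_scaleR)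
        show "(\<lambda>y. \<rho> (x - y) *\<^sub>R (indicator (nbhd K r) y *\<^sub>R f y)) \<in> borel_measurable lebesgue"
          using borel_measurable_integrable[OF \<open>integrable lebesgue (\<lambda>x. indicator (nbhd K r) x *\<^sub>R f x)\<close>]
          by (rule borel_measurable_scaleR[OF m])
        show "AE y in lebesgue. \<rho> (x - y) *\<^sub>R g y = \<rho> (x - y) *\<^sub>R (indicator (nbhd K r) y *\<^sub>R f y)"
          using g(2) by eventually_elim simp
      qed
      also have "\<dots> = (LINT y|lebesgue. indicator \<Omega> y *\<^sub>R (f y * \<rho> (x - y)))"
      proof (rule Bochner_Integration.integral_cong[OF refl])
        fix y
        have "y \<in> nbhd K r" if "\<rho> (x - y) \<noteq> 0"
          using smooth_suppD(4)[OF s that] nbhdI[OF x, of "y - x" r] \<rho>(2) by (simp add: norm_minus_commute)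
        then show "\<rho> (x - y) *\<^sub>R (indicator (nbhd K r) y *\<^sub>R f y) = indicator \<Omega> y *\<^sub>R (f y * \<rho> (x - y))"
          using sub by (cases "\<rho> (x - y) = 0") (auto simp: mult.commute indicator_def)
      qed
      finally show ?thesis using 0 by simp
    qed
    have fin: "(\<integral>\<^sup>+x. pw 1 (g x) \<partial>lborel) < \<infinity>" using g(1) by (simp add: pw_def integrable_iff_bounded)
    have small: "(\<integral>\<^sup>+x. indicator K x * pw 1 (g x) \<partial>lborel) \<le> ennreal e" if e: "e > 0" for e
    proof -
      obtain \<delta> where \<delta>: "\<delta> > 0" "\<And>r \<rho>. mollifier r \<rho> \<Longrightarrow> r \<le> \<delta> \<Longrightarrow> (\<integral>\<^sup>+x. pw 1 (conv \<rho> g x - g x) \<partial>lborel) \<le> ennreal e"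
        using conv_tendsto_Lq[OF _ g(1) fin e] by auto
      define s where "s = min \<delta> r"
      obtain \<rho> :: "real^'n \<Rightarrow> real" where \<rho>: "mollifier s \<rho>"
        using exists_mollifier[of s] \<delta>(1) r(1) by (auto simp: s_def)
      have "(\<integral>\<^sup>+x. indicator K x * pw 1 (g x) \<partial>lborel) \<le> (\<integral>\<^sup>+x. pw 1 (conv \<rho> g x - g x) \<partial>lborel)"
        using conv0[OF \<rho>] by (intro nn_integral_mono) (auto simp: s_def indicator_def pw_minus)
      also have "\<dots> \<le> ennreal e" using \<delta>(2)[OF \<rho>] by (simp add: s_def)
      finally show ?thesis .
    qed
    have "(\<integral>\<^sup>+x. indicator K x * pw 1 (g x) \<partial>lborel) \<le> 0"
      by (rule ennreal_le_epsilon) (unfold add_0, rule small)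
    then have "(\<integral>\<^sup>+x. indicator K x * pw 1 (g x) \<partial>lborel) = 0" by simp
    then have "AE x in lborel. indicator K x * pw 1 (g x) = 0"
      by (subst (asm) nn_integral_0_iff_AE) auto
    then have "AE x in lebesgue. indicator K x * pw 1 (g x) = 0" by (rule AE_completion)
    with g(2) show ?thesis
    proof eventually_elim
      case (elim x)
      then show ?case using subset_nbhd[of r K] r(1) by (auto simp: pw_def indicator_def split: if_splits)
    qed
  qed
  \<comment> \<open>Countably many closed boxes exhaust the open set, so only countably many null
    sets have to be united.\<close>
  obtain D where D: "countable D" "D \<subseteq> Pow \<Omega>" "\<And>X. X \<in> D \<Longrightarrow> \<exists>a b. X = cbox a b" "\<Union>D = \<Omega>"
    using open_countable_Union_open_cbox[OF \<Omega>] by metis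
  have "AE x in lebesgue. \<forall>X\<in>D. x \<in> X \<longrightarrow> f x = 0"
  proof (rule AE_ball_countable')
    fix X assume "X \<in> D"
    then have "compact X" "X \<subseteq> \<Omega>" using D(2,3) compact_cbox by blast+
    then show "AE x in lebesgue. x \<in> X \<longrightarrow> f x = 0" by (rule compact_case)
  qed (rule D(1))
  then show ?thesis
  proof eventually_elim
    case (elim x)
    with D(4) show ?case by blast
  qed
qed

text \<open>Both gradients have the same integrals against test functions, so the fundamental lemma
  applies to each entry of the difference. It allows \<open>weak_gradient\<close>, which is picked
  by choice, to be replaced by an explicit gradient under an integral.\<close>

lemma AE_weak_gradient_unique:
  assumes "open \<Omega>" "has_weak_gradient \<Omega> u G" "has_weak_gradient \<Omega> u H"
  shows "AE x in lebesgue. x \<in> \<Omega> \<longrightarrow> G x = H x"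
proof -
  have comp: "AE x in lebesgue. x \<in> \<Omega> \<longrightarrow> G x $ i $ j - H x $ i $ j = 0" for i j
  proof (rule AE_zero_if_test_integrals_zero[OF assms(1)])
    have li: "set_integrable lebesgue K (\<lambda>x. F x $ i $ j)" if "locally_integrable \<Omega> F" "compact K" "K \<subseteq> \<Omega>" for K and F :: "real^'a \<Rightarrow> real^'a^'b"
    proof -
      have "integrable lebesgue (\<lambda>x. indicator K x *\<^sub>R F x)"
        using that by (auto simp: locally_integrable_def set_integrable_def)
      from integrable_bounded_linear[OF bounded_linear_vec_nth integrable_bounded_linear[OF bounded_linear_vec_nth this]]
      show ?thesis by (simp add: set_integrable_def)
    qed
    have G: "locally_integrable \<Omega> G" "locally_integrable \<Omega> H" using assms by (auto simp: has_weak_gradient_def)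
    show "locally_integrable \<Omega> (\<lambda>x. G x $ i $ j - H x $ i $ j)"
      unfolding locally_integrable_def using li G by (auto intro!: set_integral_diff(1))
    fix \<phi> :: "real^'a \<Rightarrow> real" assume \<phi>: "test_function \<Omega> \<phi>"
    define K where "K = closure {x. \<phi> x \<noteq> 0}"
    have K: "compact K" "K \<subseteq> \<Omega>" using \<phi> by (auto simp: test_function_def K_def)
    obtain R where R: "smooth_supp R \<phi>" using test_function_smooth_supp[OF \<phi>] by metis
    obtain B where B: "\<And>x. \<bar>\<phi> x\<bar> \<le> B" using smooth_supp_bounded[OF R] by auto
    \<comment> \<open>Integrability of both products is needed to split the integral of the
      difference; it follows from local integrability on the support \<open>K\<close> and the
      boundedness of the test function.\<close>
    have int: "set_integrable lebesgue \<Omega> (\<lambda>x. F x $ i $ j * \<phi> x)" if F: "locally_integrable \<Omega> F" for F :: "real^'a \<Rightarrow> real^'a^'b"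
    proof -
      have *: "integrable lebesgue (\<lambda>x. indicator K x *\<^sub>R F x $ i $ j)"
        using li[OF F K] by (simp add: set_integrable_def)
      have "integrable lebesgue (\<lambda>x. (indicator K x *\<^sub>R F x $ i $ j) * \<phi> x)"
      proof (rule Bochner_Integration.integrable_bound)
        show "integrable lebesgue (\<lambda>x. B * (indicator K x *\<^sub>R F x $ i $ j))" using * by simp
        show "(\<lambda>x. (indicator K x *\<^sub>R F x $ i $ j) * \<phi> x) \<in> borel_measurable lebesgue"
          using borel_measurable_integrable[OF *]
          by (rule borel_measurable_times)
            (intro measurable_completion, use test_function_measurable[OF \<phi>] in simp)
        have "\<bar>F x $ i $ j\<bar> * \<bar>\<phi> x\<bar> \<le> \<bar>B\<bar> * \<bar>F x $ i $ j\<bar>" for x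
          using mult_right_mono[OF B[of x], of "\<bar>F x $ i $ j\<bar>"] by (simp add: mult.commute) (smt (verit) abs_ge_self mult_right_mono abs_ge_zero)
        then show "AE x in lebesgue. norm ((indicator K x *\<^sub>R F x $ i $ j) * \<phi> x) \<le> norm (B * (indicator K x *\<^sub>R F x $ i $ j))"
          by (auto simp: abs_mult indicator_def)
      qed
      moreover have "(\<lambda>x. (indicator K x *\<^sub>R F x $ i $ j) * \<phi> x) = (\<lambda>x. indicator \<Omega> x *\<^sub>R (F x $ i $ j * \<phi> x))"
      proof
        fix x
        show "(indicator K x *\<^sub>R F x $ i $ j) * \<phi> x = indicator \<Omega> x *\<^sub>R (F x $ i $ j * \<phi> x)"
          using K closure_subset[of "{x. \<phi> x \<noteq> 0}"] by (cases "\<phi> x = 0") (auto simp: indicator_def K_def)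
      qed
      ultimately show ?thesis unfolding set_integrable_def by simp
    qed
    have "(LINT x:\<Omega>|lebesgue. G x $ i $ j * \<phi> x) = (LINT x:\<Omega>|lebesgue. H x $ i $ j * \<phi> x)"
    proof -
      have "(LINT x:\<Omega>|lebesgue. u x $ i * partial_deriv j \<phi> x) = - (LINT x:\<Omega>|lebesgue. G x $ i $ j * \<phi> x)"
        using assms(2) \<phi> unfolding has_weak_gradient_def by blast
      moreover have "(LINT x:\<Omega>|lebesgue. u x $ i * partial_deriv j \<phi> x) = - (LINT x:\<Omega>|lebesgue. H x $ i $ j * \<phi> x)"
        using assms(3) \<phi> unfolding has_weak_gradient_def by blast
      ultimately show ?thesis by simp
    qed
    then show "(LINT x:\<Omega>|lebesgue. (G x $ i $ j - H x $ i $ j) * \<phi> x) = 0"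
      using int[OF G(1)] int[OF G(2)] by (simp add: left_diff_distrib set_integral_diff(2))
  qed
  have "AE x in lebesgue. \<forall>i\<in>UNIV. \<forall>j\<in>UNIV. x \<in> \<Omega> \<longrightarrow> G x $ i $ j - H x $ i $ j = 0"
    using comp by (intro AE_finite_allI) auto
  then show ?thesis by (rule AE_mp) (intro AE_I2, simp add: vec_eq_iff)
qed

section \<open>Quasiconvexity\<close>

definition smooth_map :: "(real^'n \<Rightarrow> real^'m) \<Rightarrow> bool" where
  "smooth_map w \<longleftrightarrow> (\<forall>k i. C_k k (\<lambda>x. w x $ i))"

definition jac :: "(real^'n \<Rightarrow> real^'m) \<Rightarrow> real^'n \<Rightarrow> real^'n^'m" where
  "jac w x = (\<chi> i j. partial_deriv j (\<lambda>y. w y $ i) x)"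

lemma smooth_mapD:
  assumes "smooth_map w"
  shows "C_k k (\<lambda>x. w x $ i)" "(\<lambda>x. w x $ i) differentiable (at x)" "C_k k (partial_deriv j (\<lambda>x. w x $ i))"
proof -
  have "C_k (Suc k) (\<lambda>x. w x $ i)" using assms unfolding smooth_map_def by blast
  then show "(\<lambda>x. w x $ i) differentiable (at x)" "C_k k (partial_deriv j (\<lambda>x. w x $ i))" by auto
  show "C_k k (\<lambda>x. w x $ i)" using assms unfolding smooth_map_def by blast
qed

lemma continuous_on_smooth_map: "smooth_map w \<Longrightarrow> continuous_on UNIV w"
  using continuous_on_vec_lambda[of UNIV "\<lambda>i x. w x $ i"] C_k_continuous[OF smooth_mapD(1)] by auto

lemma continuous_on_jac: "smooth_map w \<Longrightarrow> continuous_on UNIV (jac w)"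
  unfolding jac_def by (intro continuous_on_vec_lambda C_k_continuous[OF smooth_mapD(3)])

lemma smooth_map_has_derivative:
  assumes "smooth_map w"
  shows "(w has_derivative (\<lambda>h. jac w x *v h)) (at x)"
proof -
  have "((\<lambda>y. w y $ i) has_derivative (\<lambda>h. (jac w x *v h) $ i)) (at x)" for i
    using has_derivative_partial_deriv[OF smooth_mapD(2)[OF assms]]
    by (simp add: jac_def matrix_vector_mult_def mult.commute)
  then show ?thesis
    by (subst has_derivative_componentwise_within) (auto simp: Basis_vec_def inner_axis)
qed

lemma integrable_lebesgue_of_lborel:
  fixes f :: "'a::euclidean_space \<Rightarrow> 'b::{banach,second_countable_topology}"
  shows "integrable lborel f \<Longrightarrow> integrable lebesgue f"
  by (subst integrable_completion) auto

lemma locally_integrable_continuous: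
  assumes "continuous_on UNIV f"
  shows "locally_integrable \<Omega> f"
  unfolding locally_integrable_def set_integrable_def
proof (intro allI impI integrable_lebesgue_of_lborel)
  fix K assume "compact K \<and> K \<subseteq> \<Omega>"
  then show "integrable lborel (\<lambda>x. indicator K x *\<^sub>R f x)"
    by (intro borel_integrable_compact continuous_on_subset[OF assms]) auto
qed

lemma set_lebesgue_integral_test:
  assumes [measurable]: "f \<in> borel_measurable borel" and \<phi>: "test_function \<Omega> \<phi>"
  shows "(LINT x:\<Omega>|lebesgue. f x * \<phi> x) = (LINT x|lborel. f x * \<phi> x)"
proof -
  note [measurable] = test_function_measurable[OF \<phi>]
  have "(\<lambda>x. indicator \<Omega> x *\<^sub>R (f x * \<phi> x)) = (\<lambda>x. f x * \<phi> x)"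
  proof
    show "indicator \<Omega> x *\<^sub>R (f x * \<phi> x) = f x * \<phi> x" for x
      using test_function_eq_0[OF \<phi>, of x] by (auto simp: indicator_def)
  qed
  then show ?thesis by (simp add: set_lebesgue_integral_def integral_completion)
qed

lemma smooth_map_has_weak_gradient:
  assumes w: "smooth_map w"
  shows "has_weak_gradient \<Omega> w (jac w)"
  unfolding has_weak_gradient_def
proof (intro conjI allI impI)
  show "locally_integrable \<Omega> w" "locally_integrable \<Omega> (jac w)"
    using locally_integrable_continuous continuous_on_smooth_map[OF w] continuous_on_jac[OF w] by auto
  fix \<phi> i j assume \<phi>: "test_function \<Omega> \<phi>"
  obtain R where R: "smooth_supp R \<phi>" using test_function_smooth_supp[OF \<phi>] by metis
  have m: "(\<lambda>x. w x $ i) \<in> borel_measurable borel" "(\<lambda>x. jac w x $ i $ j) \<in> borel_measurable borel"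
    using C_k_continuous[OF smooth_mapD(1)[OF w]] C_k_continuous[OF smooth_mapD(3)[OF w]]
    by (auto simp: jac_def intro: borel_measurable_continuous_onI)
  have "(LINT x:\<Omega>|lebesgue. w x $ i * partial_deriv j \<phi> x) = (LINT x|lborel. w x $ i * partial_deriv j \<phi> x)"
    by (rule set_lebesgue_integral_test[OF m(1) partial_deriv_test_function[OF \<phi>]])
  also have "\<dots> = - (LINT x|lborel. jac w x $ i $ j * \<phi> x)"
    using integration_by_parts[OF smooth_mapD(1)[OF w] R] by (simp add: jac_def)
  also have "\<dots> = - (LINT x:\<Omega>|lebesgue. jac w x $ i $ j * \<phi> x)"
    using set_lebesgue_integral_test[OF m(2) \<phi>] by simp
  finally show "(LINT x:\<Omega>|lebesgue. w x $ i * partial_deriv j \<phi> x) = - (LINT x:\<Omega>|lebesgue. jac w x $ i $ j * \<phi> x)" .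
qed

lemma Lp_space_continuous:
  fixes f :: "real^'n \<Rightarrow> 'b::euclidean_space"
  assumes "continuous_on UNIV f" "\<And>x. f x \<noteq> 0 \<Longrightarrow> norm x \<le> R" "open \<Omega>" "0 < q"
  shows "f \<in> Lp_space q \<Omega>"
proof -
  have "f \<in> borel_measurable lebesgue"
    using borel_measurable_continuous_onI[OF assms(1)] by (intro measurable_completion) simp
  then have 1: "f \<in> borel_measurable (lebesgue_on \<Omega>)" by (rule measurable_restrict_space1)
  have "continuous_on UNIV (\<lambda>x. norm (f x) powr q)"
    using assms(1,4) by (intro continuous_on_powr' continuous_intros) auto
  then have "integrable lborel (\<lambda>x. norm (f x) powr q)"
    using assms(2) by (intro integrable_continuous_bounded_support[where R = R]) auto
  then have "integrable lborel (\<lambda>x. indicator \<Omega> x *\<^sub>R (norm (f x) powr q))"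
    using assms(3) by (intro integrable_mult_indicator) auto
  then have "integrable (lebesgue_on \<Omega>) (\<lambda>x. norm (f x) powr q)"
    using assms(3) by (subst integrable_restrict_space) (auto intro: integrable_lebesgue_of_lborel)
  with 1 show ?thesis by (simp add: Lp_space_def)
qed

lemma smooth_map_supp:
  assumes "\<And>i. test_function \<Omega> (\<lambda>x. \<phi> x $ i)"
  obtains R where "\<And>x. \<phi> x \<noteq> 0 \<Longrightarrow> norm x \<le> R" "\<And>x. jac \<phi> x \<noteq> 0 \<Longrightarrow> norm x \<le> R" "smooth_map \<phi>"
proof -
  obtain R where R: "\<And>i. smooth_supp (R i) (\<lambda>x. \<phi> x $ i)"
  proof -
    have "\<exists>R. smooth_supp R (\<lambda>x. \<phi> x $ i)" for i by (rule test_function_smooth_supp[OF assms[of i]]) blast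
    then show ?thesis using that by metis
  qed
  define M where "M = Max (range R)"
  have M: "R i \<le> M" for i by (simp add: M_def)
  have supp: "smooth_supp M (\<lambda>x. \<phi> x $ i)" for i
    unfolding smooth_supp_def
    using smooth_suppD(1)[OF R[of i]] smooth_suppD(4)[OF R[of i]] order_trans[OF _ M[of i]] by blast
  show ?thesis
  proof (rule that[of M])
    show "norm x \<le> M" if "\<phi> x \<noteq> 0" for x
      using that smooth_suppD(4)[OF supp] by (auto simp: vec_eq_iff)
    show "norm x \<le> M" if "jac \<phi> x \<noteq> 0" for x
      using that smooth_suppD(4)[OF smooth_supp_partial_deriv[OF supp]] by (auto simp: vec_eq_iff jac_def)
    show "smooth_map \<phi>" using smooth_suppD(1)[OF supp] by (simp add: smooth_map_def)
  qed
qed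

lemma nn_integral_lebesgue_on:
  assumes "\<Omega> \<in> sets borel"
  shows "(\<integral>\<^sup>+x. f x \<partial>lebesgue_on \<Omega>) = (\<integral>\<^sup>+x. indicator \<Omega> x * f x \<partial>lborel)"
  using assms by (subst nn_integral_restrict_space) (auto simp: nn_integral_completion mult.commute)

lemma AE_lebesgue_on:
  assumes "\<Omega> \<in> sets borel"
  shows "(AE x in lebesgue_on \<Omega>. P x) \<longleftrightarrow> (AE x in lebesgue. x \<in> \<Omega> \<longrightarrow> P x)"
  using assms by (subst AE_restrict_space_iff) auto

lemma weak_gradient_has_weak_gradient:
  "has_weak_gradient \<Omega> u G \<Longrightarrow> has_weak_gradient \<Omega> u (weak_gradient \<Omega> u)"
  unfolding weak_gradient_def by (rule someI[of "has_weak_gradient \<Omega> u"])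

lemma partial_deriv_linear: "partial_deriv j (\<lambda>y. (\<xi> *v y) $ i) = (\<lambda>y. \<xi> $ i $ j)"
proof
  fix y
  have "((\<lambda>y. (\<xi> *v y) $ i) has_derivative (\<lambda>h. (\<xi> *v h) $ i)) (at y)"
    by (intro bounded_linear_imp_has_derivative bounded_linear_compose[OF bounded_linear_vec_nth]) simp
  from partial_deriv_eqI[OF this, of j] show "partial_deriv j (\<lambda>y. (\<xi> *v y) $ i) y = \<xi> $ i $ j"
    by (simp add: matrix_vector_mul_component inner_axis)
qed

lemma smooth_map_linear: "smooth_map (\<lambda>y. \<xi> *v y)"
  unfolding smooth_map_def matrix_vector_mult_def
  by (auto intro!: C_k_sum C_k_mult C_k_const C_k_coordinate)

lemma smooth_map_add: "smooth_map v \<Longrightarrow> smooth_map w \<Longrightarrow> smooth_map (\<lambda>x. v x + w x)"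
  by (simp add: smooth_map_def C_k_add)

lemma jac_add: "smooth_map v \<Longrightarrow> smooth_map w \<Longrightarrow> jac (\<lambda>x. v x + w x) x = jac v x + jac w x"
  by (simp add: jac_def vec_eq_iff partial_deriv_add smooth_mapD(2))

text \<open>Even for the zero function \<open>weak_gradient\<close> is only some admissible choice,
  so it vanishes almost everywhere by uniqueness and not by computation.\<close>

lemma W1p_norm_zero:
  assumes "open \<Omega>"
  shows "W1p_norm q \<Omega> (\<lambda>x. 0) = 0"
proof -
  have "smooth_map (\<lambda>x. 0)" by (simp add: smooth_map_def)
  from smooth_map_has_weak_gradient[OF this, of \<Omega>]
  have h0: "has_weak_gradient \<Omega> (\<lambda>x. 0) (\<lambda>x. 0)"
    using partial_deriv_linear[of _ "0::real^'a^'b"] by (simp add: jac_def[abs_def] zero_vec_def[symmetric])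
  have "AE x in lebesgue. x \<in> \<Omega> \<longrightarrow> weak_gradient \<Omega> (\<lambda>x. 0) x = (0::real^'a^'b)"
    by (rule AE_weak_gradient_unique[OF assms weak_gradient_has_weak_gradient[OF h0] h0])
  then have "AE x in lebesgue_on \<Omega>. norm (weak_gradient \<Omega> (\<lambda>x. 0) x :: real^'a^'b) powr q = 0"
    using assms by (subst AE_lebesgue_on) auto
  then have "(LINT x|lebesgue_on \<Omega>. norm (weak_gradient \<Omega> (\<lambda>x. 0) x :: real^'a^'b) powr q) = 0"
    by (rule integral_eq_zero_AE)
  then show ?thesis by (simp add: W1p_norm_def)
qed

text \<open>A test field is its own approximation in the definition of \<open>W1p_0\<close>, so it
  is admissible in the quasiconvexity inequality; uniqueness then replaces the weak gradient by the
  classical one. Here the quasiconvexity hypothesis is unfolded once and for all.\<close>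

lemma quasiconvex_test_function:
  fixes L :: "real^'n^'m \<Rightarrow> ennreal"
  assumes L: "W1q_quasiconvex q L" and q: "0 < q"
    and \<phi>: "\<And>i. test_function unit_cube (\<lambda>x. \<phi> x $ i)"
  shows "L \<xi> \<le> (\<integral>\<^sup>+x. indicator unit_cube x * L (\<xi> + jac \<phi> x) \<partial>lborel)"
proof -
  have op: "open (unit_cube :: (real^'n) set)" by (simp add: unit_cube_def open_box)
  then have bor: "(unit_cube :: (real^'n) set) \<in> sets borel" by simp
  obtain R where R: "\<And>x. \<phi> x \<noteq> 0 \<Longrightarrow> norm x \<le> R" "\<And>x. jac \<phi> x \<noteq> 0 \<Longrightarrow> norm x \<le> R" "smooth_map \<phi>"
    using smooth_map_supp[OF \<phi>] by metis
  define u where "u y = \<xi> *v y + \<phi> y" for y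
  have u: "smooth_map u" unfolding u_def by (intro smooth_map_add smooth_map_linear R(3))
  have jacu: "jac u x = \<xi> + jac \<phi> x" for x
    unfolding u_def jac_add[OF smooth_map_linear R(3)]
    by (simp add: jac_def vec_eq_iff partial_deriv_linear)
  have "\<phi> \<in> W1p q unit_cube"
    unfolding W1p_def
    using smooth_map_has_weak_gradient[OF R(3)] Lp_space_continuous[OF continuous_on_smooth_map[OF R(3)] R(1) op q]
      Lp_space_continuous[OF continuous_on_jac[OF R(3)] R(2) op q] by blast
  moreover have "W1p_norm q unit_cube (\<lambda>x. \<phi> x - \<phi> x) < \<epsilon>" if "\<epsilon> > 0" for \<epsilon>
    using that by (simp add: W1p_norm_zero[OF op])
  ultimately have "\<phi> \<in> W1p_0 q unit_cube"
    unfolding W1p_0_def using \<phi> by blast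
  moreover have "(\<lambda>y. u y - \<xi> *v y) = \<phi>" by (simp add: u_def)
  ultimately have "L \<xi> \<le> gradient_integral L unit_cube u"
    using L unfolding W1q_quasiconvex_def by metis
  also have "\<dots> = (\<integral>\<^sup>+x. L (jac u x) \<partial>lebesgue_on unit_cube)"
    unfolding gradient_integral_def
  proof (rule nn_integral_cong_AE)
    note h = smooth_map_has_weak_gradient[OF u]
    have "AE x in lebesgue. x \<in> unit_cube \<longrightarrow> weak_gradient unit_cube u x = jac u x"
      by (rule AE_weak_gradient_unique[OF op weak_gradient_has_weak_gradient[OF h] h])
    then have "AE x in lebesgue_on unit_cube. weak_gradient unit_cube u x = jac u x"
      by (simp add: AE_lebesgue_on[OF bor])
    then show "AE x in lebesgue_on unit_cube. L (weak_gradient unit_cube u x) = L (jac u x)"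
      by eventually_elim simp
  qed
  finally show ?thesis by (simp add: nn_integral_lebesgue_on[OF bor] jacu)
qed

section \<open>Cubes and cutoff functions\<close>

definition cube :: "real \<Rightarrow> (real^'n) set" where
  "cube s = box (\<chi> i. - s) (\<chi> i. s)"

lemma mem_cube: "x \<in> cube s \<longleftrightarrow> (\<forall>i. \<bar>x $ i\<bar> < s)"
  by (auto simp: cube_def mem_box_cart abs_less_iff) (metis minus_less_iff)+

lemma unit_cube_eq_cube: "unit_cube = cube (1/2)"
  by (simp add: unit_cube_def cube_def)

lemma open_cube: "open (cube s)" by (simp add: cube_def open_box)

lemma emeasure_cube:
  assumes "0 \<le> s"
  shows "emeasure lborel (cube s :: (real^'n) set) = ennreal ((2 * s) ^ CARD('n))"
proof -
  have comp: "(\<chi> i. c) \<bullet> b = c" if "b \<in> Basis" for c and b :: "real^'n"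
    using that by (auto simp: Basis_vec_def inner_axis)
  have "((\<chi> i. s) - (\<chi> i. - s) :: real^'n) = (\<chi> i. 2 * s)" by (simp add: vec_eq_iff)
  then show ?thesis
    unfolding cube_def using assms by (subst emeasure_lborel_box) (auto simp: comp)
qed

lemma exists_cutoff:
  assumes "0 < \<epsilon>"
  shows "\<exists>\<eta> Y'. test_function (unit_cube :: (real^'n) set) \<eta> \<and> (\<forall>x. 0 \<le> \<eta> x \<and> \<eta> x \<le> 1) \<and> open Y' \<and> Y' \<subseteq> unit_cube \<and>
     (\<forall>x\<in>Y'. \<eta> x = 1) \<and> emeasure lborel (unit_cube - Y') \<le> ennreal \<epsilon>"
proof -
  define N where "N = real CARD('n)"
  have N: "N \<ge> 1" by (simp add: N_def)
  \<comment> \<open>The layer outside the cube of side 1 - 6d has measure 1 - (1 - 6d)^N <= 6 N d by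
    Bernoulli's inequality, which dictates \<open>\<epsilon> / (6 * N)\<close>. The bound 1/12 keeps
    all the cubes nondegenerate.\<close>
  define d where "d = min (1 / 12) (\<epsilon> / (6 * N))"
  have d: "d > 0" "d \<le> 1 / 12" "6 * N * d \<le> \<epsilon>"
    using assms N by (auto simp: d_def min_def field_simps)
  obtain \<rho> :: "real^'n \<Rightarrow> real" where \<rho>: "mollifier d \<rho>" using exists_mollifier[OF d(1)] by blast
  have s: "smooth_supp d \<rho>" by (rule mollifier_smooth_supp[OF \<rho>])
  \<comment> \<open>Mollifying the indicator of \<open>Q\<close> at scale \<open>d\<close> leaves a margin \<open>d\<close> on either side.\<close>
  define Q :: "(real^'n) set" where "Q = cube (1/2 - 2 * d)"
  define \<eta> :: "real^'n \<Rightarrow> real" where "\<eta> = conv \<rho> (indicator Q)"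
  have Qint: "integrable lborel (indicator Q :: real^'n \<Rightarrow> real)"
    using d(2) by (intro integrable_real_indicator) (auto simp: Q_def emeasure_cube intro!: borel_open open_cube)
  have \<rho>int: "integrable lborel \<rho>" by (rule smooth_supp_integrable[OF s])
  have \<eta>_alt: "\<eta> x = (LINT z|lborel. \<rho> z * indicator Q (x - z))" for x
    unfolding \<eta>_def using conv_alt[OF s Qint, of x] by simp
  have \<eta>_int: "integrable lborel (\<lambda>z. \<rho> z * indicator Q (x - z))" for x
    using integrable_conv_alt[OF s Qint, of x] by simp
  have \<rho>_props: "\<rho> x \<ge> 0" "\<rho> x \<noteq> 0 \<Longrightarrow> norm x < d" "(LINT x|lborel. \<rho> x) = 1" for x
    using \<rho> by (auto simp: mollifier_def)
  have comp: "\<bar>z $ i\<bar> < d" if "\<rho> z \<noteq> 0" for z i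
    using component_le_norm_cart[of z i] \<rho>_props(2)[OF that] by simp
  have supp: "x \<in> cbox (\<chi> i. - (1/2 - d)) (\<chi> i. 1/2 - d)" if "\<eta> x \<noteq> 0" for x
  proof (rule ccontr)
    assume x: "\<not> x \<in> cbox (\<chi> i. - (1/2 - d)) (\<chi> i. 1/2 - d)"
    then obtain i where "\<not> (- (1/2 - d) \<le> x $ i \<and> x $ i \<le> 1/2 - d)" by (auto simp: mem_box_cart)
    then have i: "\<not> \<bar>x $ i\<bar> \<le> 1/2 - d" by (simp add: abs_le_iff) linarith
    have "\<rho> z * indicator Q (x - z) = 0" for z
    proof (cases "\<rho> z = 0")
      case False
      have "\<not> \<bar>(x - z) $ i\<bar> < 1/2 - 2 * d" using i comp[OF False, of i] by (auto simp: abs_less_iff abs_le_iff)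
      then show ?thesis by (auto simp: Q_def mem_cube indicator_def)
    qed simp
    then have "(\<lambda>z. \<rho> z * indicator Q (x - z)) = (\<lambda>z. 0)" by (rule ext)
    then show False using that \<eta>_alt[of x] by simp
  qed
  have test: "test_function unit_cube \<eta>"
  proof (rule smooth_supp_imp_test_function[OF _ _ _ _ supp])
    show "C_k k \<eta>" for k unfolding \<eta>_def by (rule C_k_conv[OF s Qint])
    have "\<bar>x $ i\<bar> < 1/2" if "x \<in> cbox (\<chi> i. - (1/2 - d)) (\<chi> i. 1/2 - d)" for x :: "real^'n" and i
    proof -
      have "- (1/2 - d) \<le> x $ i" "x $ i \<le> 1/2 - d" using that by (auto simp: mem_box_cart)
      then show ?thesis using d(1) by (simp add: abs_less_iff)
    qed
    then show "cbox (\<chi> i. - (1/2 - d)) (\<chi> i. 1/2 - d) \<subseteq> (unit_cube :: (real^'n) set)"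
      unfolding unit_cube_eq_cube by (auto simp: mem_cube)
  qed auto
  have range: "0 \<le> \<eta> x \<and> \<eta> x \<le> 1" for x
  proof
    show "0 \<le> \<eta> x" unfolding \<eta>_alt using \<rho>_props(1) by (intro integral_nonneg_AE) auto
    have "\<eta> x \<le> (LINT z|lborel. \<rho> z)"
      unfolding \<eta>_alt using \<eta>_int \<rho>int \<rho>_props(1) by (intro integral_mono) (auto simp: indicator_def)
    then show "\<eta> x \<le> 1" using \<rho>_props(3) by simp
  qed
  have one: "\<eta> x = 1" if "x \<in> cube (1/2 - 3 * d)" for x
  proof -
    have "\<rho> z * indicator Q (x - z) = \<rho> z" for z
    proof (cases "\<rho> z = 0")
      case False
      have "\<bar>(x - z) $ i\<bar> < 1/2 - 2 * d" for i
      proof -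
        have "\<bar>x $ i\<bar> < 1/2 - 3 * d" using that by (simp add: mem_cube)
        then show ?thesis using comp[OF False, of i] by (simp add: abs_less_iff)
      qed
      then show ?thesis by (simp add: Q_def mem_cube)
    qed simp
    then have "(\<lambda>z. \<rho> z * indicator Q (x - z)) = \<rho>" by (rule ext)
    then show ?thesis using \<eta>_alt[of x] \<rho>_props(3) by simp
  qed
  have sub: "cube (1/2 - 3 * d) \<subseteq> (unit_cube :: (real^'n) set)"
  proof
    fix x :: "real^'n" assume x: "x \<in> cube (1/2 - 3 * d)"
    have "\<bar>x $ i\<bar> < 1/2" for i
    proof -
      have "\<bar>x $ i\<bar> < 1/2 - 3 * d" using x by (simp add: mem_cube)
      then show ?thesis using d(1) by linarith
    qed
    then show "x \<in> unit_cube" by (simp add: unit_cube_eq_cube mem_cube)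
  qed
  have "emeasure lborel (unit_cube - cube (1/2 - 3 * d) :: (real^'n) set)
     = emeasure lborel (unit_cube :: (real^'n) set) - emeasure lborel (cube (1/2 - 3 * d) :: (real^'n) set)"
    using d(2) sub by (intro emeasure_Diff) (auto simp: emeasure_cube unit_cube_eq_cube intro!: borel_open open_cube)
  also have "\<dots> = ennreal (1 - (2 * (1/2 - 3 * d)) ^ CARD('n))"
    using d(2) by (simp add: unit_cube_eq_cube emeasure_cube ennreal_minus[symmetric] del: ennreal_minus)
  also have "\<dots> \<le> ennreal \<epsilon>"
  proof (rule ennreal_leI)
    have "1 + real CARD('n) * (- 6 * d) \<le> (1 + - 6 * d) ^ CARD('n)"
      by (rule Bernoulli_inequality) (use d(2) in simp)
    moreover have "2 * (1/2 - 3 * d) = 1 + - 6 * d" by simp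
    ultimately show "1 - (2 * (1/2 - 3 * d)) ^ CARD('n) \<le> \<epsilon>" using d(3) by (simp add: N_def)
  qed
  finally show ?thesis using test range one sub open_cube by blast
qed

text \<open>This is the rank-one matrix that the product rule creates when a vector field is
  multiplied by a cutoff.\<close>

lemma norm_outer: "norm ((\<chi> i j. v $ i * g $ j) :: real^'n^'m) = norm v * norm g"
proof -
  have "norm ((\<chi> j. v $ i * g $ j) :: real^'n) = norm (v $ i) * norm g" for i
  proof -
    have "((\<chi> j. v $ i * g $ j) :: real^'n) = v $ i *\<^sub>R g" by (simp add: vec_eq_iff)
    then show ?thesis by simp
  qed
  then show ?thesis by (simp add: norm_vec_def[of "\<chi> i j. v $ i * g $ j"] norm_vec_def[of v] L2_set_left_distrib)
qed

lemma pw_add3: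
  assumes "0 \<le> q"
  shows "pw q (a + (b + c)) \<le> ennreal (2 powr q * 2 powr q) * (pw q a + pw q b + pw q c)"
proof -
  have one: "1 \<le> 2 powr q" using assms by (intro ge_one_powr_ge_zero) auto
  have "pw q (a + (b + c)) \<le> ennreal (2 powr q) * (pw q a + pw q (b + c))" by (rule pw_add[OF assms])
  also have "\<dots> \<le> ennreal (2 powr q) * (ennreal (2 powr q) * pw q a + ennreal (2 powr q) * (pw q b + pw q c))"
  proof (intro mult_left_mono add_mono pw_add[OF assms])
    show "pw q a \<le> ennreal (2 powr q) * pw q a"
      using mult_right_mono[of 1 "ennreal (2 powr q)" "pw q a"] one by (simp add: ennreal_ge_1)
  qed simp
  also have "\<dots> = ennreal (2 powr q * 2 powr q) * (pw q a + pw q b + pw q c)"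
    by (simp add: ennreal_mult distrib_left mult.assoc add.assoc)
  finally show ?thesis .
qed

text \<open>The test field is the cutoff times w - \<xi> y, so the competitor has gradient \<nabla>w
  in the inner region and is controlled by the growth condition in the layer \<open>S\<close>. Both
  \<open>S\<close> and \<open>C\<close> come from the cutoff alone and are chosen before \<xi> and
  w; this is what later allows \<xi> and w to vary with the centre of the cube.\<close>

lemma unit_cube_inequality:
  fixes L :: "real^'n^'m \<Rightarrow> ennreal"
  assumes L: "W1q_quasiconvex q L" and q: "1 \<le> q" and \<alpha>: "0 < \<alpha>"
    and growth: "\<And>\<xi>. L \<xi> \<le> ennreal \<alpha> * (1 + pw q \<xi>)" and cont: "continuous_on UNIV L" and \<epsilon>: "0 < \<epsilon>"
  shows "\<exists>S C. S \<in> sets borel \<and> S \<subseteq> unit_cube \<and> emeasure lborel S \<le> ennreal \<epsilon> \<and> 0 \<le> C \<and>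
     (\<forall>\<xi> w. smooth_map w \<longrightarrow> L \<xi> \<le> (\<integral>\<^sup>+y. indicator unit_cube y * L (jac w y) \<partial>lborel) +
        ennreal (\<alpha> * (2 powr q * 2 powr q)) * (\<integral>\<^sup>+y. indicator S y * (1 + pw q \<xi> + pw q (jac w y)) \<partial>lborel) +
        ennreal C * (\<integral>\<^sup>+y. indicator unit_cube y * pw q (w y - \<xi> *v y) \<partial>lborel))"
proof -
  obtain \<eta> and Y' :: "(real^'n) set" where \<eta>: "test_function unit_cube \<eta>" "\<And>x. 0 \<le> \<eta> x" "\<And>x. \<eta> x \<le> 1"
    and Y': "open Y'" "Y' \<subseteq> unit_cube" "\<And>x. x \<in> Y' \<Longrightarrow> \<eta> x = 1"
    and small: "emeasure lborel (unit_cube - Y') \<le> ennreal \<epsilon>"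
    using exists_cutoff[OF \<epsilon>] by metis
  obtain R where R: "smooth_supp R \<eta>" using test_function_smooth_supp[OF \<eta>(1)] by metis
  obtain B where B: "B \<ge> 0" "\<And>x. norm (grad \<eta> x) \<le> B"
    using bounded_bounded_support[OF continuous_on_grad[OF R] grad_supp[OF R]] by metis
  define S where "S = (unit_cube :: (real^'n) set) - Y'"
  define D where "D = 2 powr q * 2 powr q"
  \<comment> \<open>\<open>B\<close> bounds the gradient of the cutoff, so this constant
    deteriorates as the layer gets thinner.\<close>
  define C where "C = \<alpha> * D * B powr q"
  have one: "1 \<le> 2 powr q" using q by (intro ge_one_powr_ge_zero) auto
  have D: "D \<ge> 1" unfolding D_def using mult_mono[OF one one] by simp
  have [measurable]: "(unit_cube :: (real^'n) set) \<in> sets borel" "Y' \<in> sets borel" "S \<in> sets borel"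
    using Y'(1) by (auto simp: S_def unit_cube_eq_cube open_cube borel_open)
  have [measurable]: "L \<in> borel_measurable borel" by (rule borel_measurable_continuous_onI[OF cont])
  have main: "L \<xi> \<le> (\<integral>\<^sup>+y. indicator unit_cube y * L (jac w y) \<partial>lborel) +
        ennreal (\<alpha> * D) * (\<integral>\<^sup>+y. indicator S y * (1 + pw q \<xi> + pw q (jac w y)) \<partial>lborel) +
        ennreal C * (\<integral>\<^sup>+y. indicator unit_cube y * pw q (w y - \<xi> *v y) \<partial>lborel)"
    if w: "smooth_map w" for \<xi> w
  proof -
    have [measurable]: "w \<in> borel_measurable borel" "jac w \<in> borel_measurable borel"
      "(\<lambda>y. \<xi> *v y) \<in> borel_measurable borel"
      using continuous_on_smooth_map[OF w] continuous_on_jac[OF w] continuous_on_smooth_map[OF smooth_map_linear]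
      by (auto intro: borel_measurable_continuous_onI)
    define \<phi> where "\<phi> y = (\<chi> i. (w y $ i - (\<xi> *v y) $ i) * \<eta> y)" for y
    have Ck: "C_k k (\<lambda>y. w y $ i - (\<xi> *v y) $ i)" for k i
      by (intro C_k_minus smooth_mapD(1) w smooth_map_linear)
    have \<phi>: "test_function unit_cube (\<lambda>x. \<phi> x $ i)" for i
    proof (rule smooth_supp_imp_test_function[where S = "closure {x. \<eta> x \<noteq> 0}"])
      show "C_k k (\<lambda>x. \<phi> x $ i)" for k
        unfolding \<phi>_def using C_k_mult[OF Ck smooth_suppD(1)[OF R]] by simp
      show "x \<in> closure {x. \<eta> x \<noteq> 0}" if "\<phi> x $ i \<noteq> 0" for x
        using that closure_subset[of "{x. \<eta> x \<noteq> 0}"] by (auto simp: \<phi>_def)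
    qed (use \<eta>(1) in \<open>auto simp: test_function_def compact_imp_bounded\<close>)
    have dv: "partial_deriv j (\<lambda>y. w y $ i - (\<xi> *v y) $ i) y = jac w y $ i $ j - \<xi> $ i $ j" for i j y
    proof -
      have "((\<lambda>y. w y $ i - (\<xi> *v y) $ i) has_derivative (\<lambda>h. (jac w y *v h) $ i - (\<xi> *v h) $ i)) (at y)"
        using smooth_map_has_derivative[OF w, of y]
        by (intro has_derivative_diff bounded_linear.has_derivative[OF bounded_linear_vec_nth]
            bounded_linear_imp_has_derivative bounded_linear_compose[OF bounded_linear_vec_nth]) simp_all
      from partial_deriv_eqI[OF this, of j] show ?thesis
        by (simp add: matrix_vector_mul_component inner_axis)
    qed
    \<comment> \<open>The product rule leaves three terms, as in \<open>pw_add3\<close>; the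
      rank-one term carries the gradient of the cutoff.\<close>
    have jac\<phi>: "\<xi> + jac \<phi> y = (1 - \<eta> y) *\<^sub>R \<xi> + (\<eta> y *\<^sub>R jac w y + (\<chi> i j. (w y - \<xi> *v y) $ i * grad \<eta> y $ j))" for y
    proof -
      have "(\<lambda>y. w y $ i - (\<xi> *v y) $ i) differentiable (at y)" for i y
        using Ck[of "Suc 0"] by simp
      then have "partial_deriv j (\<lambda>y. \<phi> y $ i) y = (w y $ i - (\<xi> *v y) $ i) * partial_deriv j \<eta> y + (jac w y $ i $ j - \<xi> $ i $ j) * \<eta> y" for i j
        unfolding \<phi>_def by (simp add: partial_deriv_mult smooth_suppD(2)[OF R] dv)
      then show ?thesis
        by (simp add: vec_eq_iff jac_def[of \<phi>] grad_def algebra_simps)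
    qed
    \<comment> \<open>The set \<open>Y'\<close> is open and the cutoff is 1 on it, so the gradient
      of the cutoff vanishes there as well.\<close>
    have on_Y': "\<xi> + jac \<phi> y = jac w y" if "y \<in> Y'" for y
    proof -
      have "partial_deriv j \<eta> y = 0" for j
      proof -
        have "((\<lambda>x. 1) has_derivative (\<lambda>h. 0)) (at y)" by simp
        then have "(\<eta> has_derivative (\<lambda>h. 0)) (at y)"
          by (rule has_derivative_transform_within_open[OF _ Y'(1) that]) (simp add: Y'(3))
        then show ?thesis by (simp add: partial_deriv_eqI)
      qed
      then have "grad \<eta> y = 0" by (simp add: grad_def vec_eq_iff)
      then show ?thesis by (simp add: jac\<phi> Y'(3)[OF that] vec_eq_iff)
    qed
    have on_S: "L (\<xi> + jac \<phi> y) \<le> ennreal (\<alpha> * D) * (1 + pw q \<xi> + pw q (jac w y)) + ennreal C * pw q (w y - \<xi> *v y)" for y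
    proof -
      have "pw q (\<xi> + jac \<phi> y) \<le> ennreal D * (pw q ((1 - \<eta> y) *\<^sub>R \<xi>) + pw q (\<eta> y *\<^sub>R jac w y) + pw q ((\<chi> i j. (w y - \<xi> *v y) $ i * grad \<eta> y $ j) :: real^'n^'m))"
        unfolding jac\<phi> D_def using q by (intro pw_add3) simp
      also have "\<dots> \<le> ennreal D * (pw q \<xi> + pw q (jac w y) + ennreal (B powr q) * pw q (w y - \<xi> *v y))"
      proof (intro mult_left_mono add_mono)
        have "\<bar>1 - \<eta> y\<bar> * norm \<xi> \<le> 1 * norm \<xi>" using \<eta>(2,3)[of y] by (intro mult_right_mono) auto
        then show "pw q ((1 - \<eta> y) *\<^sub>R \<xi>) \<le> pw q \<xi>" using q by (intro pw_mono) auto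
        have "\<bar>\<eta> y\<bar> * norm (jac w y) \<le> 1 * norm (jac w y)" using \<eta>(2,3)[of y] by (intro mult_right_mono) auto
        then show "pw q (\<eta> y *\<^sub>R jac w y) \<le> pw q (jac w y)" using q by (intro pw_mono) auto
        have "norm (w y - \<xi> *v y) * norm (grad \<eta> y) \<le> norm (w y - \<xi> *v y) * B"
          using B(2)[of y] by (intro mult_left_mono) auto
        then have "pw q ((\<chi> i j. (w y - \<xi> *v y) $ i * grad \<eta> y $ j) :: real^'n^'m) \<le> pw q (B *\<^sub>R (w y - \<xi> *v y))"
          using q B(1) by (intro pw_mono) (simp_all only: norm_outer norm_scaleR abs_of_nonneg mult.commute[of B])
        then show "pw q ((\<chi> i j. (w y - \<xi> *v y) $ i * grad \<eta> y $ j) :: real^'n^'m) \<le> ennreal (B powr q) * pw q (w y - \<xi> *v y)"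
          using B(1) by (simp only: pw_scaleR abs_of_nonneg)
      qed simp
      finally have *: "pw q (\<xi> + jac \<phi> y) \<le> ennreal D * (pw q \<xi> + pw q (jac w y) + ennreal (B powr q) * pw q (w y - \<xi> *v y))" .
      have "L (\<xi> + jac \<phi> y) \<le> ennreal \<alpha> * (1 + pw q (\<xi> + jac \<phi> y))" by (rule growth)
      also have "\<dots> \<le> ennreal \<alpha> * (ennreal D * 1 + ennreal D * (pw q \<xi> + pw q (jac w y) + ennreal (B powr q) * pw q (w y - \<xi> *v y)))"
        using D by (intro mult_left_mono add_mono *) (auto simp: ennreal_ge_1)
      also have "\<dots> = ennreal (\<alpha> * D) * (1 + pw q \<xi> + pw q (jac w y)) + ennreal C * pw q (w y - \<xi> *v y)"
        using \<alpha> D by (simp add: C_def ennreal_mult distrib_left mult.assoc add.assoc)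
      finally show ?thesis .
    qed
    have "L \<xi> \<le> (\<integral>\<^sup>+x. indicator unit_cube x * L (\<xi> + jac \<phi> x) \<partial>lborel)"
      by (rule quasiconvex_test_function[OF L _ \<phi>]) (use q in simp)
    also have "\<dots> \<le> (\<integral>\<^sup>+y. indicator unit_cube y * L (jac w y) + ennreal (\<alpha> * D) * (indicator S y * (1 + pw q \<xi> + pw q (jac w y)))
        + ennreal C * (indicator unit_cube y * pw q (w y - \<xi> *v y)) \<partial>lborel)"
    proof (rule nn_integral_mono)
      fix y
      consider "y \<in> Y'" | "y \<in> S" | "y \<notin> unit_cube" by (auto simp: S_def)
      then show "indicator unit_cube y * L (\<xi> + jac \<phi> y) \<le> indicator unit_cube y * L (jac w y)
        + ennreal (\<alpha> * D) * (indicator S y * (1 + pw q \<xi> + pw q (jac w y))) + ennreal C * (indicator unit_cube y * pw q (w y - \<xi> *v y))"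
      proof cases
        case 1
        then have "y \<in> unit_cube" "y \<notin> S" using Y'(2) by (auto simp: S_def)
        then show ?thesis by (simp add: on_Y'[OF 1])
      next
        case 2
        then have "y \<in> unit_cube" by (simp add: S_def)
        \<comment> \<open>The nonnegative term \<open>L (jac w y)\<close> is added so that one
          integrand on the right serves the layer and the inner region.\<close>
        have "L (\<xi> + jac \<phi> y) \<le> L (jac w y) + (ennreal (\<alpha> * D) * (1 + pw q \<xi> + pw q (jac w y)) + ennreal C * pw q (w y - \<xi> *v y))"
          using on_S[of y] by (rule add_increasing[rotated]) simp
        then show ?thesis using 2 \<open>y \<in> unit_cube\<close> by (simp add: add.assoc)
      qed simp
    qed
    also have "\<dots> = (\<integral>\<^sup>+y. indicator unit_cube y * L (jac w y) \<partial>lborel) +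
        ennreal (\<alpha> * D) * (\<integral>\<^sup>+y. indicator S y * (1 + pw q \<xi> + pw q (jac w y)) \<partial>lborel) +
        ennreal C * (\<integral>\<^sup>+y. indicator unit_cube y * pw q (w y - \<xi> *v y) \<partial>lborel)"
      by (simp add: nn_integral_add nn_integral_cmult)
    finally show ?thesis .
  qed
  show ?thesis
  proof (intro exI[of _ S] exI[of _ C] conjI allI impI)
    show "S \<subseteq> unit_cube" by (auto simp: S_def)
    show "emeasure lborel S \<le> ennreal \<epsilon>" using small by (simp add: S_def)
    show "0 \<le> C" using \<alpha> D by (simp add: C_def)
  qed (use main in \<open>auto simp: D_def\<close>)
qed

section \<open>The localized estimate\<close>

lemma norm_matrix_vector_mult_le: "norm (A *v z) \<le> norm A * norm (z :: real^'n)"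
proof -
  have "norm (A *v z) = L2_set (\<lambda>i. norm (A $ i \<bullet> z)) UNIV"
    by (simp add: norm_vec_def[of "A *v z"] matrix_vector_mul_component)
  also have "\<dots> \<le> L2_set (\<lambda>i. norm (A $ i) * norm z) UNIV"
    using Cauchy_Schwarz_ineq2 by (intro L2_set_mono) auto
  also have "\<dots> = norm A * norm z" by (simp add: norm_vec_def[of A] L2_set_left_distrib)
  finally show ?thesis .
qed

lemma continuous_on_matrix_vector_mult:
  fixes f :: "'a::topological_space \<Rightarrow> real^'n^'m"
  assumes "continuous_on A f" "continuous_on A g"
  shows "continuous_on A (\<lambda>x. f x *v g x)"
proof -
  have "continuous_on A (\<lambda>x. \<chi> i. f x $ i \<bullet> g x)"
    using assms by (intro continuous_on_vec_lambda continuous_intros) auto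
  moreover have "(\<lambda>x. f x *v g x) = (\<lambda>x. \<chi> i. f x $ i \<bullet> g x)"
    by (simp add: fun_eq_iff vec_eq_iff matrix_vector_mul_component)
  ultimately show ?thesis by (simp only:)
qed

text \<open>The left-hand vector is the integral of (\<nabla>w(x + t z) - B) z over t in [0,1], and
  Jensen's inequality moves the q-th power inside.\<close>

lemma FTC_pw:
  fixes w :: "real^'n \<Rightarrow> real^'m"
  assumes w: "smooth_map w" and q: "1 \<le> q"
  shows "pw q (w (x + z) - w x - B *v z) \<le>
     ennreal (norm z powr q) * (\<integral>\<^sup>+t. indicator {0..1} t * pw q (jac w (x + t *\<^sub>R z) - B) \<partial>lborel)"
proof -
  define g where "g t = (jac w (x + t *\<^sub>R z) - B) *v z" for t
  have cont: "continuous_on UNIV (\<lambda>t. jac w (x + t *\<^sub>R z))"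
    by (rule continuous_on_compose2[OF continuous_on_jac[OF w]]) (auto intro!: continuous_intros)
  then have contg: "continuous_on UNIV g"
    unfolding g_def by (intro continuous_on_matrix_vector_mult continuous_intros)
  note [measurable] = borel_measurable_continuous_onI[OF cont] borel_measurable_continuous_onI[OF contg]
  have "((\<lambda>t. w (x + t *\<^sub>R z) - t *\<^sub>R (B *v z)) has_vector_derivative g t) (at t within {0..1})" for t
  proof -
    have 1: "((\<lambda>t. x + t *\<^sub>R z) has_vector_derivative z) (at t within {0..1})"
      by (auto intro!: derivative_eq_intros)
    have "((w \<circ> (\<lambda>t. x + t *\<^sub>R z)) has_vector_derivative (jac w (x + t *\<^sub>R z) *v z)) (at t within {0..1})"
      by (rule vector_derivative_diff_chain_within[OF 1])
         (rule has_derivative_at_withinI[OF smooth_map_has_derivative[OF w]])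
    then show ?thesis
      unfolding g_def o_def by (auto intro!: derivative_eq_intros simp: matrix_vector_mult_diff_rdistrib)
  qed
  then have "(LINT t|lborel. indicator {0..1} t *\<^sub>R g t) =
      (w (x + 1 *\<^sub>R z) - 1 *\<^sub>R (B *v z)) - (w (x + 0 *\<^sub>R z) - 0 *\<^sub>R (B *v z))"
    using contg by (intro integral_FTC_atLeastAtMost) (auto intro: continuous_on_subset)
  then have eq: "w (x + z) - w x - B *v z = (LINT t|lborel. indicator {0..1} t *\<^sub>R g t)" by simp
  \<comment> \<open>The indicator of [0,1] serves as the probability weight.\<close>
  have "pw q (LINT t|lborel. indicator {0..1} t *\<^sub>R g t) \<le> (\<integral>\<^sup>+t. ennreal (indicator {0..1} t) * pw q (g t) \<partial>lborel)"
    by (rule weighted_Jensen_pw[OF q])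
       (use contg in \<open>auto intro!: borel_integrable_compact intro: continuous_on_subset\<close>)
  also have "\<dots> \<le> (\<integral>\<^sup>+t. ennreal (norm z powr q) * (indicator {0..1} t * pw q (jac w (x + t *\<^sub>R z) - B)) \<partial>lborel)"
  proof (rule nn_integral_mono)
    fix t
    have "pw q (g t) \<le> pw q (norm z *\<^sub>R (jac w (x + t *\<^sub>R z) - B))"
      unfolding g_def using q norm_matrix_vector_mult_le[of "jac w (x + t *\<^sub>R z) - B" z]
      by (intro pw_mono) (auto simp: mult.commute)
    also have "\<dots> = ennreal (norm z powr q) * pw q (jac w (x + t *\<^sub>R z) - B)" by (simp add: pw_scaleR)
    finally show "ennreal (indicator {0..1} t) * pw q (g t) \<le>
        ennreal (norm z powr q) * (indicator {0..1} t * pw q (jac w (x + t *\<^sub>R z) - B))"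
      by (auto simp: indicator_def)
  qed
  also have "\<dots> = ennreal (norm z powr q) * (\<integral>\<^sup>+t. indicator {0..1} t * pw q (jac w (x + t *\<^sub>R z) - B) \<partial>lborel)"
    by (rule nn_integral_cmult) measurable
  finally show ?thesis unfolding eq .
qed

text \<open>Fubini in x and t passes a bound on the shifted gradients, uniform along the segment, to
  the increments of w. With G = 0 this controls translations by the gradient; with G a limit
  gradient it controls the first-order error.\<close>

lemma integral_FTC_pw:
  fixes w :: "real^'n \<Rightarrow> real^'m"
  assumes w: "smooth_map w" and q: "1 \<le> q" and [measurable]: "K \<in> sets borel" "G \<in> borel_measurable borel"
    and le: "\<And>t. 0 \<le> t \<Longrightarrow> t \<le> 1 \<Longrightarrow> (\<integral>\<^sup>+x. indicator K x * pw q (jac w (x + t *\<^sub>R z) - G x) \<partial>lborel) \<le> E"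
  shows "(\<integral>\<^sup>+x. indicator K x * pw q (w (x + z) - w x - G x *v z) \<partial>lborel) \<le> ennreal (norm z powr q) * E"
proof -
  have [measurable]: "jac w \<in> borel_measurable borel"
    by (rule borel_measurable_continuous_onI[OF continuous_on_jac[OF w]])
  have "(\<integral>\<^sup>+x. indicator K x * pw q (w (x + z) - w x - G x *v z) \<partial>lborel)
     \<le> (\<integral>\<^sup>+x. (\<integral>\<^sup>+t. ennreal (norm z powr q) * (indicator {0..1} t * (indicator K x * pw q (jac w (x + t *\<^sub>R z) - G x))) \<partial>lborel) \<partial>lborel)"
  proof (rule nn_integral_mono)
    fix x
    have "indicator K x * pw q (w (x + z) - w x - G x *v z)
      \<le> indicator K x * (ennreal (norm z powr q) * (\<integral>\<^sup>+t. indicator {0..1} t * pw q (jac w (x + t *\<^sub>R z) - G x) \<partial>lborel))"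
      by (intro mult_left_mono FTC_pw[OF w q]) simp
    also have "\<dots> = (\<integral>\<^sup>+t. ennreal (norm z powr q) * (indicator {0..1} t * (indicator K x * pw q (jac w (x + t *\<^sub>R z) - G x))) \<partial>lborel)"
      by (simp add: mult.left_commute flip: nn_integral_cmult)
    finally show "indicator K x * pw q (w (x + z) - w x - G x *v z)
      \<le> (\<integral>\<^sup>+t. ennreal (norm z powr q) * (indicator {0..1} t * (indicator K x * pw q (jac w (x + t *\<^sub>R z) - G x))) \<partial>lborel)" .
  qed
  also have "\<dots> = (\<integral>\<^sup>+t. (\<integral>\<^sup>+x. ennreal (norm z powr q) * (indicator {0..1} t * (indicator K x * pw q (jac w (x + t *\<^sub>R z) - G x))) \<partial>lborel) \<partial>lborel)"
    by (intro lborel_pair.Fubini'[symmetric]) measurable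
  also have "\<dots> = (\<integral>\<^sup>+t. ennreal (norm z powr q) * (indicator {0..1} t * (\<integral>\<^sup>+x. indicator K x * pw q (jac w (x + t *\<^sub>R z) - G x) \<partial>lborel)) \<partial>lborel)"
    by (simp add: nn_integral_cmult)
  also have "\<dots> \<le> (\<integral>\<^sup>+t. ennreal (norm z powr q) * E * indicator {0..1::real} t \<partial>lborel)"
  proof (rule nn_integral_mono)
    fix t :: real
    show "ennreal (norm z powr q) * (indicator {0..1} t * (\<integral>\<^sup>+x. indicator K x * pw q (jac w (x + t *\<^sub>R z) - G x) \<partial>lborel))
        \<le> ennreal (norm z powr q) * E * indicator {0..1} t"
      using le[of t] by (cases "t \<in> {0..1}") (auto intro: mult_left_mono)
  qed
  also have "\<dots> = ennreal (norm z powr q) * E" by (simp add: nn_integral_cmult_indicator)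
  finally show ?thesis .
qed

text \<open>For c = 1/h the factor c h is 1, so the rescaled map takes the same gradient values as
  \<open>w\<close>, read at x + h y.\<close>

lemma jac_rescale:
  assumes w: "smooth_map w"
  shows "smooth_map (\<lambda>y. c *\<^sub>R (w (x + h *\<^sub>R y) - a))"
    and "jac (\<lambda>y. c *\<^sub>R (w (x + h *\<^sub>R y) - a)) y = (c * h) *\<^sub>R jac w (x + h *\<^sub>R y)"
proof -
  have aff: "C_k k (\<lambda>y. w (x + h *\<^sub>R y) $ i)" for k i
    by (rule C_k_affine[OF smooth_mapD(1)[OF w]])
  show sm: "smooth_map (\<lambda>y. c *\<^sub>R (w (x + h *\<^sub>R y) - a))"
    unfolding smooth_map_def using aff by (auto intro!: C_k_mult C_k_minus)
  have "partial_deriv j (\<lambda>y. (c *\<^sub>R (w (x + h *\<^sub>R y) - a)) $ i) y = c * h * partial_deriv j (\<lambda>x. w x $ i) (x + h *\<^sub>R y)" for i j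
  proof -
    define f where "f y = w (x + h *\<^sub>R y) $ i" for y
    have d: "f differentiable (at y)" for y
      unfolding f_def by (rule differentiable_affine[OF smooth_mapD(2)[OF w]])
    have c0: "partial_deriv j (\<lambda>x. b) = (\<lambda>x. 0)" for b :: real
      by (rule ext, subst partial_deriv_eqI[OF has_derivative_const]) simp
    have "partial_deriv j (\<lambda>y. c * (f y + - a $ i)) y = c * partial_deriv j f y"
      using partial_deriv_add[of f "\<lambda>_. - a $ i" j] partial_deriv_mult[of "\<lambda>_. c" "\<lambda>y. f y + - a $ i" j] d
      by (simp add: c0)
    also have "partial_deriv j f y = h * partial_deriv j (\<lambda>x. w x $ i) (x + h *\<^sub>R y)"
      unfolding f_def by (simp add: partial_deriv_affine[where f = "\<lambda>x. w x $ i"] smooth_mapD(2)[OF w])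
    finally show ?thesis by (simp add: f_def)
  qed
  then show "jac (\<lambda>y. c *\<^sub>R (w (x + h *\<^sub>R y) - a)) y = (c * h) *\<^sub>R jac w (x + h *\<^sub>R y)"
    by (simp add: jac_def vec_eq_iff)
qed

lemma norm_unit_cube: "y \<in> unit_cube \<Longrightarrow> norm (y :: real^'n) \<le> real CARD('n)"
proof -
  assume y: "y \<in> unit_cube"
  have "norm y \<le> (\<Sum>i\<in>UNIV. \<bar>y $ i\<bar>)" by (rule norm_le_l1_cart)
  also have "\<dots> \<le> (\<Sum>i\<in>(UNIV::'n set). 1)"
  proof (rule sum_mono)
    fix i
    have "\<bar>y $ i\<bar> < 1/2" using y by (simp add: unit_cube_eq_cube mem_cube)
    then show "\<bar>y $ i\<bar> \<le> 1" by simp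
  qed
  finally show ?thesis by simp
qed

lemma emeasure_unit_cube: "emeasure lborel (unit_cube :: (real^'n) set) = 1"
  by (simp add: unit_cube_eq_cube emeasure_cube)

text \<open>By Fubini each \<open>y\<close> contributes a translate of one and the same integral.
  For T the whole cube the factor is 1 and the energy is recovered; for T the boundary layer the
  factor is its measure, wherever \<open>f\<close> concentrates.\<close>

lemma average_shift_le:
  fixes f :: "real^'n \<Rightarrow> ennreal"
  assumes [measurable]: "f \<in> borel_measurable borel" "K \<in> sets borel" "K' \<in> sets borel" "T \<in> sets borel"
    and T: "T \<subseteq> unit_cube" and sub: "\<And>x y. x \<in> K \<Longrightarrow> y \<in> unit_cube \<Longrightarrow> x + h *\<^sub>R y \<in> K'"
  shows "(\<integral>\<^sup>+x. indicator K x * (\<integral>\<^sup>+y. indicator T y * f (x + h *\<^sub>R y) \<partial>lborel) \<partial>lborel)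
     \<le> emeasure lborel T * (\<integral>\<^sup>+x. indicator K' x * f x \<partial>lborel)"
proof -
  have "(\<integral>\<^sup>+x. indicator K x * (\<integral>\<^sup>+y. indicator T y * f (x + h *\<^sub>R y) \<partial>lborel) \<partial>lborel)
     = (\<integral>\<^sup>+x. (\<integral>\<^sup>+y. indicator K x * (indicator T y * f (x + h *\<^sub>R y)) \<partial>lborel) \<partial>lborel)"
    by (simp add: nn_integral_cmult)
  also have "\<dots> \<le> (\<integral>\<^sup>+x. (\<integral>\<^sup>+y. indicator T y * (indicator K' (x + h *\<^sub>R y) * f (x + h *\<^sub>R y)) \<partial>lborel) \<partial>lborel)"
    using T sub by (intro nn_integral_mono) (auto simp: indicator_def)
  also have "\<dots> = (\<integral>\<^sup>+y. (\<integral>\<^sup>+x. indicator T y * (indicator K' (x + h *\<^sub>R y) * f (x + h *\<^sub>R y)) \<partial>lborel) \<partial>lborel)"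
    by (intro lborel_pair.Fubini'[symmetric]) measurable
  also have "\<dots> = (\<integral>\<^sup>+y. indicator T y * (\<integral>\<^sup>+x. indicator K' x * f x \<partial>lborel) \<partial>lborel)"
    using nn_integral_lborel_shift[of "\<lambda>x. indicator K' x * f x"] by (simp add: nn_integral_cmult)
  also have "\<dots> = emeasure lborel T * (\<integral>\<^sup>+x. indicator K' x * f x \<partial>lborel)"
    by (simp add: nn_integral_multc)
  finally show ?thesis .
qed

text \<open>The inequality \<open>UC\<close> is integrated over the centres x in \<open>K\<close>,
  with \<xi> = G x. Since its constants are independent of \<xi>, measurable dependence of \<xi> on
  x suffices and no point of continuity of \<open>G\<close> has to be selected.\<close>

lemma localized_estimate:
  fixes L :: "real^'n^'m \<Rightarrow> ennreal"
  assumes UC: "\<And>\<xi> w. smooth_map w \<Longrightarrow> L \<xi> \<le> (\<integral>\<^sup>+y. indicator unit_cube y * L (jac w y) \<partial>lborel) +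
        c0 * (\<integral>\<^sup>+y. indicator S y * (1 + pw q \<xi> + pw q (jac w y)) \<partial>lborel) +
        C * (\<integral>\<^sup>+y. indicator unit_cube y * pw q (w y - \<xi> *v y) \<partial>lborel)"
    and S[measurable]: "S \<in> sets borel" and Ssub: "S \<subseteq> unit_cube"
    and q: "1 \<le> q" and cont: "continuous_on UNIV L"
    and w: "smooth_map w" and U: "smooth_map U"
    and [measurable]: "G \<in> borel_measurable borel" "K \<in> sets borel" "K' \<in> sets borel"
    and h: "0 < h" and sub: "\<And>x y. x \<in> K \<Longrightarrow> y \<in> unit_cube \<Longrightarrow> x + h *\<^sub>R y \<in> K'"
    and E: "\<And>z. norm z \<le> h * real CARD('n) \<Longrightarrow> (\<integral>\<^sup>+x. indicator K x * pw q (jac U (x + z) - G x) \<partial>lborel) \<le> E"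
  shows "(\<integral>\<^sup>+x. indicator K x * L (G x) \<partial>lborel) \<le> (\<integral>\<^sup>+x. indicator K' x * L (jac w x) \<partial>lborel) +
     c0 * (emeasure lborel S * ((\<integral>\<^sup>+x. indicator K x * (1 + pw q (G x)) \<partial>lborel) + (\<integral>\<^sup>+x. indicator K' x * pw q (jac w x) \<partial>lborel))) +
     C * (ennreal (2 powr q) * (ennreal ((1 / h) powr q) * (\<integral>\<^sup>+x. indicator K' x * pw q (w x - U x) \<partial>lborel) +
        ennreal (real CARD('n) powr q) * E))"
proof -
  let ?N = "real CARD('n)"
  let ?Y = "unit_cube :: (real^'n) set"
  have [measurable]: "?Y \<in> sets borel" by (simp add: unit_cube_eq_cube borel_open open_cube)
  have [measurable]: "w \<in> borel_measurable borel" "jac w \<in> borel_measurable borel"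
    "U \<in> borel_measurable borel" "jac U \<in> borel_measurable borel" "L \<in> borel_measurable borel"
    using continuous_on_smooth_map[OF w] continuous_on_jac[OF w] continuous_on_smooth_map[OF U] continuous_on_jac[OF U] cont
    by (auto intro: borel_measurable_continuous_onI)
  \<comment> \<open>\<open>G\<close> is only Borel, so joint measurability of
    \<open>G x *v y\<close> comes from the continuity of the matrix-vector product on pairs.\<close>
  have bil: "(\<lambda>p. fst p *v snd p :: real^'m) \<in> borel_measurable ((borel :: (real^'n^'m) measure) \<Otimes>\<^sub>M (borel :: (real^'n) measure))"
  proof -
    have "(\<lambda>p :: (real^'n^'m) \<times> (real^'n). fst p *v snd p) \<in> borel_measurable borel"
      by (intro borel_measurable_continuous_onI continuous_on_matrix_vector_mult continuous_intros)
    then show ?thesis by (simp add: borel_prod)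
  qed
  have mv[measurable]: "(\<lambda>x. A x *v z x :: real^'m) \<in> borel_measurable M"
    if [measurable]: "A \<in> borel_measurable M" "z \<in> borel_measurable M" for A :: "'z \<Rightarrow> real^'n^'m" and z :: "'z \<Rightarrow> real^'n" and M :: "'z measure"
  proof -
    have "(\<lambda>x. (A x, z x)) \<in> M \<rightarrow>\<^sub>M borel \<Otimes>\<^sub>M borel" by measurable
    from measurable_compose[OF this bil] show ?thesis by simp
  qed
  define F where "F x y = pw q ((1 / h) *\<^sub>R (w (x + h *\<^sub>R y) - U x) - G x *v y)" for x y
  have Fm[measurable]: "(\<lambda>p. F (fst p) (snd p)) \<in> borel_measurable (borel \<Otimes>\<^sub>M borel)"
    "F x \<in> borel_measurable borel" "(\<lambda>x. F x y) \<in> borel_measurable borel" for x y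
    unfolding F_def by (intro pw_measurable borel_measurable_diff mv; measurable)+
  have pt: "L (G x) \<le> (\<integral>\<^sup>+y. indicator ?Y y * L (jac w (x + h *\<^sub>R y)) \<partial>lborel) +
     c0 * (emeasure lborel S * (1 + pw q (G x)) + (\<integral>\<^sup>+y. indicator S y * pw q (jac w (x + h *\<^sub>R y)) \<partial>lborel)) +
     C * (\<integral>\<^sup>+y. indicator ?Y y * F x y \<partial>lborel)" for x
  proof -
    define v where "v y = (1 / h) *\<^sub>R (w (x + h *\<^sub>R y) - U x)" for y
    have v: "smooth_map v" "jac v y = jac w (x + h *\<^sub>R y)" for y
      using jac_rescale[OF w, of "1 / h" x h "U x"] h by (simp_all add: v_def[abs_def])
    have "(\<integral>\<^sup>+y. indicator S y * (1 + pw q (G x) + pw q (jac w (x + h *\<^sub>R y))) \<partial>lborel) =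
       (\<integral>\<^sup>+y. (1 + pw q (G x)) * indicator S y + indicator S y * pw q (jac w (x + h *\<^sub>R y)) \<partial>lborel)"
      by (intro nn_integral_cong) (auto simp: indicator_def)
    also have "\<dots> = emeasure lborel S * (1 + pw q (G x)) + (\<integral>\<^sup>+y. indicator S y * pw q (jac w (x + h *\<^sub>R y)) \<partial>lborel)"
    proof (subst nn_integral_add)
      have "(\<integral>\<^sup>+y. (1 + pw q (G x)) * indicator S y \<partial>lborel) = (1 + pw q (G x)) * emeasure lborel S"
        by (rule nn_integral_cmult_indicator) simp
      then show "(\<integral>\<^sup>+y. (1 + pw q (G x)) * indicator S y \<partial>lborel) + (\<integral>\<^sup>+y. indicator S y * pw q (jac w (x + h *\<^sub>R y)) \<partial>lborel)
        = emeasure lborel S * (1 + pw q (G x)) + (\<integral>\<^sup>+y. indicator S y * pw q (jac w (x + h *\<^sub>R y)) \<partial>lborel)"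
        by (simp only: mult.commute)
    qed simp_all
    finally show ?thesis using UC[OF v(1), of "G x"] by (simp add: v(2) v_def F_def)
  qed
  \<comment> \<open>For fixed y the deviation from the affine map splits into w - U at the shifted
    point and the first-order error of U between x and x + h y.\<close>
  have Fy: "(\<integral>\<^sup>+x. indicator K x * F x y \<partial>lborel) \<le> ennreal (2 powr q) * (ennreal ((1 / h) powr q) * (\<integral>\<^sup>+x. indicator K' x * pw q (w x - U x) \<partial>lborel) +
        ennreal (?N powr q) * E)" if y: "y \<in> ?Y" for y
  proof -
    have mvy[measurable]: "(\<lambda>x. G x *v (h *\<^sub>R y)) \<in> borel_measurable borel" by (rule mv) measurable
    have "F x y \<le> ennreal (2 powr q) * (ennreal ((1 / h) powr q) * pw q (w (x + h *\<^sub>R y) - U (x + h *\<^sub>R y)) +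
        ennreal ((1 / h) powr q) * pw q (U (x + h *\<^sub>R y) - U x - G x *v (h *\<^sub>R y)))" for x
    proof -
      have "G x *v y = (1 / h) *\<^sub>R (G x *v (h *\<^sub>R y))" using h by (simp add: matrix_vector_mult_scaleR)
      then have "(1 / h) *\<^sub>R (w (x + h *\<^sub>R y) - U x) - G x *v y =
          (1 / h) *\<^sub>R (w (x + h *\<^sub>R y) - U (x + h *\<^sub>R y)) + (1 / h) *\<^sub>R (U (x + h *\<^sub>R y) - U x - G x *v (h *\<^sub>R y))"
        by (simp add: scaleR_diff_right)
      then show ?thesis
        unfolding F_def using pw_add[of q "(1 / h) *\<^sub>R (w (x + h *\<^sub>R y) - U (x + h *\<^sub>R y))" "(1 / h) *\<^sub>R (U (x + h *\<^sub>R y) - U x - G x *v (h *\<^sub>R y))"] q h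
        by (simp add: pw_scaleR)
    qed
    then have "(\<integral>\<^sup>+x. indicator K x * F x y \<partial>lborel) \<le> (\<integral>\<^sup>+x. ennreal (2 powr q) * (ennreal ((1 / h) powr q) * (indicator K x * pw q (w (x + h *\<^sub>R y) - U (x + h *\<^sub>R y))) +
        ennreal ((1 / h) powr q) * (indicator K x * pw q (U (x + h *\<^sub>R y) - U x - G x *v (h *\<^sub>R y)))) \<partial>lborel)"
      by (intro nn_integral_mono) (auto simp: indicator_def)
    also have "\<dots> = ennreal (2 powr q) * (ennreal ((1 / h) powr q) * (\<integral>\<^sup>+x. indicator K x * pw q (w (x + h *\<^sub>R y) - U (x + h *\<^sub>R y)) \<partial>lborel) +
        ennreal ((1 / h) powr q) * (\<integral>\<^sup>+x. indicator K x * pw q (U (x + h *\<^sub>R y) - U x - G x *v (h *\<^sub>R y)) \<partial>lborel))"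
      by (simp add: nn_integral_cmult nn_integral_add)
    also have "\<dots> \<le> ennreal (2 powr q) * (ennreal ((1 / h) powr q) * (\<integral>\<^sup>+x. indicator K' x * pw q (w x - U x) \<partial>lborel) + ennreal (?N powr q) * E)"
    proof (intro mult_left_mono add_mono)
      have "(\<integral>\<^sup>+x. indicator K x * pw q (w (x + h *\<^sub>R y) - U (x + h *\<^sub>R y)) \<partial>lborel)
        \<le> (\<integral>\<^sup>+x. indicator K' (x + h *\<^sub>R y) * pw q (w (x + h *\<^sub>R y) - U (x + h *\<^sub>R y)) \<partial>lborel)"
        using sub y by (intro nn_integral_mono) (auto simp: indicator_def)
      also have "\<dots> = (\<integral>\<^sup>+x. indicator K' x * pw q (w x - U x) \<partial>lborel)"
        by (rule nn_integral_lborel_shift) measurable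
      finally show "(\<integral>\<^sup>+x. indicator K x * pw q (w (x + h *\<^sub>R y) - U (x + h *\<^sub>R y)) \<partial>lborel) \<le> (\<integral>\<^sup>+x. indicator K' x * pw q (w x - U x) \<partial>lborel)" .
      have ny: "norm y \<le> ?N" by (rule norm_unit_cube[OF y])
      have "(\<integral>\<^sup>+x. indicator K x * pw q (U (x + h *\<^sub>R y) - U x - G x *v (h *\<^sub>R y)) \<partial>lborel) \<le> ennreal (norm (h *\<^sub>R y) powr q) * E"
      proof (rule integral_FTC_pw[OF U q])
        fix t :: real assume t: "0 \<le> t" "t \<le> 1"
        have "t * (h * norm y) \<le> 1 * (h * ?N)" using t h ny by (intro mult_mono) auto
        then have "norm (t *\<^sub>R h *\<^sub>R y) \<le> h * ?N" using t h by simp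
        then show "(\<integral>\<^sup>+x. indicator K x * pw q (jac U (x + t *\<^sub>R h *\<^sub>R y) - G x) \<partial>lborel) \<le> E" by (rule E)
      qed measurable
      then have "ennreal ((1 / h) powr q) * (\<integral>\<^sup>+x. indicator K x * pw q (U (x + h *\<^sub>R y) - U x - G x *v (h *\<^sub>R y)) \<partial>lborel)
          \<le> ennreal ((1 / h) powr q) * (ennreal (norm (h *\<^sub>R y) powr q) * E)"
        by (rule mult_left_mono) simp
      also have "\<dots> = ennreal ((1 / h) powr q * norm (h *\<^sub>R y) powr q) * E" by (simp add: ennreal_mult mult.assoc)
      \<comment> \<open>The length |h y| of the increment cancels the 1/h of the rescaling, so this
        term stays bounded as h shrinks. The term with w - U has no such gain and keeps the weight
        (1/h)^q.\<close>
      also have "(1 / h) powr q * norm (h *\<^sub>R y) powr q = norm y powr q"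
        using h by (simp add: powr_mult powr_divide)
      also have "ennreal (norm y powr q) * E \<le> ennreal (?N powr q) * E"
        using ny q by (intro mult_right_mono ennreal_leI powr_mono2) auto
      finally show "ennreal ((1 / h) powr q) * (\<integral>\<^sup>+x. indicator K x * pw q (U (x + h *\<^sub>R y) - U x - G x *v (h *\<^sub>R y)) \<partial>lborel) \<le> ennreal (?N powr q) * E" .
    qed simp_all
    finally show ?thesis .
  qed
  have "(\<integral>\<^sup>+x. indicator K x * L (G x) \<partial>lborel) \<le> (\<integral>\<^sup>+x. indicator K x * (\<integral>\<^sup>+y. indicator ?Y y * L (jac w (x + h *\<^sub>R y)) \<partial>lborel) +
     c0 * (emeasure lborel S * (indicator K x * (1 + pw q (G x))) + indicator K x * (\<integral>\<^sup>+y. indicator S y * pw q (jac w (x + h *\<^sub>R y)) \<partial>lborel)) +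
     C * (indicator K x * (\<integral>\<^sup>+y. indicator ?Y y * F x y \<partial>lborel)) \<partial>lborel)"
    by (intro nn_integral_mono) (use pt in \<open>auto simp: indicator_def\<close>)
  also have "\<dots> = (\<integral>\<^sup>+x. indicator K x * (\<integral>\<^sup>+y. indicator ?Y y * L (jac w (x + h *\<^sub>R y)) \<partial>lborel) \<partial>lborel) +
     c0 * (emeasure lborel S * (\<integral>\<^sup>+x. indicator K x * (1 + pw q (G x)) \<partial>lborel) +
        (\<integral>\<^sup>+x. indicator K x * (\<integral>\<^sup>+y. indicator S y * pw q (jac w (x + h *\<^sub>R y)) \<partial>lborel) \<partial>lborel)) +
     C * (\<integral>\<^sup>+x. indicator K x * (\<integral>\<^sup>+y. indicator ?Y y * F x y \<partial>lborel) \<partial>lborel)"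
    by (simp add: nn_integral_cmult nn_integral_add)
  also have "\<dots> \<le> (\<integral>\<^sup>+x. indicator K' x * L (jac w x) \<partial>lborel) +
     c0 * (emeasure lborel S * (\<integral>\<^sup>+x. indicator K x * (1 + pw q (G x)) \<partial>lborel) + emeasure lborel S * (\<integral>\<^sup>+x. indicator K' x * pw q (jac w x) \<partial>lborel)) +
     C * (ennreal (2 powr q) * (ennreal ((1 / h) powr q) * (\<integral>\<^sup>+x. indicator K' x * pw q (w x - U x) \<partial>lborel) +
        ennreal (?N powr q) * E))"
  proof (intro add_mono mult_left_mono)
    show "(\<integral>\<^sup>+x. indicator K x * (\<integral>\<^sup>+y. indicator ?Y y * L (jac w (x + h *\<^sub>R y)) \<partial>lborel) \<partial>lborel) \<le> (\<integral>\<^sup>+x. indicator K' x * L (jac w x) \<partial>lborel)"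
      using average_shift_le[of "\<lambda>x. L (jac w x)" K K' ?Y h] sub by (simp add: emeasure_unit_cube)
    show "(\<integral>\<^sup>+x. indicator K x * (\<integral>\<^sup>+y. indicator S y * pw q (jac w (x + h *\<^sub>R y)) \<partial>lborel) \<partial>lborel) \<le> emeasure lborel S * (\<integral>\<^sup>+x. indicator K' x * pw q (jac w x) \<partial>lborel)"
      using average_shift_le[of "\<lambda>x. pw q (jac w x)" K K' S h] sub Ssub by simp
    have "(\<integral>\<^sup>+x. indicator K x * (\<integral>\<^sup>+y. indicator ?Y y * F x y \<partial>lborel) \<partial>lborel)
      = (\<integral>\<^sup>+x. (\<integral>\<^sup>+y. indicator ?Y y * (indicator K x * F x y) \<partial>lborel) \<partial>lborel)"
      by (simp add: mult.left_commute flip: nn_integral_cmult)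
    also have "\<dots> = (\<integral>\<^sup>+y. (\<integral>\<^sup>+x. indicator ?Y y * (indicator K x * F x y) \<partial>lborel) \<partial>lborel)"
      by (intro lborel_pair.Fubini'[symmetric]) (simp add: case_prod_beta)
    also have "\<dots> = (\<integral>\<^sup>+y. indicator ?Y y * (\<integral>\<^sup>+x. indicator K x * F x y \<partial>lborel) \<partial>lborel)"
      by (simp add: nn_integral_cmult)
    also have "\<dots> \<le> (\<integral>\<^sup>+y. (ennreal (2 powr q) * (ennreal ((1 / h) powr q) * (\<integral>\<^sup>+x. indicator K' x * pw q (w x - U x) \<partial>lborel) +
        ennreal (?N powr q) * E)) * indicator ?Y y \<partial>lborel)"
      using Fy by (intro nn_integral_mono) (auto simp: indicator_def)
    also have "\<dots> = ennreal (2 powr q) * (ennreal ((1 / h) powr q) * (\<integral>\<^sup>+x. indicator K' x * pw q (w x - U x) \<partial>lborel) +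
        ennreal (?N powr q) * E)"
      by (subst nn_integral_cmult_indicator) (simp_all add: emeasure_unit_cube)
    finally show "(\<integral>\<^sup>+x. indicator K x * (\<integral>\<^sup>+y. indicator ?Y y * F x y \<partial>lborel) \<partial>lborel) \<le>
      ennreal (2 powr q) * (ennreal ((1 / h) powr q) * (\<integral>\<^sup>+x. indicator K' x * pw q (w x - U x) \<partial>lborel) + ennreal (?N powr q) * E)" .
  qed simp_all
  finally show ?thesis by (simp add: distrib_left)
qed

section \<open>Approximation in energy\<close>

lemma nn_integral_Fatou_le:
  fixes f :: "nat \<Rightarrow> 'a \<Rightarrow> ennreal"
  assumes [measurable]: "\<And>n. f n \<in> borel_measurable M"
    and lim: "AE x in M. (\<lambda>n. f n x) \<longlonglongrightarrow> g x" and le: "\<And>n. (\<integral>\<^sup>+x. f n x \<partial>M) \<le> c"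
  shows "(\<integral>\<^sup>+x. g x \<partial>M) \<le> c"
proof -
  have "AE x in M. g x = liminf (\<lambda>n. f n x)"
    using lim by eventually_elim (metis lim_imp_Liminf trivial_limit_sequentially)
  then have "(\<integral>\<^sup>+x. g x \<partial>M) = (\<integral>\<^sup>+x. liminf (\<lambda>n. f n x) \<partial>M)" by (rule nn_integral_cong_AE)
  also have "\<dots> \<le> liminf (\<lambda>n. \<integral>\<^sup>+x. f n x \<partial>M)" by (rule nn_integral_liminf) simp
  also have "\<dots> \<le> c"
    using Liminf_mono[of "\<lambda>n. \<integral>\<^sup>+x. f n x \<partial>M" "\<lambda>_. c" sequentially] le by (simp add: Liminf_const)
  finally show ?thesis .
qed

lemma continuous_on_pw:
  assumes "0 < q"
  shows "continuous_on UNIV (pw q)"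
  unfolding pw_def using assms
  by (intro continuous_on_ennreal continuous_on_powr' continuous_intros) auto

text \<open>Three regimes. If A is large, the growth condition charges the tail term; if A is
  bounded and A' is close to it, uniform continuity gives \<epsilon>; if A is bounded and A' is at
  distance at least d, everything is absorbed in C |A' - A|^q.\<close>

lemma growth_modulus:
  fixes L :: "'a::euclidean_space \<Rightarrow> ennreal"
  assumes cont: "continuous_on UNIV L" and growth: "\<And>A. L A \<le> ennreal \<alpha> * (1 + pw q A)"
    and \<alpha>: "0 < \<alpha>" and q: "1 \<le> q" and \<epsilon>: "0 < \<epsilon>" and B: "1 \<le> B"
  shows "\<exists>C\<ge>0. \<forall>A A'. L A' \<le> L A + (ennreal \<epsilon> + ennreal C * pw q (A' - A) +
      ennreal (\<alpha> * (1 + 2 powr q)) * (indicator {A. B < norm A} A * pw q A))"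
proof -
  define l where "l A = enn2real (L A)" for A
  have fin: "L A < \<infinity>" for A
  proof -
    have "L A \<le> ennreal \<alpha> * (1 + pw q A)" by (rule growth)
    also have "\<dots> < \<infinity>" by (simp add: pw_def ennreal_mult_less_top)
    finally show ?thesis .
  qed
  have Ll: "L A = ennreal (l A)" for A using fin[of A] by (simp add: l_def)
  have l0: "l A \<ge> 0" for A by (simp add: l_def)
  have lg: "l A \<le> \<alpha> * (1 + norm A powr q)" for A
  proof -
    have "ennreal (l A) \<le> ennreal \<alpha> * (1 + pw q A)" using growth[of A] by (simp add: Ll)
    also have "\<dots> = ennreal (\<alpha> * (1 + norm A powr q))"
      using \<alpha> by (simp add: pw_def ennreal_mult)
    finally show ?thesis using \<alpha> by (subst (asm) ennreal_le_iff) auto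
  qed
  have contl: "continuous_on UNIV l"
    unfolding continuous_on_def
  proof
    fix A :: 'a
    have "(L \<longlongrightarrow> L A) (at A)" using cont by (simp add: continuous_on_def)
    then have "(L \<longlongrightarrow> ennreal (l A)) (at A)" unfolding Ll[of A] .
    then have "((\<lambda>A. enn2real (L A)) \<longlongrightarrow> l A) (at A)" by (rule tendsto_enn2real) (rule l0)
    then show "(l \<longlongrightarrow> l A) (at A within UNIV)" by (simp add: l_def[abs_def])
  qed
  have split: "norm A' powr q \<le> 2 powr q * (norm A powr q + norm (A' - A) powr q)" for A A' :: 'a
  proof -
    have "pw q (A + (A' - A)) \<le> ennreal (2 powr q) * (pw q A + pw q (A' - A))"
      using q by (intro pw_add) simp
    then show ?thesis by (simp add: pw_def flip: ennreal_plus ennreal_mult)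
  qed
  have "uniformly_continuous_on (cball 0 (B + 1)) l"
    by (intro compact_uniformly_continuous continuous_on_subset[OF contl]) auto
  then obtain \<delta> where \<delta>: "\<delta> > 0" "\<And>A A'. A \<in> cball 0 (B + 1) \<Longrightarrow> A' \<in> cball 0 (B + 1) \<Longrightarrow> dist A' A < \<delta> \<Longrightarrow> dist (l A') (l A) < \<epsilon>"
    using \<epsilon> unfolding uniformly_continuous_on_def by metis
  \<comment> \<open>The bound by 1 keeps A' inside the ball of radius B + 1 on which
    \<open>l\<close> is uniformly continuous.\<close>
  define d where "d = min \<delta> 1"
  have d: "d > 0" using \<delta>(1) by (simp add: d_def)
  \<comment> \<open>The first summand pays for all terms not involving A' - A, using |A' - A| >= d;
    the second pays for the part of |A'|^q that comes from A' - A.\<close>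
  define C where "C = \<alpha> * (1 + 2 powr q * B powr q) / d powr q + \<alpha> * 2 powr q"
  have C0: "C \<ge> 0" using \<alpha> by (simp add: C_def)
  have real: "l A' \<le> l A + (\<epsilon> + C * norm (A' - A) powr q + \<alpha> * (1 + 2 powr q) * (indicator {A. B < norm A} A * norm A powr q))" for A A'
  proof -
    have up: "l A' \<le> \<alpha> * (1 + 2 powr q * (norm A powr q + norm (A' - A) powr q))"
      using lg[of A'] mult_left_mono[OF split[of A' A], of \<alpha>] \<alpha> by (simp add: distrib_left)
    consider "B < norm A" | "norm A \<le> B" "norm (A' - A) < d" | "norm A \<le> B" "d \<le> norm (A' - A)" by linarith
    then show ?thesis
    proof cases
      case 1
      \<comment> \<open>Since B >= 1, the constant 1 in the growth bound is itself dominated by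
        |A|^q in this regime.\<close>
      have "1 \<le> norm A powr q" using 1 B q by (intro ge_one_powr_ge_zero) auto
      then have "\<alpha> * 1 \<le> \<alpha> * norm A powr q" using \<alpha> by (intro mult_left_mono) auto
      moreover have "\<alpha> * 2 powr q * norm (A' - A) powr q \<le> C * norm (A' - A) powr q"
        using \<alpha> d by (intro mult_right_mono) (auto simp: C_def)
      ultimately show ?thesis using up l0[of A] \<epsilon> 1 by (simp add: algebra_simps)
    next
      case 2
      have "norm A' \<le> norm A + norm (A' - A)" by (rule norm_triangle_sub)
      then have "A' \<in> cball 0 (B + 1)" using 2 by (simp add: d_def)
      then have "dist (l A') (l A) < \<epsilon>" using 2 by (intro \<delta>(2)) (auto simp: d_def dist_norm)
      then have "l A' \<le> l A + \<epsilon>" by (simp add: dist_norm abs_less_iff)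
      moreover have "0 \<le> C * norm (A' - A) powr q + \<alpha> * (1 + 2 powr q) * (indicator {A. B < norm A} A * norm A powr q)"
        using C0 \<alpha> by (intro add_nonneg_nonneg mult_nonneg_nonneg) auto
      ultimately show ?thesis by linarith
    next
      case 3
      have "norm A powr q \<le> B powr q" using 3 q by (intro powr_mono2) auto
      then have "\<alpha> * (1 + 2 powr q * norm A powr q) \<le> \<alpha> * (1 + 2 powr q * B powr q)"
        using \<alpha> by (intro mult_left_mono add_left_mono) auto
      moreover have "\<alpha> * (1 + 2 powr q * B powr q) \<le> \<alpha> * (1 + 2 powr q * B powr q) / d powr q * norm (A' - A) powr q"
      proof -
        have "d powr q \<le> norm (A' - A) powr q" using 3 q d by (intro powr_mono2) auto
        then have "1 \<le> norm (A' - A) powr q / d powr q" using d by simp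
        then have "\<alpha> * (1 + 2 powr q * B powr q) * 1 \<le> \<alpha> * (1 + 2 powr q * B powr q) * (norm (A' - A) powr q / d powr q)"
          using \<alpha> by (intro mult_left_mono) auto
        then show ?thesis by simp
      qed
      ultimately have "\<alpha> * (1 + 2 powr q * (norm A powr q + norm (A' - A) powr q)) \<le> C * norm (A' - A) powr q"
        unfolding C_def distrib_right distrib_left by linarith
      then show ?thesis using up l0[of A] \<epsilon> 3 by simp
    qed
  qed
  show ?thesis
  proof (intro exI[of _ C] conjI allI)
    fix A A' :: 'a
    have nn: "0 \<le> \<alpha> * (1 + 2 powr q) * (indicator {A. B < norm A} A * norm A powr q)"
      using \<alpha> by simp
    have "L A' \<le> ennreal (l A + (\<epsilon> + C * norm (A' - A) powr q + \<alpha> * (1 + 2 powr q) * (indicator {A. B < norm A} A * norm A powr q)))"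
      unfolding Ll by (intro ennreal_leI real)
    also have "\<dots> = L A + (ennreal \<epsilon> + ennreal C * pw q (A' - A) +
      ennreal (\<alpha> * (1 + 2 powr q)) * (indicator {A. B < norm A} A * pw q A))"
      using \<alpha> \<epsilon> C0 l0[of A] by (simp add: Ll pw_def ennreal_mult ennreal_indicator[symmetric] del: ennreal_indicator)
    finally show "L A' \<le> L A + (ennreal \<epsilon> + ennreal C * pw q (A' - A) +
      ennreal (\<alpha> * (1 + 2 powr q)) * (indicator {A. B < norm A} A * pw q A))" .
  qed (rule C0)
qed

text \<open>Upper semicontinuity of the energy under L^q convergence. The truncation level is fixed
  first, then the constant of \<open>growth_modulus\<close>, then \<delta>. The tail term involves
  only the fixed function \<open>F\<close>, so dominated convergence makes it small uniformly in
  \<open>F'\<close>.\<close>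

lemma superposition_approx:
  fixes L :: "'b::euclidean_space \<Rightarrow> ennreal" and F :: "'a::euclidean_space \<Rightarrow> 'b"
  assumes cont: "continuous_on UNIV L" and growth: "\<And>A. L A \<le> ennreal \<alpha> * (1 + pw q A)"
    and \<alpha>: "0 < \<alpha>" and q: "1 \<le> q"
    and [measurable]: "F \<in> borel_measurable borel" "T \<in> sets borel"
    and F: "(\<integral>\<^sup>+x. pw q (F x) \<partial>lborel) < \<infinity>" and T: "emeasure lborel T < \<infinity>" and e: "0 < e"
  shows "\<exists>\<delta>>0. \<forall>F'. F' \<in> borel_measurable borel \<longrightarrow> (\<integral>\<^sup>+x. pw q (F' x - F x) \<partial>lborel) \<le> ennreal \<delta> \<longrightarrow>
     (\<integral>\<^sup>+x. indicator T x * L (F' x) \<partial>lborel) \<le> (\<integral>\<^sup>+x. indicator T x * L (F x) \<partial>lborel) + ennreal e"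
proof -
  have [measurable]: "L \<in> borel_measurable borel" by (rule borel_measurable_continuous_onI[OF cont])
  define c0 where "c0 = \<alpha> * (1 + 2 powr q)"
  have c0: "c0 > 0" using \<alpha> by (simp add: c0_def add_pos_nonneg)
  define \<tau> where "\<tau> = measure lborel T"
  have \<tau>: "emeasure lborel T = ennreal \<tau>" "\<tau> \<ge> 0"
    using T by (auto simp: \<tau>_def emeasure_eq_ennreal_measure)
  \<comment> \<open>The modulus \<epsilon> is paid on all of \<open>T\<close>, hence the division by
    its measure. It, the L^q distance and the tail each receive a third of \<open>e\<close>.\<close>
  define \<epsilon> where "\<epsilon> = e / (3 * (\<tau> + 1))"
  have \<epsilon>: "\<epsilon> > 0" using e \<tau>(2) by (simp add: \<epsilon>_def)
  have "(\<lambda>n. \<integral>\<^sup>+x. indicator {A. real n < norm A} (F x) * pw q (F x) \<partial>lborel) \<longlonglongrightarrow> (\<integral>\<^sup>+x. 0 \<partial>(lborel :: 'a measure))"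
  proof (rule nn_integral_dominated_convergence[where w = "\<lambda>x. pw q (F x)"])
    show "AE x in lborel. indicator {A. real n < norm A} (F x) * pw q (F x) \<le> pw q (F x)" for n
      by (auto simp: indicator_def)
    show "AE x in lborel. (\<lambda>n. indicator {A. real n < norm A} (F x) * pw q (F x)) \<longlonglongrightarrow> 0"
    proof (rule AE_I2)
      fix x
      obtain N where "norm (F x) \<le> real N" using real_arch_simple by blast
      then have "\<forall>n\<ge>N. indicator {A. real n < norm A} (F x) * pw q (F x) = 0" by (auto simp: indicator_def)
      then show "(\<lambda>n. indicator {A. real n < norm A} (F x) * pw q (F x)) \<longlonglongrightarrow> 0"
        by (intro tendsto_eventually) (auto simp: eventually_sequentially)
    qed
  qed (use F in auto)
  then have "\<forall>\<^sub>F n in sequentially. (\<integral>\<^sup>+x. indicator {A. real n < norm A} (F x) * pw q (F x) \<partial>lborel) < ennreal (e / (3 * c0))"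
    using e c0 by (intro order_tendstoD(2)[where y = 0]) auto
  then have "\<forall>\<^sub>F n in sequentially. 1 \<le> n \<and> (\<integral>\<^sup>+x. indicator {A. real n < norm A} (F x) * pw q (F x) \<partial>lborel) < ennreal (e / (3 * c0))"
    by (intro eventually_conj eventually_ge_at_top)
  then obtain n where n: "1 \<le> n" "(\<integral>\<^sup>+x. indicator {A. real n < norm A} (F x) * pw q (F x) \<partial>lborel) < ennreal (e / (3 * c0))"
    by (auto simp: eventually_sequentially)
  obtain C where C: "C \<ge> 0" "\<And>A A'. L A' \<le> L A + (ennreal \<epsilon> + ennreal C * pw q (A' - A) +
      ennreal c0 * (indicator {A. real n < norm A} A * pw q A))"
    using growth_modulus[OF cont growth \<alpha> q \<epsilon>, of "real n"] n(1) unfolding c0_def by auto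
  define \<delta> where "\<delta> = e / (3 * (C + 1))"
  have \<delta>: "\<delta> > 0" using e C(1) by (simp add: \<delta>_def)
  show ?thesis
  proof (intro exI[of _ \<delta>] conjI allI impI)
    fix F' :: "'a \<Rightarrow> 'b" assume [measurable]: "F' \<in> borel_measurable borel"
      and F': "(\<integral>\<^sup>+x. pw q (F' x - F x) \<partial>lborel) \<le> ennreal \<delta>"
    have "(\<integral>\<^sup>+x. indicator T x * L (F' x) \<partial>lborel) \<le> (\<integral>\<^sup>+x. indicator T x * L (F x) + (ennreal \<epsilon> * indicator T x + ennreal C * pw q (F' x - F x) +
      ennreal c0 * (indicator {A. real n < norm A} (F x) * pw q (F x))) \<partial>lborel)"
    proof (rule nn_integral_mono)
      fix x
      show "indicator T x * L (F' x) \<le> indicator T x * L (F x) + (ennreal \<epsilon> * indicator T x + ennreal C * pw q (F' x - F x) +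
      ennreal c0 * (indicator {A. real n < norm A} (F x) * pw q (F x)))"
        using C(2)[of "F' x" "F x"] by (cases "x \<in> T") auto
    qed
    also have "\<dots> = (\<integral>\<^sup>+x. indicator T x * L (F x) \<partial>lborel) + (ennreal \<epsilon> * emeasure lborel T + ennreal C * (\<integral>\<^sup>+x. pw q (F' x - F x) \<partial>lborel) +
      ennreal c0 * (\<integral>\<^sup>+x. indicator {A. real n < norm A} (F x) * pw q (F x) \<partial>lborel))"
      by (simp add: nn_integral_add nn_integral_cmult nn_integral_cmult_indicator)
    also have "\<dots> \<le> (\<integral>\<^sup>+x. indicator T x * L (F x) \<partial>lborel) + (ennreal \<epsilon> * ennreal \<tau> + ennreal C * ennreal \<delta> + ennreal c0 * ennreal (e / (3 * c0)))"
      using F' n(2) \<tau>(1) by (intro add_left_mono add_mono mult_left_mono) auto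
    also have "ennreal \<epsilon> * ennreal \<tau> + ennreal C * ennreal \<delta> + ennreal c0 * ennreal (e / (3 * c0)) = ennreal (\<epsilon> * \<tau> + C * \<delta> + c0 * (e / (3 * c0)))"
      using \<epsilon> \<tau>(2) C(1) \<delta> c0 e by (simp flip: ennreal_plus ennreal_mult)
    also have "\<dots> \<le> ennreal e"
    proof (rule ennreal_leI)
      have "\<epsilon> * \<tau> \<le> e / 3"
      proof -
        have "\<epsilon> * \<tau> \<le> \<epsilon> * (\<tau> + 1)" using \<epsilon> by (intro mult_left_mono) auto
        also have "\<dots> = e / 3" using \<tau>(2) by (simp add: \<epsilon>_def divide_simps)
        finally show ?thesis .
      qed
      moreover have "C * \<delta> \<le> e / 3"
      proof -
        have "C * \<delta> \<le> (C + 1) * \<delta>" using \<delta> by (intro mult_right_mono) auto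
        also have "\<dots> = e / 3" using C(1) by (simp add: \<delta>_def divide_simps)
        finally show ?thesis .
      qed
      moreover have "c0 * (e / (3 * c0)) = e / 3" using c0 by simp
      ultimately show "\<epsilon> * \<tau> + C * \<delta> + c0 * (e / (3 * c0)) \<le> e" by linarith
    qed
    finally show "(\<integral>\<^sup>+x. indicator T x * L (F' x) \<partial>lborel) \<le> (\<integral>\<^sup>+x. indicator T x * L (F x) \<partial>lborel) + ennreal e"
      by (simp add: add_left_mono)
  qed (rule \<delta>)
qed

text \<open>Weak gradients for Borel functions integrable on the whole space, whose convolutions make
  sense everywhere; the values outside \<open>\<Omega>\<close> are arbitrary.\<close>

definition wgrad :: "(real^'n) set \<Rightarrow> (real^'n \<Rightarrow> real^'m) \<Rightarrow> (real^'n \<Rightarrow> real^'n^'m) \<Rightarrow> bool" where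
  "wgrad \<Omega> u G \<longleftrightarrow> integrable lborel u \<and> integrable lborel G \<and>
     (\<forall>\<phi> i j. test_function \<Omega> \<phi> \<longrightarrow>
        (LINT x|lborel. u x $ i * partial_deriv j \<phi> x) = - (LINT x|lborel. G x $ i $ j * \<phi> x))"

section \<open>Mollification of Sobolev functions\<close>

lemma integrable_nth:
  fixes u :: "'a \<Rightarrow> 'b::euclidean_space^'m"
  shows "integrable M u \<Longrightarrow> integrable M (\<lambda>x. u x $ i)"
  by (rule integrable_bounded_linear[OF bounded_linear_vec_nth])

lemma smooth_map_conv:
  fixes u :: "real^'n \<Rightarrow> real^'m"
  assumes "smooth_supp r \<rho>" "integrable lborel u"
  shows "smooth_map (conv \<rho> u)"
  unfolding smooth_map_def conv_nth[OF assms] by (intro allI C_k_conv[OF assms(1) integrable_nth[OF assms(2)]])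

lemma jac_conv_nth:
  fixes u :: "real^'n \<Rightarrow> real^'m"
  assumes "smooth_supp r \<rho>" "integrable lborel u"
  shows "jac (conv \<rho> u) x $ i $ j = conv (partial_deriv j \<rho>) (\<lambda>x. u x $ i) x"
  unfolding jac_def conv_nth[OF assms] using partial_deriv_conv[OF assms(1) integrable_nth[OF assms(2)]] by simp

text \<open>The derivative falls on the kernel, whose reflection at x is a test function because the
  ball of radius r lies in \<Omega>. The sign from the reflection cancels the sign in the definition
  of the weak gradient.\<close>

lemma jac_conv:
  fixes u :: "real^'n \<Rightarrow> real^'m"
  assumes s: "smooth_supp r \<rho>" and w: "wgrad \<Omega> u G" and x: "cball x r \<subseteq> \<Omega>"
  shows "jac (conv \<rho> u) x = conv \<rho> G x"
proof -
  have int: "integrable lborel u" "integrable lborel G" using w by (auto simp: wgrad_def)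
  have "jac (conv \<rho> u) x $ i $ j = conv \<rho> G x $ i $ j" for i j
  proof -
    have "partial_deriv j (\<lambda>y. \<rho> (x - y)) = (\<lambda>y. - partial_deriv j \<rho> (x - y))"
      using partial_deriv_affine[OF smooth_suppD(2)[OF s], of j x "-1"] by simp
    moreover have "(LINT y|lborel. u y $ i * partial_deriv j (\<lambda>y. \<rho> (x - y)) y) = - (LINT y|lborel. G y $ i $ j * \<rho> (x - y))"
      using w test_function_translate[OF s x] unfolding wgrad_def by blast
    ultimately have "(LINT y|lborel. u y $ i * partial_deriv j \<rho> (x - y)) = (LINT y|lborel. G y $ i $ j * \<rho> (x - y))"
      by simp
    moreover have "conv \<rho> G x $ i $ j = conv \<rho> (\<lambda>y. G y $ i $ j) x"
      by (simp add: conv_nth[OF s int(2)] conv_nth[OF s integrable_nth[OF int(2)]])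
    ultimately show ?thesis
      unfolding jac_conv_nth[OF s int(1)] by (simp add: conv_def mult.commute)
  qed
  then show ?thesis by (simp add: vec_eq_iff)
qed

lemma conv_Lq_norm_le:
  assumes q: "1 \<le> q" and \<rho>: "mollifier r \<rho>" and f: "integrable lborel f"
  shows "(\<integral>\<^sup>+x. pw q (conv \<rho> f x) \<partial>lborel) \<le> (\<integral>\<^sup>+x. pw q (f x) \<partial>lborel)"
proof -
  have [measurable]: "f \<in> borel_measurable borel" using f by auto
  have "(\<integral>\<^sup>+x. indicator UNIV x * pw q (f (x + 0 - z) - 0) \<partial>lborel) \<le> (\<integral>\<^sup>+x. pw q (f x) \<partial>lborel)" for z
    using nn_integral_lborel_shift[of "\<lambda>x. pw q (f x)" "- z"] by simp
  from conv_Lq_le[OF q \<rho> f _ _ this] show ?thesis by simp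
qed

text \<open>A finite net of \<open>K\<close> turns pointwise into uniform convergence. The Lipschitz
  bound concerns nearby points only, since it will come from a mean value argument on a ball inside
  the domain.\<close>

lemma equi_Lipschitz_uniform_limit:
  fixes f :: "nat \<Rightarrow> 'a::metric_space \<Rightarrow> 'b::real_normed_vector"
  assumes K: "compact K" and lim: "\<And>x. x \<in> K \<Longrightarrow> (\<lambda>n. f n x) \<longlonglongrightarrow> 0"
    and r: "0 < r" and \<Lambda>: "0 \<le> \<Lambda>"
    and lip: "\<And>n x y. x \<in> K \<Longrightarrow> y \<in> K \<Longrightarrow> dist x y \<le> r \<Longrightarrow> norm (f n x - f n y) \<le> \<Lambda> * dist x y"
    and e: "0 < e"
  shows "\<forall>\<^sub>F n in sequentially. \<forall>x\<in>K. norm (f n x) < e"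
proof -
  define d where "d = min r (e / (2 * (\<Lambda> + 1)))"
  have d: "d > 0" using r \<Lambda> e by (simp add: d_def)
  have cover: "K \<subseteq> (\<Union>x\<in>K. ball x d)" using d by auto
  obtain D where D: "finite D" "D \<subseteq> K" "K \<subseteq> (\<Union>x\<in>D. ball x d)"
    using compactE_image[OF K _ cover] open_ball by metis
  have "\<forall>\<^sub>F n in sequentially. \<forall>x\<in>D. norm (f n x) < e / 2"
  proof (rule eventually_ball_finite[OF D(1)], rule ballI)
    fix x assume "x \<in> D"
    then have "(\<lambda>n. norm (f n x)) \<longlonglongrightarrow> 0" using lim D(2) by (intro tendsto_norm_zero) auto
    then show "\<forall>\<^sub>F n in sequentially. norm (f n x) < e / 2" using e by (intro order_tendstoD(2)) auto
  qed
  then show ?thesis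
  proof eventually_elim
    case (elim n)
    show ?case
    proof
      fix y assume y: "y \<in> K"
      then obtain x where x: "x \<in> D" "dist x y < d" using D(3) by auto
      have "norm (f n y) \<le> norm (f n x) + norm (f n x - f n y)"
        using norm_triangle_ineq4[of "f n x" "f n x - f n y"] by simp
      also have "norm (f n x - f n y) \<le> \<Lambda> * dist x y"
        using x y D(2) by (intro lip) (auto simp: d_def)
      also have "\<dots> \<le> (\<Lambda> + 1) * (e / (2 * (\<Lambda> + 1)))"
        using x(2) \<Lambda> by (intro mult_mono) (auto simp: d_def)
      also have "\<dots> = e / 2" using \<Lambda> by (simp add: divide_simps)
      finally show "norm (f n y) < e" using elim x(1) by fastforce
    qed
  qed
qed

lemma tendsto_pw:
  assumes "0 < q" "(f \<longlongrightarrow> a) F"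
  shows "((\<lambda>x. pw q (f x)) \<longlongrightarrow> pw q a) F"
  using continuous_on_tendsto_compose[OF continuous_on_pw[OF assms(1)] assms(2)] by simp

section \<open>Lower semicontinuity on compact subsets\<close>

text \<open>The analytic core, freed from the choice of representatives: Borel data integrable on
  the whole space, with gradients extended by 0 so that \<open>energy\<close> controls their global
  norms. Convergence is assumed against test functions only, and the aim is to give the limit the
  same energy level \<open>c\<close> on compact sets.\<close>

locale bounded_energy_sequence =
  fixes \<Omega> :: "(real^'n) set" and L :: "real^'n^'m \<Rightarrow> ennreal" and q \<alpha> \<beta> c :: real
    and u :: "nat \<Rightarrow> real^'n \<Rightarrow> real^'m" and G :: "nat \<Rightarrow> real^'n \<Rightarrow> real^'n^'m"
    and v :: "real^'n \<Rightarrow> real^'m" and H :: "real^'n \<Rightarrow> real^'n^'m"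
  assumes open_\<Omega>: "open \<Omega>" and bounded_\<Omega>: "bounded \<Omega>"
    and q1: "1 \<le> q" and \<alpha>0: "0 < \<alpha>" and \<beta>0: "0 < \<beta>" and c0: "0 \<le> c"
    and cont: "continuous_on UNIV L" and quasiconvex: "W1q_quasiconvex q L"
    and growth: "\<And>\<xi>. L \<xi> \<le> ennreal \<alpha> * (1 + pw q \<xi>)"
    and coercive: "\<And>\<xi>. ennreal \<beta> * pw q \<xi> \<le> L \<xi>"
    and wgrad_u: "\<And>n. wgrad \<Omega> (u n) (G n)" and wgrad_v: "wgrad \<Omega> v H"
    and supp: "\<And>n x. x \<notin> \<Omega> \<Longrightarrow> G n x = 0"
    and weak_lim: "\<And>\<phi> i. test_function \<Omega> \<phi> \<Longrightarrow> (\<lambda>n. LINT x|lborel. u n x $ i * \<phi> x) \<longlonglongrightarrow> (LINT x|lborel. v x $ i * \<phi> x)"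
    and energy: "\<And>n. (\<integral>\<^sup>+x. indicator \<Omega> x * L (G n x) \<partial>lborel) \<le> ennreal c"
begin

lemma ints: "integrable lborel (u n)" "integrable lborel (G n)" "integrable lborel v" "integrable lborel H"
  using wgrad_u wgrad_v by (auto simp: wgrad_def)

lemma meas [measurable]: "u n \<in> borel_measurable borel" "G n \<in> borel_measurable borel"
  "v \<in> borel_measurable borel" "H \<in> borel_measurable borel" "\<Omega> \<in> sets borel" "L \<in> borel_measurable borel"
  using ints(1)[of n] ints(2)[of n] ints(3,4) open_\<Omega> borel_measurable_continuous_onI[OF cont] by auto

lemma coercive_integral:
  assumes [measurable]: "F \<in> borel_measurable borel" "T \<in> sets borel"
    and le: "(\<integral>\<^sup>+x. indicator T x * L (F x) \<partial>lborel) \<le> ennreal b" and b: "0 \<le> b"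
  shows "(\<integral>\<^sup>+x. indicator T x * pw q (F x) \<partial>lborel) \<le> ennreal (b / \<beta>)"
proof -
  have "ennreal \<beta> * (\<integral>\<^sup>+x. indicator T x * pw q (F x) \<partial>lborel) = (\<integral>\<^sup>+x. indicator T x * (ennreal \<beta> * pw q (F x)) \<partial>lborel)"
    by (simp add: mult.left_commute flip: nn_integral_cmult)
  also have "\<dots> \<le> (\<integral>\<^sup>+x. indicator T x * L (F x) \<partial>lborel)"
    by (intro nn_integral_mono mult_left_mono coercive) simp
  finally have "ennreal \<beta> * (\<integral>\<^sup>+x. indicator T x * pw q (F x) \<partial>lborel) \<le> ennreal b" using le by simp
  then have "ennreal (1 / \<beta>) * (ennreal \<beta> * (\<integral>\<^sup>+x. indicator T x * pw q (F x) \<partial>lborel)) \<le> ennreal (1 / \<beta>) * ennreal b"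
    by (rule mult_left_mono) simp
  then show ?thesis
    using \<beta>0 b by (simp flip: ennreal_mult mult.assoc)
qed

lemma gradient_energy: "(\<integral>\<^sup>+x. pw q (G n x) \<partial>lborel) \<le> ennreal (c / \<beta>)"
proof -
  have "(\<integral>\<^sup>+x. indicator \<Omega> x * pw q (G n x) \<partial>lborel) \<le> ennreal (c / \<beta>)"
    by (rule coercive_integral[OF _ _ energy c0]) measurable
  moreover have "indicator \<Omega> x * pw q (G n x) = pw q (G n x)" for x
    using supp[of x n] by (cases "x \<in> \<Omega>") auto
  ultimately show ?thesis by simp
qed

text \<open>From t <= 1 + t^q on the bounded set \<Omega>. Paired with a bounded kernel, an L^1
  bound yields Lipschitz bounds for mollifications.\<close>

lemma gradient_L1: "(LINT x|lborel. norm (G n x)) \<le> measure lborel \<Omega> + c / \<beta>"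
proof -
  have fin: "emeasure lborel \<Omega> < \<infinity>" by (rule emeasure_bounded_finite[OF bounded_\<Omega>])
  have le: "norm \<xi> \<le> 1 + norm \<xi> powr q" for \<xi> :: "real^'n^'m"
  proof (cases "norm \<xi> \<le> 1")
    case False
    then have "norm \<xi> powr 1 \<le> norm \<xi> powr q" using q1 by (intro powr_mono) auto
    then show ?thesis using False by simp
  qed (simp add: add_increasing2)
  have "ennreal (LINT x|lborel. norm (G n x)) = (\<integral>\<^sup>+x. norm (G n x) \<partial>lborel)"
    using ints(2)[of n] by (simp add: nn_integral_eq_integral)
  also have "\<dots> \<le> (\<integral>\<^sup>+x. indicator \<Omega> x + pw q (G n x) \<partial>lborel)"
  proof (rule nn_integral_mono)
    fix x
    have "ennreal (norm (G n x)) \<le> 1 + pw q (G n x)"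
      using ennreal_leI[OF le[of "G n x"]] by (simp add: pw_def)
    then show "ennreal (norm (G n x)) \<le> indicator \<Omega> x + pw q (G n x)"
      using supp[of x n] by (cases "x \<in> \<Omega>") auto
  qed
  also have "\<dots> = emeasure lborel \<Omega> + (\<integral>\<^sup>+x. pw q (G n x) \<partial>lborel)"
    by (subst nn_integral_add) auto
  also have "\<dots> \<le> ennreal (measure lborel \<Omega>) + ennreal (c / \<beta>)"
    using gradient_energy[of n] fin by (intro add_mono) (auto simp: emeasure_eq_ennreal_measure)
  also have "\<dots> = ennreal (measure lborel \<Omega> + c / \<beta>)" using c0 \<beta>0 by simp
  finally show ?thesis using c0 \<beta>0 by (subst (asm) ennreal_le_iff) auto
qed

lemma conv_u_tendsto:
  assumes s: "smooth_supp r \<rho>" and x: "cball x r \<subseteq> \<Omega>"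
  shows "(\<lambda>n. conv \<rho> (u n) x) \<longlonglongrightarrow> conv \<rho> v x"
proof (rule vec_tendstoI)
  fix i
  have "(\<lambda>n. LINT y|lborel. u n y $ i * \<rho> (x - y)) \<longlonglongrightarrow> (LINT y|lborel. v y $ i * \<rho> (x - y))"
    by (rule weak_lim[OF test_function_translate[OF s x]])
  then show "(\<lambda>n. conv \<rho> (u n) x $ i) \<longlonglongrightarrow> conv \<rho> v x $ i"
    by (simp add: conv_nth[OF s ints(1)] conv_nth[OF s ints(3)]) (simp add: conv_def mult.commute)
qed

text \<open>The derivative is moved onto the kernel, where it is again a test function, so the
  convergence of \<open>u\<close> against test functions already gives that of the mollified
  gradients.\<close>

lemma conv_G_tendsto:
  assumes s: "smooth_supp r \<rho>" and x: "cball x r \<subseteq> \<Omega>"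
  shows "(\<lambda>n. conv \<rho> (G n) x) \<longlonglongrightarrow> conv \<rho> H x"
proof -
  have "(\<lambda>n. jac (conv \<rho> (u n)) x) \<longlonglongrightarrow> jac (conv \<rho> v) x"
  proof (intro vec_tendstoI)
    fix i j
    have s': "smooth_supp r (partial_deriv j \<rho>)" by (rule smooth_supp_partial_deriv[OF s])
    have "(\<lambda>n. conv (partial_deriv j \<rho>) (u n) x $ i) \<longlonglongrightarrow> conv (partial_deriv j \<rho>) v x $ i"
      by (intro tendsto_vec_nth conv_u_tendsto[OF s' x])
    then show "(\<lambda>n. jac (conv \<rho> (u n)) x $ i $ j) \<longlonglongrightarrow> jac (conv \<rho> v) x $ i $ j"
      by (simp add: jac_conv_nth[OF s ints(1)] jac_conv_nth[OF s ints(3)] conv_nth[OF s' ints(1)] conv_nth[OF s' ints(3)])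
  qed
  then show ?thesis by (simp add: jac_conv[OF s wgrad_u x] jac_conv[OF s wgrad_v x])
qed

text \<open>Fatou's lemma twice: along the sequence for a fixed mollifier, then along mollifiers
  that shrink.\<close>

lemma limit_gradient_Lq:
  assumes [measurable]: "T \<in> sets borel" and r: "0 < r" "\<And>x. x \<in> T \<Longrightarrow> cball x r \<subseteq> \<Omega>"
  shows "(\<integral>\<^sup>+x. indicator T x * pw q (H x) \<partial>lborel) \<le> ennreal (c / \<beta>)"
proof -
  \<comment> \<open>Whether \<open>H\<close> lies in L^q is what is being proved, so its
    mollifications are compared with it in L^1.\<close>
  have fin1: "(\<integral>\<^sup>+x. pw 1 (H x) \<partial>lborel) < \<infinity>" using ints(4) by (simp add: pw_def integrable_iff_bounded)
  define Q where "Q k s \<rho> \<longleftrightarrow> mollifier s \<rho> \<and> s \<le> r \<and> (\<integral>\<^sup>+x. pw 1 (conv \<rho> H x - H x) \<partial>lborel) \<le> ennreal (1 / Suc k)"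
    for k :: nat and s \<rho>
  have "\<exists>s \<rho>. Q k s \<rho>" for k
  proof -
    obtain \<delta> where \<delta>: "\<delta> > 0" "\<And>s \<rho>. mollifier s \<rho> \<Longrightarrow> s \<le> \<delta> \<Longrightarrow> (\<integral>\<^sup>+x. pw 1 (conv \<rho> H x - H x) \<partial>lborel) \<le> ennreal (1 / Suc k)"
      using conv_tendsto_Lq[OF _ ints(4) fin1, of "1 / Suc k"] by auto
    obtain \<rho> :: "real^'n \<Rightarrow> real" where "mollifier (min \<delta> r) \<rho>" using exists_mollifier[of "min \<delta> r"] \<delta>(1) r(1) by auto
    then have "Q k (min \<delta> r) \<rho>" using \<delta>(2)[of "min \<delta> r" \<rho>] by (auto simp: Q_def)
    then show ?thesis by blast
  qed
  then obtain s \<rho> where "\<And>k. Q k (s k) (\<rho> k)" by metis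
  then have \<rho>: "mollifier (s k) (\<rho> k)" "s k \<le> r"
    "(\<integral>\<^sup>+x. pw 1 (conv (\<rho> k) H x - H x) \<partial>lborel) \<le> ennreal (1 / Suc k)" for k
    by (auto simp: Q_def)
  note ss = mollifier_smooth_supp[OF \<rho>(1)]
  have [measurable]: "conv (\<rho> k) H \<in> borel_measurable borel" "conv (\<rho> k) (G n) \<in> borel_measurable borel" for k n
    using continuous_on_conv[OF ss ints(4)] continuous_on_conv[OF ss ints(2)] borel_measurable_continuous_onI by blast+
  have step: "(\<integral>\<^sup>+x. indicator T x * pw q (conv (\<rho> k) H x) \<partial>lborel) \<le> ennreal (c / \<beta>)" for k
  proof (rule nn_integral_Fatou_le[where f = "\<lambda>n x. indicator T x * pw q (conv (\<rho> k) (G n) x)"])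
    show "AE x in lborel. (\<lambda>n. indicator T x * pw q (conv (\<rho> k) (G n) x)) \<longlonglongrightarrow> indicator T x * pw q (conv (\<rho> k) H x)"
    proof (rule AE_I2)
      fix x
      show "(\<lambda>n. indicator T x * pw q (conv (\<rho> k) (G n) x)) \<longlonglongrightarrow> indicator T x * pw q (conv (\<rho> k) H x)"
      proof (cases "x \<in> T")
        case True
        have "cball x (s k) \<subseteq> \<Omega>" using r(2)[OF True] \<rho>(2)[of k] by (meson order_trans subset_cball)
        then have "(\<lambda>n. conv (\<rho> k) (G n) x) \<longlonglongrightarrow> conv (\<rho> k) H x" by (rule conv_G_tendsto[OF ss])
        then have "(\<lambda>n. pw q (conv (\<rho> k) (G n) x)) \<longlonglongrightarrow> pw q (conv (\<rho> k) H x)"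
          using q1 by (intro tendsto_pw) auto
        then show ?thesis using True by simp
      qed simp
    qed
    fix n
    have "(\<integral>\<^sup>+x. indicator T x * pw q (conv (\<rho> k) (G n) x) \<partial>lborel) \<le> (\<integral>\<^sup>+x. pw q (conv (\<rho> k) (G n) x) \<partial>lborel)"
      by (intro nn_integral_mono) (auto simp: indicator_def)
    also have "\<dots> \<le> (\<integral>\<^sup>+x. pw q (G n x) \<partial>lborel)" by (rule conv_Lq_norm_le[OF q1 \<rho>(1) ints(2)])
    also have "\<dots> \<le> ennreal (c / \<beta>)" by (rule gradient_energy)
    finally show "(\<integral>\<^sup>+x. indicator T x * pw q (conv (\<rho> k) (G n) x) \<partial>lborel) \<le> ennreal (c / \<beta>)" .
  qed measurable
  have int_diff: "integrable lborel (\<lambda>x. conv (\<rho> k) H x - H x)" for k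
  proof (rule integrableI_bounded)
    have "(\<integral>\<^sup>+x. ennreal (norm (conv (\<rho> k) H x - H x)) \<partial>lborel) \<le> ennreal (1 / Suc k)"
      using \<rho>(3)[of k] by (simp add: pw_def)
    then show "(\<integral>\<^sup>+x. ennreal (norm (conv (\<rho> k) H x - H x)) \<partial>lborel) < \<infinity>" by (rule le_less_trans) simp
  qed measurable
  have "(LINT x|lborel. norm (conv (\<rho> k) H x - H x)) \<le> 1 / Suc k" for k
  proof -
    have "ennreal (LINT x|lborel. norm (conv (\<rho> k) H x - H x)) \<le> ennreal (1 / Suc k)"
      using \<rho>(3)[of k] int_diff[of k] by (simp add: pw_def nn_integral_eq_integral)
    then show ?thesis by (subst (asm) ennreal_le_iff) auto
  qed
  then have "(\<lambda>k. LINT x|lborel. norm (conv (\<rho> k) H x - H x)) \<longlonglongrightarrow> 0"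
    by (intro tendsto_sandwich[OF _ _ tendsto_const LIMSEQ_inverse_real_of_nat]) (auto simp: inverse_eq_divide)
  \<comment> \<open>Fatou's lemma needs pointwise convergence, which L^1 convergence provides along
    a subsequence.\<close>
  then have "\<exists>a::nat \<Rightarrow> nat. strict_mono a \<and> (AE x in lborel. (\<lambda>k. conv (\<rho> (a k)) H x - H x) \<longlonglongrightarrow> 0)"
    by (intro tendsto_L1_AE_subseq[where u = "\<lambda>k x. conv (\<rho> k) H x - H x"] int_diff)
  then obtain a where a: "strict_mono (a :: nat \<Rightarrow> nat)" "AE x in lborel. (\<lambda>k. conv (\<rho> (a k)) H x - H x) \<longlonglongrightarrow> 0"
    by blast
  show ?thesis
  proof (rule nn_integral_Fatou_le[where f = "\<lambda>k x. indicator T x * pw q (conv (\<rho> (a k)) H x)"])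
    show "AE x in lborel. (\<lambda>k. indicator T x * pw q (conv (\<rho> (a k)) H x)) \<longlonglongrightarrow> indicator T x * pw q (H x)"
      using a(2)
    proof eventually_elim
      case (elim x)
      then have "(\<lambda>k. conv (\<rho> (a k)) H x) \<longlonglongrightarrow> H x" by (simp add: LIM_zero_iff)
      then have "(\<lambda>k. pw q (conv (\<rho> (a k)) H x)) \<longlonglongrightarrow> pw q (H x)"
        using q1 by (intro tendsto_pw) auto
      then show ?case by (cases "x \<in> T") auto
    qed
  qed (use step in auto)
qed

text \<open>The scale of mollification depends on n. On \<open>T\<close> the gradient of the
  mollification is the mollified \<open>G n\<close>, which is close to \<open>G n\<close> in L^q, so
  \<open>superposition_approx\<close> bounds its energy.\<close>

lemma smooth_approximant:
  assumes T: "compact T" and r: "0 < r" "\<And>x. x \<in> T \<Longrightarrow> cball x r \<subseteq> \<Omega>" and e: "0 < e"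
  shows "\<exists>w. smooth_map w \<and> integrable lborel w \<and> (LINT x|lborel. norm (w x - u n x)) \<le> e \<and>
    (\<integral>\<^sup>+x. indicator T x * L (jac w x) \<partial>lborel) \<le> ennreal (c + e)"
proof -
  have [measurable]: "T \<in> sets borel" using T by (rule borel_compact)
  have finq: "(\<integral>\<^sup>+x. pw q (G n x) \<partial>lborel) < \<infinity>" using gradient_energy[of n] by (rule le_less_trans) simp
  have fin1: "(\<integral>\<^sup>+x. pw 1 (u n x) \<partial>lborel) < \<infinity>" using ints(1)[of n] by (simp add: pw_def integrable_iff_bounded)
  have finT: "emeasure lborel T < \<infinity>" by (rule emeasure_bounded_finite[OF compact_imp_bounded[OF T]])
  obtain \<delta> where \<delta>: "\<delta> > 0" "\<And>F'. F' \<in> borel_measurable borel \<Longrightarrow> (\<integral>\<^sup>+x. pw q (F' x - G n x) \<partial>lborel) \<le> ennreal \<delta> \<Longrightarrow>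
     (\<integral>\<^sup>+x. indicator T x * L (F' x) \<partial>lborel) \<le> (\<integral>\<^sup>+x. indicator T x * L (G n x) \<partial>lborel) + ennreal e"
    using superposition_approx[OF cont growth \<alpha>0 q1 _ _ finq finT e] by auto
  obtain d1 where d1: "d1 > 0" "\<And>s \<rho>. mollifier s \<rho> \<Longrightarrow> s \<le> d1 \<Longrightarrow> (\<integral>\<^sup>+x. pw q (conv \<rho> (G n) x - G n x) \<partial>lborel) \<le> ennreal \<delta>"
    using conv_tendsto_Lq[OF q1 ints(2) finq \<delta>(1)] by auto
  obtain d2 where d2: "d2 > 0" "\<And>s \<rho>. mollifier s \<rho> \<Longrightarrow> s \<le> d2 \<Longrightarrow> (\<integral>\<^sup>+x. pw 1 (conv \<rho> (u n) x - u n x) \<partial>lborel) \<le> ennreal e"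
    using conv_tendsto_Lq[OF _ ints(1) fin1 e] by auto
  define s where "s = min r (min d1 d2)"
  obtain \<rho> :: "real^'n \<Rightarrow> real" where \<rho>: "mollifier s \<rho>"
    using exists_mollifier[of s] r(1) d1(1) d2(1) by (auto simp: s_def)
  note ss = mollifier_smooth_supp[OF \<rho>]
  define w where "w = conv \<rho> (u n)"
  have w: "smooth_map w" unfolding w_def by (rule smooth_map_conv[OF ss ints(1)])
  have [measurable]: "w \<in> borel_measurable borel" "conv \<rho> (G n) \<in> borel_measurable borel"
    using continuous_on_smooth_map[OF w] continuous_on_conv[OF ss ints(2)] borel_measurable_continuous_onI by blast+
  have close: "(\<integral>\<^sup>+x. ennreal (norm (w x - u n x)) \<partial>lborel) \<le> ennreal e"
    using d2(2)[OF \<rho>] by (simp add: s_def pw_def w_def)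
  \<comment> \<open>Integrability of the mollification is read off from its finite L^1 distance to
    \<open>u n\<close>.\<close>
  have id: "integrable lborel (\<lambda>x. w x - u n x)"
    by (rule integrableI_bounded) (use close in \<open>auto intro: le_less_trans\<close>)
  have "integrable lborel (\<lambda>x. (w x - u n x) + u n x)" using id ints(1) by (intro Bochner_Integration.integrable_add)
  then have iw: "integrable lborel w" by simp
  have "(LINT x|lborel. norm (w x - u n x)) \<le> e"
    using close id e by (simp add: nn_integral_eq_integral)
  moreover have "(\<integral>\<^sup>+x. indicator T x * L (jac w x) \<partial>lborel) = (\<integral>\<^sup>+x. indicator T x * L (conv \<rho> (G n) x) \<partial>lborel)"
  proof (rule nn_integral_cong)
    fix x
    have "jac w x = conv \<rho> (G n) x" if "x \<in> T"
    proof -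
      have "cball x s \<subseteq> \<Omega>"
        by (rule order_trans[OF subset_cball r(2)[OF that]]) (simp add: s_def)
      then show ?thesis unfolding w_def by (rule jac_conv[OF ss wgrad_u])
    qed
    then show "indicator T x * L (jac w x) = indicator T x * L (conv \<rho> (G n) x)" by (cases "x \<in> T") auto
  qed
  moreover have "(\<integral>\<^sup>+x. indicator T x * L (conv \<rho> (G n) x) \<partial>lborel) \<le> ennreal (c + e)"
  proof -
    have "(\<integral>\<^sup>+x. indicator T x * L (conv \<rho> (G n) x) \<partial>lborel) \<le> (\<integral>\<^sup>+x. indicator T x * L (G n x) \<partial>lborel) + ennreal e"
      using d1(2)[OF \<rho>] by (intro \<delta>(2)) (auto simp: s_def)
    also have "(\<integral>\<^sup>+x. indicator T x * L (G n x) \<partial>lborel) \<le> (\<integral>\<^sup>+x. indicator \<Omega> x * L (G n x) \<partial>lborel)"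
    proof (rule nn_integral_mono)
      fix x
      have "x \<in> \<Omega>" if "x \<in> T" using r(2)[OF that] r(1) by auto
      then show "indicator T x * L (G n x) \<le> indicator \<Omega> x * L (G n x)" by (auto simp: indicator_def)
    qed
    also have "\<dots> \<le> ennreal c" by (rule energy)
    finally show ?thesis using c0 e by (simp add: add_mono)
  qed
  ultimately show ?thesis using w iw by (intro exI[of _ w]) auto
qed

text \<open>The mollified functions converge pointwise and are equi-Lipschitz, since their gradients are
  mollifications of an \<open>L\<^sup>1\<close>-bounded sequence.\<close>

lemma conv_uniform_limit:
  assumes K: "compact K" and r: "0 < r" and sub: "\<And>x. x \<in> K \<Longrightarrow> cball x (2 * r) \<subseteq> \<Omega>"
    and \<rho>: "smooth_supp r \<rho>" and e: "0 < e"
  shows "\<forall>\<^sub>F n in sequentially. \<forall>x\<in>K. norm (conv \<rho> (u n) x - conv \<rho> v x) < e"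
proof -
  obtain B where B: "B \<ge> 0" "\<And>x. \<bar>\<rho> x\<bar> \<le> B" using smooth_supp_bounded[OF \<rho>] by auto
  define \<Lambda> where "\<Lambda> = B * (measure lborel \<Omega> + c / \<beta>) + B * (LINT y|lborel. norm (H y))"
  have \<Lambda>: "\<Lambda> \<ge> 0" using B(1) c0 \<beta>0 by (simp add: \<Lambda>_def)
  define f where "f n x = conv \<rho> (u n) x - conv \<rho> v x" for n x
  \<comment> \<open>The mean value inequality runs over \<open>cball x r\<close>, and the gradient
    formula at each of its points needs a further r of room; this is the origin of the radius
    \<open>2 * r\<close>.\<close>
  have inner: "cball z r \<subseteq> \<Omega>" if "x \<in> K" "z \<in> cball x r" for x z
  proof
    fix y assume "y \<in> cball z r"
    then have "dist x y \<le> 2 * r" using that(2) dist_triangle[of x y z] by simp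
    then show "y \<in> \<Omega>" using sub[OF that(1)] by auto
  qed
  have "\<forall>\<^sub>F n in sequentially. \<forall>x\<in>K. norm (f n x) < e"
  proof (rule equi_Lipschitz_uniform_limit[OF K _ r \<Lambda> _ e])
    show "(\<lambda>n. f n x) \<longlonglongrightarrow> 0" if "x \<in> K" for x
    proof -
      have "cball x r \<subseteq> \<Omega>" using inner[OF that, of x] r by simp
      then show ?thesis unfolding f_def using conv_u_tendsto[OF \<rho>] by (simp add: LIM_zero)
    qed
    show "norm (f n x - f n y) \<le> \<Lambda> * dist x y" if xy: "x \<in> K" "y \<in> K" "dist x y \<le> r" for n x y
    proof -
      have "norm (f n x - f n y) \<le> \<Lambda> * norm (x - y)"
      proof (rule differentiable_bound[of "cball x r" "f n" "\<lambda>z h. (jac (conv \<rho> (u n)) z - jac (conv \<rho> v) z) *v h"])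
        fix z assume z: "z \<in> cball x r"
        show "(f n has_derivative (\<lambda>h. (jac (conv \<rho> (u n)) z - jac (conv \<rho> v) z) *v h)) (at z within cball x r)"
          unfolding f_def matrix_vector_mult_diff_rdistrib
          by (rule has_derivative_at_withinI, rule has_derivative_diff)
            (rule smooth_map_has_derivative[OF smooth_map_conv[OF \<rho>]], rule ints)+
        have zO: "cball z r \<subseteq> \<Omega>" by (rule inner[OF xy(1) z])
        have "norm (jac (conv \<rho> (u n)) z - jac (conv \<rho> v) z) \<le> norm (conv \<rho> (G n) z) + norm (conv \<rho> H z)"
          unfolding jac_conv[OF \<rho> wgrad_u zO] jac_conv[OF \<rho> wgrad_v zO] by (rule norm_triangle_ineq4)
        also have "\<dots> \<le> B * (LINT y|lborel. norm (G n y)) + B * (LINT y|lborel. norm (H y))"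
          by (intro add_mono conv_norm_le[OF \<rho>] ints B)
        also have "\<dots> \<le> \<Lambda>"
          unfolding \<Lambda>_def using gradient_L1[of n] B(1) by (intro add_mono mult_left_mono) auto
        finally have *: "norm (jac (conv \<rho> (u n)) z - jac (conv \<rho> v) z) \<le> \<Lambda>" .
        show "onorm (\<lambda>h. (jac (conv \<rho> (u n)) z - jac (conv \<rho> v) z) *v h) \<le> \<Lambda>"
        proof (rule onorm_bound[OF \<Lambda>])
          fix h
          show "norm ((jac (conv \<rho> (u n)) z - jac (conv \<rho> v) z) *v h) \<le> \<Lambda> * norm h"
            using norm_matrix_vector_mult_le mult_right_mono[OF * norm_ge_zero[of h]] order_trans by blast
        qed
      qed (use xy r in auto)
      then show ?thesis by (simp add: dist_norm)
    qed
  qed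
  then show ?thesis by (simp add: f_def)
qed

text \<open>The triangle inequality passes through \<open>conv \<rho> (w n)\<close> and
  \<open>conv \<rho> (u n)\<close>. The first distance is controlled by \<eta> times the gradient
  and is small in \<eta> only; the second is small because the kernel is bounded and
  \<open>close\<close> holds in L^1; the third tends to 0 uniformly on \<open>K\<close>.\<close>

lemma mollified_close:
  assumes K: "compact K" and \<eta>: "0 < \<eta>" and sub: "\<And>x. x \<in> K \<Longrightarrow> cball x (2 * \<eta>) \<subseteq> \<Omega>"
    and \<rho>: "mollifier \<eta> \<rho>"
    and w: "\<And>n. smooth_map (w n)" "\<And>n. integrable lborel (w n)"
    and close: "\<And>n. (LINT x|lborel. norm (w n x - u n x)) \<le> 1 / Suc n"
    and grad_w: "\<And>n. (\<integral>\<^sup>+x. indicator (nbhd K \<eta>) x * pw q (jac (w n) x) \<partial>lborel) \<le> ennreal M" and M: "0 \<le> M"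
    and \<epsilon>: "0 < \<epsilon>"
  shows "\<forall>\<^sub>F n in sequentially. (\<integral>\<^sup>+x. indicator K x * pw q (w n x - conv \<rho> v x) \<partial>lborel) \<le>
     ennreal (2 powr q * (\<eta> powr q * M) + \<epsilon>)"
proof -
  have s: "smooth_supp \<eta> \<rho>" by (rule mollifier_smooth_supp[OF \<rho>])
  have [measurable]: "K \<in> sets borel" "nbhd K \<eta> \<in> sets borel" using K by (auto intro: borel_compact nbhd_borel)
  have [measurable]: "w n \<in> borel_measurable borel" "jac (w n) \<in> borel_measurable borel" "conv \<rho> (w n) \<in> borel_measurable borel"
    "conv \<rho> v \<in> borel_measurable borel" for n
    using continuous_on_smooth_map[OF w(1)] continuous_on_jac[OF w(1)] continuous_on_conv[OF s w(2)] continuous_on_conv[OF s ints(3)]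
      borel_measurable_continuous_onI by blast+
  obtain B where B: "B \<ge> 0" "\<And>x. \<bar>\<rho> x\<bar> \<le> B" using smooth_supp_bounded[OF s] by auto
  define \<kappa> where "\<kappa> = measure lborel K"
  have \<kappa>: "emeasure lborel K = ennreal \<kappa>" "\<kappa> \<ge> 0"
    using emeasure_bounded_finite[OF compact_imp_bounded[OF K]] by (auto simp: \<kappa>_def emeasure_eq_ennreal_measure)
  \<comment> \<open>The sup-norm tolerance for which 2^q t^q times the measure of \<open>K\<close>
    is at most \<epsilon>.\<close>
  define t where "t = (\<epsilon> / (2 powr q * (\<kappa> + 1))) powr (1 / q)"
  have t: "t > 0" using \<epsilon> \<kappa>(2) by (simp add: t_def)
  have tq: "t powr q = \<epsilon> / (2 powr q * (\<kappa> + 1))" using q1 \<epsilon> \<kappa>(2) by (simp add: t_def powr_powr)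
  have first: "(\<integral>\<^sup>+x. indicator K x * pw q (conv \<rho> (w n) x - w n x) \<partial>lborel) \<le> ennreal (\<eta> powr q * M)" for n
  proof -
    have "(\<integral>\<^sup>+x. indicator K x * pw q (w n (x + 0 - z) - w n x) \<partial>lborel) \<le> ennreal (\<eta> powr q * M)" if z: "norm z < \<eta>" for z
    proof -
      have "(\<integral>\<^sup>+x. indicator K x * pw q (w n (x + - z) - w n x - (\<lambda>_. 0) x *v - z) \<partial>lborel) \<le> ennreal (norm (- z) powr q) * ennreal M"
      proof (rule integral_FTC_pw[OF w(1) q1])
        fix r :: real assume r: "0 \<le> r" "r \<le> 1"
        have "r * norm z \<le> 1 * \<eta>" using r z by (intro mult_mono) auto
        then have "norm (r *\<^sub>R - z) \<le> \<eta>" using r by simp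
        then have "(\<integral>\<^sup>+x. indicator K x * pw q (jac (w n) (x + r *\<^sub>R - z) - 0) \<partial>lborel)
          \<le> (\<integral>\<^sup>+x. indicator (nbhd K \<eta>) (x + r *\<^sub>R - z) * pw q (jac (w n) (x + r *\<^sub>R - z)) \<partial>lborel)"
          using nbhdI[of _ K "r *\<^sub>R - z" \<eta>] by (intro nn_integral_mono) (auto simp: indicator_def)
        also have "\<dots> = (\<integral>\<^sup>+x. indicator (nbhd K \<eta>) x * pw q (jac (w n) x) \<partial>lborel)"
          by (rule nn_integral_lborel_shift) measurable
        also have "\<dots> \<le> ennreal M" by (rule grad_w)
        finally show "(\<integral>\<^sup>+x. indicator K x * pw q (jac (w n) (x + r *\<^sub>R - z) - 0) \<partial>lborel) \<le> ennreal M" .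
      qed measurable
      also have "\<dots> = ennreal (norm z powr q * M)" using M by (simp add: ennreal_mult)
      also have "\<dots> \<le> ennreal (\<eta> powr q * M)"
        using z q1 M by (intro ennreal_leI mult_right_mono powr_mono2) auto
      finally show ?thesis by simp
    qed
    from conv_Lq_le[OF q1 \<rho> w(2) _ _ this] show ?thesis by simp
  qed
  have "(\<lambda>n. B * (1 / Suc n)) \<longlonglongrightarrow> B * 0"
    using LIMSEQ_inverse_real_of_nat by (intro tendsto_mult_left) (simp add: inverse_eq_divide)
  then have "\<forall>\<^sub>F n in sequentially. B * (1 / Suc n) < t / 2"
    using t by (intro order_tendstoD(2)) auto
  moreover have "\<forall>\<^sub>F n in sequentially. \<forall>x\<in>K. norm (conv \<rho> (u n) x - conv \<rho> v x) < t / 2"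
    using t by (intro conv_uniform_limit[OF K \<eta> sub s]) auto
  ultimately show ?thesis
  proof eventually_elim
    case (elim n)
    have sup: "norm (conv \<rho> (w n) x - conv \<rho> v x) \<le> t" if "x \<in> K" for x
    proof -
      have "norm (conv \<rho> (w n) x - conv \<rho> (u n) x) = norm (conv \<rho> (\<lambda>x. w n x - u n x) x)"
        by (simp add: conv_diff[OF s w(2) ints(1)])
      also have "\<dots> \<le> B * (LINT x|lborel. norm (w n x - u n x))"
        by (rule conv_norm_le[OF s _ B(2)]) (intro Bochner_Integration.integrable_diff w(2) ints(1))
      also have "\<dots> \<le> B * (1 / Suc n)" using close[of n] B(1) by (rule mult_left_mono)
      also have "\<dots> < t / 2" using elim(1) .
      finally have "norm (conv \<rho> (w n) x - conv \<rho> (u n) x) < t / 2" .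
      moreover have "norm (conv \<rho> (u n) x - conv \<rho> v x) < t / 2" using elim(2) that by blast
      ultimately show ?thesis
        using norm_triangle_ineq[of "conv \<rho> (w n) x - conv \<rho> (u n) x" "conv \<rho> (u n) x - conv \<rho> v x"] by simp
    qed
    have "(\<integral>\<^sup>+x. indicator K x * pw q (w n x - conv \<rho> v x) \<partial>lborel)
      \<le> (\<integral>\<^sup>+x. ennreal (2 powr q) * (indicator K x * pw q (conv \<rho> (w n) x - w n x) + ennreal (t powr q) * indicator K x) \<partial>lborel)"
    proof (rule nn_integral_mono)
      fix x
      have "pw q (w n x - conv \<rho> v x) \<le> ennreal (2 powr q) * (pw q (conv \<rho> (w n) x - w n x) + ennreal (t powr q))" if "x \<in> K"
      proof -
        have "pw q (conv \<rho> (w n) x - conv \<rho> v x) \<le> ennreal (t powr q)"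
          unfolding pw_def using sup[OF that] q1 by (intro ennreal_leI powr_mono2) auto
        then have "ennreal (2 powr q) * (pw q (w n x - conv \<rho> (w n) x) + pw q (conv \<rho> (w n) x - conv \<rho> v x))
            \<le> ennreal (2 powr q) * (pw q (conv \<rho> (w n) x - w n x) + ennreal (t powr q))"
          by (intro mult_left_mono add_mono) (simp_all add: pw_commute)
        then show ?thesis
          using pw_add[of q "w n x - conv \<rho> (w n) x" "conv \<rho> (w n) x - conv \<rho> v x"] q1 by simp
      qed
      then show "indicator K x * pw q (w n x - conv \<rho> v x)
         \<le> ennreal (2 powr q) * (indicator K x * pw q (conv \<rho> (w n) x - w n x) + ennreal (t powr q) * indicator K x)"
        by (cases "x \<in> K") auto
    qed
    also have "\<dots> = ennreal (2 powr q) * ((\<integral>\<^sup>+x. indicator K x * pw q (conv \<rho> (w n) x - w n x) \<partial>lborel) + ennreal (t powr q) * emeasure lborel K)"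
      by (simp add: nn_integral_cmult nn_integral_add nn_integral_cmult_indicator)
    also have "\<dots> \<le> ennreal (2 powr q) * (ennreal (\<eta> powr q * M) + ennreal (t powr q) * ennreal \<kappa>)"
      using first[of n] \<kappa>(1) by (intro mult_left_mono add_mono) auto
    also have "\<dots> = ennreal (2 powr q * (\<eta> powr q * M + t powr q * \<kappa>))"
      using M \<kappa>(2) by (simp flip: ennreal_plus ennreal_mult)
    also have "\<dots> \<le> ennreal (2 powr q * (\<eta> powr q * M) + \<epsilon>)"
    proof (rule ennreal_leI)
      have "2 powr q * (t powr q * \<kappa>) \<le> 2 powr q * (t powr q * (\<kappa> + 1))" by (intro mult_left_mono) auto
      also have "\<dots> = \<epsilon>" unfolding tq using \<kappa>(2) by (simp add: divide_simps)
      finally show "2 powr q * (\<eta> powr q * M + t powr q * \<kappa>) \<le> 2 powr q * (\<eta> powr q * M) + \<epsilon>"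
        by (simp add: distrib_left)
    qed
    finally show ?case .
  qed
qed

text \<open>The terms of \<open>localized_estimate\<close> are made small in turn. Each tolerance is
  \<open>e\<close> divided by the coefficient that will multiply it, enlarged by 1 so that a zero
  coefficient does no harm.\<close>

lemma energy_on_compact:
  assumes K: "compact K" "K \<subseteq> \<Omega>"
  shows "(\<integral>\<^sup>+x. indicator K x * L (H x) \<partial>lborel) \<le> ennreal c"
proof (rule ennreal_le_epsilon)
  fix e0 :: real assume "0 < e0"
  \<comment> \<open>Each of the four error terms below is at most \<open>e\<close>.\<close>
  define e where "e = e0 / 4"
  have e: "e > 0" using \<open>0 < e0\<close> by (simp add: e_def)
  define N where "N = real CARD('n)"
  have N: "N \<ge> 1" by (simp add: N_def)
  obtain r0 where r0: "0 < r0" "\<And>x. x \<in> K \<Longrightarrow> cball x r0 \<subseteq> \<Omega>"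
    using compact_neighbourhood[OF K(1) open_\<Omega> K(2)] by metis
  \<comment> \<open>A quarter of the room, because \<open>H\<close> is used on
    \<open>nbhd K (3 * r)\<close> with a further ball of radius r around its points.\<close>
  define r where "r = r0 / 4"
  have r: "r > 0" using r0(1) by (simp add: r_def)
  have inner: "cball x b \<subseteq> \<Omega>" if x: "x \<in> nbhd K a" and ab: "a + b \<le> 4 * r" for x a b
  proof
    fix y assume y: "y \<in> cball x b"
    obtain k z where k: "x = k + z" "k \<in> K" "norm z \<le> a" using x by (auto simp: nbhd_def)
    have "dist k y \<le> dist k x + dist x y" by (rule dist_triangle)
    also have "\<dots> \<le> 4 * r" using k y ab by (simp add: dist_norm)
    finally show "y \<in> \<Omega>" using r0(2)[OF k(2)] by (auto simp: r_def)
  qed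
  have KK: "compact (nbhd K a)" for a by (rule compact_nbhd[OF K(1)])
  note [measurable] = nbhd_borel[OF K(1)] borel_compact[OF K(1)]
  \<comment> \<open>By coercivity, an L^q bound for the gradients of approximants whose energy is at
    most c + 1.\<close>
  define M where "M = (c + 1) / \<beta>"
  have M: "M \<ge> 0" using c0 \<beta>0 by (simp add: M_def)
  define a0 where "a0 = \<alpha> * (2 powr q * 2 powr q)"
  have a0: "a0 \<ge> 0" using \<alpha>0 by (simp add: a0_def)
  define X where "X = measure lborel K + c / \<beta>"
  have X: "X \<ge> 0" using c0 \<beta>0 by (simp add: X_def)
  have KX: "(\<integral>\<^sup>+x. indicator K x * (1 + pw q (H x)) \<partial>lborel) \<le> ennreal X"
  proof -
    have "(\<integral>\<^sup>+x. indicator K x * (1 + pw q (H x)) \<partial>lborel) = emeasure lborel K + (\<integral>\<^sup>+x. indicator K x * pw q (H x) \<partial>lborel)"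
      by (simp add: distrib_left nn_integral_add)
    also have "\<dots> \<le> ennreal (measure lborel K) + ennreal (c / \<beta>)"
      using emeasure_bounded_finite[OF compact_imp_bounded[OF K(1)]] limit_gradient_Lq[OF _ r0]
      by (intro add_mono) (auto simp: emeasure_eq_ennreal_measure)
    also have "\<dots> = ennreal X" using c0 \<beta>0 by (simp add: X_def)
    finally show ?thesis .
  qed
  \<comment> \<open>\<open>X + M\<close> bounds the integrals that the measure of the layer
    multiplies.\<close>
  define \<epsilon>S where "\<epsilon>S = e / (a0 * (X + M) + 1)"
  have aXM: "a0 * (X + M) \<ge> 0" using a0 X M by simp
  have \<epsilon>S: "\<epsilon>S > 0" using e aXM by (simp add: \<epsilon>S_def add_nonneg_pos)
  obtain S C where S[measurable]: "S \<in> sets borel" and Ssub: "S \<subseteq> unit_cube" and Ssmall: "emeasure lborel S \<le> ennreal \<epsilon>S"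
    and C: "0 \<le> C" and UC0: "\<forall>\<xi> w. smooth_map w \<longrightarrow> L \<xi> \<le> (\<integral>\<^sup>+y. indicator unit_cube y * L (jac w y) \<partial>lborel) +
        ennreal a0 * (\<integral>\<^sup>+y. indicator S y * (1 + pw q \<xi> + pw q (jac w y)) \<partial>lborel) +
        ennreal C * (\<integral>\<^sup>+y. indicator unit_cube y * pw q (w y - \<xi> *v y) \<partial>lborel)"
    using unit_cube_inequality[OF quasiconvex q1 \<alpha>0 growth cont \<epsilon>S, folded a0_def]
    by (elim exE conjE) (rule that)
  note UC = UC0[rule_format]
  \<comment> \<open>\<open>H\<close> has an L^q bound only on sets with room inside \<Omega>. The
    cut puts it into L^q of the whole space, where translations are continuous.\<close>
  define H' where "H' x = indicator (nbhd K (3 * r)) x *\<^sub>R H x" for x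
  have H'int: "integrable lborel H'"
    unfolding H'_def using ints(4) by (intro integrable_mult_indicator) auto
  have [measurable]: "H' \<in> borel_measurable borel" using H'int by auto
  have H'q: "(\<integral>\<^sup>+x. pw q (H' x) \<partial>lborel) < \<infinity>"
  proof -
    have "pw q (H' x) = indicator (nbhd K (3 * r)) x * pw q (H x)" for x
      by (auto simp: H'_def indicator_def)
    then have "(\<integral>\<^sup>+x. pw q (H' x) \<partial>lborel) \<le> ennreal (c / \<beta>)"
      using limit_gradient_Lq[of "nbhd K (3 * r)" r] inner[of _ "3 * r" r] r by simp
    then show ?thesis by (rule le_less_trans) simp
  qed
  \<comment> \<open>The coefficient of \<open>E\<close> in the localized estimate; it depends on the
    layer through \<open>C\<close> but not on \<open>h\<close>.\<close>
  define D where "D = C * (2 powr q * N powr q)"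
  have D: "D \<ge> 0" using C by (simp add: D_def)
  define E where "E = e / (D + 1)"
  have E: "E > 0" using e D by (simp add: E_def)
  obtain \<delta> where \<delta>: "\<delta> > 0" "\<And>z. norm z < \<delta> \<Longrightarrow> (\<integral>\<^sup>+x. pw q (H' (x + z) - H' x) \<partial>lborel) \<le> ennreal E"
    using translation_continuous_Lq[OF q1 H'int H'q E] by (elim exE conjE) (rule that, auto)
  define m where "m = min \<delta> r"
  have m: "m > 0" "m \<le> \<delta>" "m \<le> r" using \<delta>(1) r by (auto simp: m_def)
  \<comment> \<open>The scaled cube moves x by at most h N = m / 2, and the mollifier adds less than
    \<eta> <= m / 2, so the total shift stays below \<delta>.\<close>
  define h where "h = m / (2 * N)"
  have h: "h > 0" "h * N = m / 2" using m N by (auto simp: h_def)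
  \<comment> \<open>The coefficient of the distance between \<open>w n\<close> and \<open>U\<close>.
    It is known only after \<open>h\<close>, so the mollification scale must be chosen after
    \<open>h\<close>.\<close>
  define D2 where "D2 = C * (2 powr q * (1 / h) powr q)"
  have D2: "D2 \<ge> 0" using C by (simp add: D2_def)
  define e2 where "e2 = e / (D2 + 1)"
  have e2: "e2 > 0" using e D2 by (simp add: e2_def)
  \<comment> \<open>For \<eta> <= t the first-order error 2^q \<eta>^q M is at most e2 / 2; the
    other half is left to the limit in n.\<close>
  define t where "t = (e2 / (2 * 2 powr q * (M + 1))) powr (1 / q)"
  have t: "t > 0" using e2 M by (simp add: t_def)
  have tq: "t powr q = e2 / (2 * 2 powr q * (M + 1))" using q1 e2 M by (simp add: t_def powr_powr)
  define \<eta> where "\<eta> = min (m / 2) t"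
  have \<eta>: "\<eta> > 0" "\<eta> \<le> m / 2" "\<eta> \<le> t" using m t by (auto simp: \<eta>_def)
  obtain \<rho> :: "real^'n \<Rightarrow> real" where \<rho>: "mollifier \<eta> \<rho>" using exists_mollifier[OF \<eta>(1)] by blast
  have s: "smooth_supp \<eta> \<rho>" by (rule mollifier_smooth_supp[OF \<rho>])
  define U where "U = conv \<rho> v"
  have U: "smooth_map U" unfolding U_def by (rule smooth_map_conv[OF s ints(3)])
  \<comment> \<open>Control on \<open>nbhd K (2 * r)\<close> is needed because the cube moves points
    of \<open>K\<close> by up to r and the mollifier by a further \<eta>.\<close>
  define Q where "Q n w \<longleftrightarrow> smooth_map w \<and> integrable lborel w \<and> (LINT x|lborel. norm (w x - u n x)) \<le> 1 / Suc n \<and>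
    (\<integral>\<^sup>+x. indicator (nbhd K (2 * r)) x * L (jac w x) \<partial>lborel) \<le> ennreal (c + 1 / Suc n)" for n w
  have "\<exists>w. Q n w" for n
    unfolding Q_def
    by (rule smooth_approximant[OF KK r]) (use inner[of _ "2 * r" r] r in auto)
  then obtain w where "\<And>n. Q n (w n)" by metis
  then have w: "\<And>n. smooth_map (w n)" "\<And>n. integrable lborel (w n)" "\<And>n. (LINT x|lborel. norm (w n x - u n x)) \<le> 1 / Suc n"
    "\<And>n. (\<integral>\<^sup>+x. indicator (nbhd K (2 * r)) x * L (jac (w n) x) \<partial>lborel) \<le> ennreal (c + 1 / Suc n)"
    by (auto simp: Q_def)
  have [measurable]: "jac (w n) \<in> borel_measurable borel" for n
    by (rule borel_measurable_continuous_onI[OF continuous_on_jac[OF w(1)]])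
  have gradw: "(\<integral>\<^sup>+x. indicator T x * pw q (jac (w n) x) \<partial>lborel) \<le> ennreal M" if "T \<subseteq> nbhd K (2 * r)" for T n
  proof -
    have "(\<integral>\<^sup>+x. indicator T x * pw q (jac (w n) x) \<partial>lborel) \<le> (\<integral>\<^sup>+x. indicator (nbhd K (2 * r)) x * pw q (jac (w n) x) \<partial>lborel)"
      using that by (intro nn_integral_mono) (auto simp: indicator_def)
    also have "\<dots> \<le> ennreal M"
      unfolding M_def
    proof (rule coercive_integral)
      have "ennreal (c + 1 / Suc n) \<le> ennreal (c + 1)" by (intro ennreal_leI) simp
      then show "(\<integral>\<^sup>+x. indicator (nbhd K (2 * r)) x * L (jac (w n) x) \<partial>lborel) \<le> ennreal (c + 1)"
        using w(4)[of n] by (rule order_trans[rotated])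
    qed (use c0 in auto)
    finally show ?thesis .
  qed
  have nn: "nbhd (nbhd K r) \<eta> \<subseteq> nbhd K (2 * r)"
  proof
    fix x assume "x \<in> nbhd (nbhd K r) \<eta>"
    then obtain k z where "x = k + z" "k \<in> nbhd K r" "norm z \<le> \<eta>" by (auto simp: nbhd_def[of "nbhd K r"])
    then have "x \<in> nbhd K (r + \<eta>)" using nbhd_nbhd by blast
    then show "x \<in> nbhd K (2 * r)" using nbhd_mono[of "r + \<eta>" "2 * r" K] \<eta>(2) m by auto
  qed
  have "\<forall>\<^sub>F n in sequentially. (\<integral>\<^sup>+x. indicator (nbhd K r) x * pw q (w n x - conv \<rho> v x) \<partial>lborel) \<le>
     ennreal (2 powr q * (\<eta> powr q * M) + e2 / 2)"
    using e2 by (intro mollified_close[OF KK \<eta>(1) _ \<rho> w(1,2,3) gradw[OF nn] M])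
       (use inner[of _ r "2 * \<eta>"] \<eta>(2) m(3) r in auto)
  moreover have "\<forall>\<^sub>F n in sequentially. 1 / real (Suc n) < e"
  proof -
    have "(\<lambda>n. 1 / real (Suc n)) \<longlonglongrightarrow> 0"
      using LIMSEQ_inverse_real_of_nat by (simp add: inverse_eq_divide)
    then show ?thesis using e by (intro order_tendstoD(2)) auto
  qed
  ultimately have "\<forall>\<^sub>F n in sequentially. (\<integral>\<^sup>+x. indicator (nbhd K r) x * pw q (w n x - conv \<rho> v x) \<partial>lborel) \<le>
     ennreal (2 powr q * (\<eta> powr q * M) + e2 / 2) \<and> 1 / real (Suc n) < e" by (rule eventually_conj)
  then obtain n where n: "(\<integral>\<^sup>+x. indicator (nbhd K r) x * pw q (w n x - conv \<rho> v x) \<partial>lborel) \<le>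
     ennreal (2 powr q * (\<eta> powr q * M) + e2 / 2)" "1 / real (Suc n) < e"
    by (auto simp: eventually_sequentially)
  have T1: "(\<integral>\<^sup>+x. indicator (nbhd K r) x * pw q (w n x - U x) \<partial>lborel) \<le> ennreal e2"
  proof -
    have "2 powr q * (\<eta> powr q * M) \<le> 2 powr q * (t powr q * (M + 1))"
      using \<eta> q1 M by (intro mult_left_mono mult_mono powr_mono2) auto
    also have "\<dots> = e2 / 2" unfolding tq using M by (simp add: divide_simps)
    finally have "ennreal (2 powr q * (\<eta> powr q * M) + e2 / 2) \<le> ennreal e2" by (intro ennreal_leI) simp
    with n(1) show ?thesis unfolding U_def by (rule order_trans)
  qed
  have T2: "(\<integral>\<^sup>+x. indicator K x * pw q (jac U (x + z) - H x) \<partial>lborel) \<le> ennreal E" if z: "norm z \<le> h * N" for z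
  proof -
    have "(\<integral>\<^sup>+x. indicator K x * pw q (jac U (x + z) - H x) \<partial>lborel) = (\<integral>\<^sup>+x. indicator K x * pw q (conv \<rho> H' (x + z) - H' x) \<partial>lborel)"
    proof (rule nn_integral_cong)
      fix x
      \<comment> \<open>The kernel centred at x + z reaches only points of
        \<open>nbhd K (3 * r)\<close>, so there it does not distinguish \<open>H\<close> from
        \<open>H'\<close>.\<close>
      have "jac U (x + z) = conv \<rho> H' (x + z)" "H x = H' x" if x: "x \<in> K"
      proof -
        have xz: "x + z \<in> nbhd K r" using z h(2) m by (intro nbhdI[OF x]) auto
        have "cball (x + z) \<eta> \<subseteq> \<Omega>" using inner[OF xz, of \<eta>] \<eta>(2) m(3) r by simp
        then have "jac U (x + z) = conv \<rho> H (x + z)" unfolding U_def by (rule jac_conv[OF s wgrad_v])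
        also have "\<dots> = conv \<rho> H' (x + z)"
          unfolding conv_def
        proof (rule Bochner_Integration.integral_cong[OF refl])
          fix y
          have "y \<in> nbhd K (3 * r)" if "\<rho> (x + z - y) \<noteq> 0"
          proof -
            have "norm (x + z - y) \<le> \<eta>" by (rule smooth_suppD(4)[OF s that])
            then have "norm (y - x) \<le> norm z + \<eta>"
              using norm_triangle_ineq4[of z "x + z - y"] by simp
            then have "norm (y - x) \<le> 3 * r" using z h(2) \<eta>(2) m(3) r by linarith
            from nbhdI[OF x this] show ?thesis by simp
          qed
          then show "\<rho> (x + z - y) *\<^sub>R H y = \<rho> (x + z - y) *\<^sub>R H' y"
            by (cases "\<rho> (x + z - y) = 0") (auto simp: H'_def)
        qed
        finally show "jac U (x + z) = conv \<rho> H' (x + z)" .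
        have "x \<in> nbhd K (3 * r)" using subset_nbhd[of "3 * r" K] r x by auto
        then show "H x = H' x" by (simp add: H'_def)
      qed
      then show "indicator K x * pw q (jac U (x + z) - H x) = indicator K x * pw q (conv \<rho> H' (x + z) - H' x)"
        by (cases "x \<in> K") auto
    qed
    also have "\<dots> \<le> ennreal E"
    proof (rule conv_Lq_le[OF q1 \<rho> H'int])
      fix \<zeta> :: "real^'n" assume \<zeta>: "norm \<zeta> < \<eta>"
      have "(\<integral>\<^sup>+x. indicator K x * pw q (H' (x + z - \<zeta>) - H' x) \<partial>lborel) \<le> (\<integral>\<^sup>+x. pw q (H' (x + (z - \<zeta>)) - H' x) \<partial>lborel)"
        by (intro nn_integral_mono) (auto simp: indicator_def add_diff_eq)
      also have "\<dots> \<le> ennreal E"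
      proof (rule \<delta>(2))
        have "norm (z - \<zeta>) \<le> norm z + norm \<zeta>" by (rule norm_triangle_ineq4)
        then show "norm (z - \<zeta>) < \<delta>" using z \<zeta> h(2) \<eta>(2) m by linarith
      qed
      finally show "(\<integral>\<^sup>+x. indicator K x * pw q (H' (x + z - \<zeta>) - H' x) \<partial>lborel) \<le> ennreal E" .
    qed measurable
    finally show ?thesis .
  qed
  have "(\<integral>\<^sup>+x. indicator K x * L (H x) \<partial>lborel) \<le> (\<integral>\<^sup>+x. indicator (nbhd K r) x * L (jac (w n) x) \<partial>lborel) +
     ennreal a0 * (emeasure lborel S * ((\<integral>\<^sup>+x. indicator K x * (1 + pw q (H x)) \<partial>lborel) + (\<integral>\<^sup>+x. indicator (nbhd K r) x * pw q (jac (w n) x) \<partial>lborel))) +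
     ennreal C * (ennreal (2 powr q) * (ennreal ((1 / h) powr q) * (\<integral>\<^sup>+x. indicator (nbhd K r) x * pw q (w n x - U x) \<partial>lborel) +
        ennreal (real CARD('n) powr q) * ennreal E))"
  proof (rule localized_estimate[OF UC S Ssub q1 cont w(1) U])
    show "x + h *\<^sub>R y \<in> nbhd K r" if "x \<in> K" "y \<in> unit_cube" for x y :: "real^'n"
    proof (rule nbhdI[OF that(1)])
      have "h * norm y \<le> h * N" using norm_unit_cube[OF that(2)] h(1) unfolding N_def by (intro mult_left_mono) auto
      then show "norm (h *\<^sub>R y) \<le> r" using h m by simp
    qed
    show "(\<integral>\<^sup>+x. indicator K x * pw q (jac U (x + z) - H x) \<partial>lborel) \<le> ennreal E" if "norm z \<le> h * real CARD('n)" for z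
      using T2 that by (simp add: N_def)
  qed (use h in \<open>simp_all add: nbhd_borel K borel_compact\<close>)
  also have "\<dots> \<le> ennreal (c + e) + ennreal a0 * (ennreal \<epsilon>S * (ennreal X + ennreal M)) +
     ennreal C * (ennreal (2 powr q) * (ennreal ((1 / h) powr q) * ennreal e2 + ennreal (N powr q) * ennreal E))"
  proof (intro add_mono mult_left_mono mult_mono Ssmall KX T1)
    have "(\<integral>\<^sup>+x. indicator (nbhd K r) x * L (jac (w n) x) \<partial>lborel) \<le> (\<integral>\<^sup>+x. indicator (nbhd K (2 * r)) x * L (jac (w n) x) \<partial>lborel)"
      using nbhd_mono[of r "2 * r" K] r by (intro nn_integral_mono) (auto simp: indicator_def)
    also have "\<dots> \<le> ennreal (c + 1 / Suc n)" by (rule w(4))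
    also have "\<dots> \<le> ennreal (c + e)" using n(2) by (intro ennreal_leI) simp
    finally show "(\<integral>\<^sup>+x. indicator (nbhd K r) x * L (jac (w n) x) \<partial>lborel) \<le> ennreal (c + e)" .
    show "(\<integral>\<^sup>+x. indicator (nbhd K r) x * pw q (jac (w n) x) \<partial>lborel) \<le> ennreal M"
      by (rule gradw) (use nbhd_mono[of r "2 * r" K] r in simp)
  qed (simp_all add: N_def)
  also have "\<dots> = ennreal ((c + e) + a0 * (\<epsilon>S * (X + M)) + C * (2 powr q * ((1 / h) powr q * e2 + N powr q * E)))"
    using c0 e a0 \<epsilon>S X M C e2 E by (simp flip: ennreal_plus ennreal_mult)
  also have "\<dots> \<le> ennreal (c + e0)"
  proof (rule ennreal_leI)
    have "a0 * (\<epsilon>S * (X + M)) = e * (a0 * (X + M) / (a0 * (X + M) + 1))" by (simp add: \<epsilon>S_def)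
    also have "\<dots> \<le> e * 1" using aXM e by (intro mult_left_mono) auto
    finally have 1: "a0 * (\<epsilon>S * (X + M)) \<le> e" by simp
    have "D2 * e2 = e * (D2 / (D2 + 1))" by (simp add: e2_def)
    also have "\<dots> \<le> e * 1" using D2 e by (intro mult_left_mono) auto
    finally have 2: "D2 * e2 \<le> e" by simp
    have "D * E = e * (D / (D + 1))" by (simp add: E_def)
    also have "\<dots> \<le> e * 1" using D e by (intro mult_left_mono) auto
    finally have 3: "D * E \<le> e" by simp
    have "C * (2 powr q * ((1 / h) powr q * e2 + N powr q * E)) = D2 * e2 + D * E"
      by (simp add: D2_def D_def algebra_simps)
    then show "(c + e) + a0 * (\<epsilon>S * (X + M)) + C * (2 powr q * ((1 / h) powr q * e2 + N powr q * E)) \<le> c + e0"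
      using 1 2 3 by (simp add: e_def)
  qed
  finally show "(\<integral>\<^sup>+x. indicator K x * L (H x) \<partial>lborel) \<le> ennreal c + ennreal e0"
    using c0 \<open>0 < e0\<close> by simp
qed

end

section \<open>Weak convergence\<close>

text \<open>The parameter t is any positive level above the L^p norm. Since the resulting bound is
  linear in t, it can afterwards be lowered to the norm itself, also when the norm is 0.\<close>

lemma integrable_Lp_space:
  fixes w :: "real^'n \<Rightarrow> 'b::euclidean_space"
  assumes \<Omega>: "open \<Omega>" "bounded \<Omega>" and p: "1 < p" and w: "w \<in> Lp_space p \<Omega>"
    and t: "0 < t" "(LINT x|lebesgue_on \<Omega>. norm (w x) powr p) \<le> t powr p"
  shows "integrable (lebesgue_on \<Omega>) w"
    and "(LINT x|lebesgue_on \<Omega>. norm (w x)) \<le> t * (measure (lebesgue_on \<Omega>) \<Omega> + 1)"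
proof -
  let ?M = "lebesgue_on \<Omega>"
  have m: "w \<in> borel_measurable ?M" and ip: "integrable ?M (\<lambda>x. norm (w x) powr p)"
    using w by (auto simp: Lp_space_def)
  have "\<Omega> \<in> lmeasurable" using \<Omega> by (simp add: bounded_set_imp_lmeasurable)
  then interpret finite_measure ?M by (rule finite_measure_lebesgue_on)
  \<comment> \<open>a substitute for Hoelder's inequality\<close>
  have le: "norm (w x) \<le> t + t powr (1 - p) * norm (w x) powr p" for x
  proof (cases "norm (w x) \<le> t")
    case True
    then show ?thesis using t(1) by (simp add: add_increasing2)
  next
    case False
    then have pos: "norm (w x) > 0" using t(1) by linarith
    have "norm (w x) powr (1 - p) \<le> t powr (1 - p)"
      using False t(1) p by (intro powr_mono2') auto
    then have "norm (w x) powr (1 - p) * norm (w x) powr p \<le> t powr (1 - p) * norm (w x) powr p"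
      by (rule mult_right_mono) simp
    moreover have "norm (w x) powr (1 - p) * norm (w x) powr p = norm (w x)"
      using pos by (simp flip: powr_add)
    ultimately show ?thesis using t(1) by linarith
  qed
  have ib: "integrable ?M (\<lambda>x. t + t powr (1 - p) * norm (w x) powr p)"
    using ip by (intro Bochner_Integration.integrable_add integrable_mult_right) auto
  show iw: "integrable ?M w"
    by (rule Bochner_Integration.integrable_bound[OF ib m])
      (simp, intro AE_I2 order_trans[OF le abs_ge_self])
  have "(LINT x|?M. norm (w x)) \<le> (LINT x|?M. t + t powr (1 - p) * norm (w x) powr p)"
    using iw ib le by (intro integral_mono) auto
  also have "\<dots> = t * measure ?M \<Omega> + t powr (1 - p) * (LINT x|?M. norm (w x) powr p)"
    using ip by (simp add: mult.commute)
  also have "\<dots> \<le> t * measure ?M \<Omega> + t powr (1 - p) * t powr p"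
    using t(2) by (intro add_left_mono mult_left_mono) auto
  also have "t powr (1 - p) * t powr p = t" using t(1) by (simp flip: powr_add)
  finally show "(LINT x|?M. norm (w x)) \<le> t * (measure ?M \<Omega> + 1)" by (simp add: distrib_left)
qed

lemma W1p_norm_ge:
  assumes "0 < p"
  shows "(LINT x|lebesgue_on \<Omega>. norm (w x) powr p) \<le> W1p_norm p \<Omega> w powr p"
proof -
  have "(LINT x|lebesgue_on \<Omega>. norm (w x) powr p) \<ge> 0"
    "(LINT x|lebesgue_on \<Omega>. norm (weak_gradient \<Omega> w x) powr p) \<ge> 0"
    by (intro integral_nonneg_AE; simp)+
  then show ?thesis using assms by (simp add: W1p_norm_def powr_powr)
qed

text \<open>The abstract dual enters the proof through these functionals. A test function is
  bounded, so the L^1 estimate above makes the functional bounded for the Sobolev norm.\<close>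

lemma test_function_integral_in_dual:
  fixes \<Omega> :: "(real^'n) set" and i :: "'m::finite"
  assumes \<Omega>: "open \<Omega>" "bounded \<Omega>" and p: "1 < p" and \<phi>: "test_function \<Omega> \<phi>"
  shows "(\<lambda>w. LINT x|lebesgue_on \<Omega>. (w x :: real^'m) $ i * \<phi> x) \<in> W1p_dual p \<Omega>"
proof -
  let ?M = "lebesgue_on \<Omega>"
  obtain R where R: "smooth_supp R \<phi>" using test_function_smooth_supp[OF \<phi>] by metis
  obtain B where B: "B \<ge> 0" "\<And>x. \<bar>\<phi> x\<bar> \<le> B" using smooth_supp_bounded[OF R] by auto
  have \<phi>m: "\<phi> \<in> borel_measurable ?M"
    by (intro measurable_restrict_space1 measurable_completion) (use test_function_measurable[OF \<phi>] in simp)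
  define \<mu> where "\<mu> = measure ?M \<Omega> + 1"
  have \<mu>: "\<mu> \<ge> 1" by (simp add: \<mu>_def)
  have nonneg: "W1p_norm p \<Omega> w \<ge> 0" for w :: "real^'n \<Rightarrow> real^'m" by (simp add: W1p_norm_def)
  have small: "integrable ?M w" "(LINT x|?M. norm (w x)) \<le> t * \<mu>"
    if "w \<in> W1p p \<Omega>" "W1p_norm p \<Omega> w < t" for w :: "real^'n \<Rightarrow> real^'m" and t
  proof -
    have "W1p_norm p \<Omega> w powr p \<le> t powr p" using that(2) p nonneg[of w] by (intro powr_mono2) auto
    then have *: "(LINT x|?M. norm (w x) powr p) \<le> t powr p"
      using W1p_norm_ge[where p = p and w = w and \<Omega> = \<Omega>] p by simp
    have t: "t > 0" using that(2) nonneg[of w] by linarith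
    have "w \<in> Lp_space p \<Omega>" using that(1) by (simp add: W1p_def)
    from integrable_Lp_space[OF \<Omega> p this t *]
    show "integrable ?M w" "(LINT x|?M. norm (w x)) \<le> t * \<mu>" by (simp_all add: \<mu>_def)
  qed
  have int: "integrable ?M (\<lambda>x. w x $ i * \<phi> x)" if "w \<in> W1p p \<Omega>" for w :: "real^'n \<Rightarrow> real^'m"
  proof (rule Bochner_Integration.integrable_bound)
    have "integrable ?M w" by (rule small(1)[OF that less_add_one])
    then show "integrable ?M (\<lambda>x. B * (w x $ i))" by (intro integrable_mult_right integrable_nth)
    show "(\<lambda>x. w x $ i * \<phi> x) \<in> borel_measurable ?M"
      using \<open>integrable ?M w\<close> \<phi>m by (intro borel_measurable_times borel_measurable_integrable[OF integrable_nth])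
    show "AE x in ?M. norm (w x $ i * \<phi> x) \<le> norm (B * w x $ i)"
    proof (rule AE_I2)
      fix x
      have "\<bar>w x $ i\<bar> * \<bar>\<phi> x\<bar> \<le> \<bar>w x $ i\<bar> * B" using B(2) by (intro mult_left_mono) auto
      then show "norm (w x $ i * \<phi> x) \<le> norm (B * w x $ i)" using B(1) by (simp add: abs_mult mult.commute)
    qed
  qed
  have bound: "\<bar>LINT x|?M. w x $ i * \<phi> x\<bar> \<le> (B * \<mu>) * W1p_norm p \<Omega> w" if w: "w \<in> W1p p \<Omega>" for w :: "real^'n \<Rightarrow> real^'m"
  proof (rule field_le_epsilon)
    fix e :: real assume e: "e > 0"
    \<comment> \<open>The estimate \<open>small\<close> holds for levels strictly above the norm;
      the excess contributes at most \<open>e\<close> to the final bound.\<close>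
    define t where "t = W1p_norm p \<Omega> w + e / (B * \<mu> + 1)"
    have B\<mu>: "B * \<mu> \<ge> 0" using B(1) \<mu> by simp
    have t: "W1p_norm p \<Omega> w < t" using e B\<mu> by (simp add: t_def)
    have iw: "integrable ?M w" by (rule small(1)[OF w t])
    have "\<bar>LINT x|?M. w x $ i * \<phi> x\<bar> \<le> (LINT x|?M. \<bar>w x $ i * \<phi> x\<bar>)" by (rule integral_abs_bound)
    also have "\<dots> \<le> (LINT x|?M. B * norm (w x))"
    proof (rule integral_mono)
      show "\<bar>w x $ i * \<phi> x\<bar> \<le> B * norm (w x)" for x
        unfolding abs_mult mult.commute[of B]
        by (intro mult_mono component_le_norm_cart B) auto
    qed (use int[OF w] iw in auto)
    also have "\<dots> \<le> B * (t * \<mu>)" using small(2)[OF w t] B(1) by (simp add: mult_left_mono)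
    also have "\<dots> = B * \<mu> * W1p_norm p \<Omega> w + e * (B * \<mu> / (B * \<mu> + 1))" by (simp add: t_def algebra_simps)
    also have "e * (B * \<mu> / (B * \<mu> + 1)) \<le> e * 1" using e B\<mu> by (intro mult_left_mono) auto
    finally show "\<bar>LINT x|?M. w x $ i * \<phi> x\<bar> \<le> B * \<mu> * W1p_norm p \<Omega> w + e" by simp
  qed
  show ?thesis
    unfolding W1p_dual_def
  proof (intro CollectI conjI ballI allI exI[of _ "B * \<mu>"])
    fix u v :: "real^'n \<Rightarrow> real^'m" assume uv: "u \<in> W1p p \<Omega>" "v \<in> W1p p \<Omega>"
    show "(LINT x|?M. (u x + v x) $ i * \<phi> x) = (LINT x|?M. u x $ i * \<phi> x) + (LINT x|?M. v x $ i * \<phi> x)"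
      using int[OF uv(1)] int[OF uv(2)] by (simp add: distrib_right)
  next
    fix c and u :: "real^'n \<Rightarrow> real^'m"
    show "(LINT x|?M. (c *\<^sub>R u x) $ i * \<phi> x) = c * (LINT x|?M. u x $ i * \<phi> x)"
      by (simp add: mult.assoc)
  qed (rule bound)
qed

text \<open>The factor \<open>\<psi>\<close> vanishes outside \<open>T\<close>, so the integral over
  \<Omega> sees neither the cut at \<open>T\<close> nor the passage to the representative.\<close>

lemma set_integral_representative:
  fixes f g \<psi> :: "real^'n \<Rightarrow> real"
  assumes f: "integrable lebesgue (\<lambda>x. indicator T x *\<^sub>R f x)"
    and [measurable]: "g \<in> borel_measurable borel" "\<psi> \<in> borel_measurable borel"
    and eq: "AE x in lebesgue. indicator T x *\<^sub>R f x = g x"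
    and sub: "\<And>x. \<psi> x \<noteq> 0 \<Longrightarrow> x \<in> T" "T \<subseteq> \<Omega>"
  shows "(LINT x:\<Omega>|lebesgue. f x * \<psi> x) = (LINT x|lborel. g x * \<psi> x)"
proof -
  have "(\<lambda>x. indicator \<Omega> x *\<^sub>R (f x * \<psi> x)) = (\<lambda>x. (indicator T x *\<^sub>R f x) * \<psi> x)"
  proof
    show "indicator \<Omega> x *\<^sub>R (f x * \<psi> x) = (indicator T x *\<^sub>R f x) * \<psi> x" for x
      using sub by (cases "\<psi> x = 0") (auto simp: indicator_def)
  qed
  then have "(LINT x:\<Omega>|lebesgue. f x * \<psi> x) = (LINT x|lebesgue. (indicator T x *\<^sub>R f x) * \<psi> x)"
    by (simp add: set_lebesgue_integral_def)
  also have "\<dots> = (LINT x|lebesgue. g x * \<psi> x)"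
  proof (rule integral_cong_AE)
    show "(\<lambda>x. (indicator T x *\<^sub>R f x) * \<psi> x) \<in> borel_measurable lebesgue"
      by (intro borel_measurable_times borel_measurable_integrable[OF f] measurable_completion) simp
    show "(\<lambda>x. g x * \<psi> x) \<in> borel_measurable lebesgue" by (intro measurable_completion) simp
    show "AE x in lebesgue. (indicator T x *\<^sub>R f x) * \<psi> x = g x * \<psi> x" using eq by eventually_elim simp
  qed
  also have "\<dots> = (LINT x|lborel. g x * \<psi> x)" by (rule integral_completion) simp
  finally show ?thesis .
qed

lemma test_function_mono: "test_function \<Omega>' \<phi> \<Longrightarrow> \<Omega>' \<subseteq> \<Omega> \<Longrightarrow> test_function \<Omega> \<phi>"
  by (auto simp: test_function_def)

text \<open>Restricting to a compact \<open>T\<close> turns local integrability into integrability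
  on the whole space, and test functions of an open set inside \<open>T\<close> do not see the
  restriction.\<close>

lemma borel_weak_gradient:
  fixes u :: "real^'n \<Rightarrow> real^'m"
  assumes h: "has_weak_gradient \<Omega> u G" and T: "compact T" "T \<subseteq> \<Omega>" and \<Omega>': "open \<Omega>'" "\<Omega>' \<subseteq> T"
  obtains u' G' where "wgrad \<Omega>' u' G'" "\<And>x. x \<notin> \<Omega>' \<Longrightarrow> G' x = 0"
    "AE x in lborel. x \<in> \<Omega>' \<longrightarrow> G' x = G x"
    "\<And>\<phi> i. test_function \<Omega>' \<phi> \<Longrightarrow> (LINT x|lborel. u' x $ i * \<phi> x) = (LINT x:\<Omega>|lebesgue. u x $ i * \<phi> x)"
proof -
  have iu: "integrable lebesgue (\<lambda>x. indicator T x *\<^sub>R u x)" and iG: "integrable lebesgue (\<lambda>x. indicator T x *\<^sub>R G x)"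
    using h T by (auto simp: has_weak_gradient_def locally_integrable_def set_integrable_def)
  obtain u' where u': "integrable lborel u'" "AE x in lebesgue. indicator T x *\<^sub>R u x = u' x"
    using integrable_borel_representative[OF iu] by blast
  obtain g where g: "integrable lborel g" "AE x in lebesgue. indicator T x *\<^sub>R G x = g x"
    using integrable_borel_representative[OF iG] by blast
  \<comment> \<open>The gradient is cut further, from \<open>T\<close> to \<open>\<Omega>'\<close>,
    so that it vanishes off the domain as \<open>bounded_energy_sequence\<close> demands.\<close>
  define G' where "G' x = indicator \<Omega>' x *\<^sub>R g x" for x
  have iG': "integrable lborel G'"
    unfolding G'_def using g(1) \<Omega>'(1) by (intro integrable_mult_indicator) auto
  have m: "(\<lambda>x. u' x $ i) \<in> borel_measurable borel" "(\<lambda>x. g x $ i $ j) \<in> borel_measurable borel" for i j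
    using borel_measurable_integrable[OF integrable_nth[OF u'(1)]] borel_measurable_integrable[OF integrable_nth[OF integrable_nth[OF g(1)]]]
    by simp_all
  have tu: "(LINT x:\<Omega>|lebesgue. u x $ i * \<phi> x) = (LINT x|lborel. u' x $ i * \<phi> x)" if \<phi>: "test_function \<Omega>' \<phi>" for \<phi> i
  proof (rule set_integral_representative[where T = T])
    show "integrable lebesgue (\<lambda>x. indicator T x *\<^sub>R u x $ i)" using integrable_nth[OF iu, of i] by simp
    show "AE x in lebesgue. indicator T x *\<^sub>R u x $ i = u' x $ i" using u'(2) by eventually_elim (metis vector_scaleR_component)
    show "x \<in> T" if "\<phi> x \<noteq> 0" for x using test_function_eq_0[OF \<phi>, of x] that \<Omega>'(2) by auto
  qed (use m T test_function_measurable[OF \<phi>] in auto)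
  have tG: "(LINT x:\<Omega>|lebesgue. G x $ i $ j * \<phi> x) = (LINT x|lborel. G' x $ i $ j * \<phi> x)" if \<phi>: "test_function \<Omega>' \<phi>" for \<phi> i j
  proof -
    have "(LINT x:\<Omega>|lebesgue. G x $ i $ j * \<phi> x) = (LINT x|lborel. g x $ i $ j * \<phi> x)"
    proof (rule set_integral_representative[where T = T])
      show "integrable lebesgue (\<lambda>x. indicator T x *\<^sub>R G x $ i $ j)"
        using integrable_nth[OF integrable_nth[OF iG], of i j] by simp
      show "AE x in lebesgue. indicator T x *\<^sub>R G x $ i $ j = g x $ i $ j"
        using g(2) by eventually_elim (metis vector_scaleR_component)
      show "x \<in> T" if "\<phi> x \<noteq> 0" for x using test_function_eq_0[OF \<phi>, of x] that \<Omega>'(2) by auto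
    qed (use m T test_function_measurable[OF \<phi>] in auto)
    also have "\<dots> = (LINT x|lborel. G' x $ i $ j * \<phi> x)"
    proof (rule Bochner_Integration.integral_cong[OF refl])
      show "g x $ i $ j * \<phi> x = G' x $ i $ j * \<phi> x" for x
        using test_function_eq_0[OF \<phi>, of x] by (cases "x \<in> \<Omega>'") (auto simp: G'_def)
    qed
    finally show ?thesis .
  qed
  have w: "wgrad \<Omega>' u' G'"
    unfolding wgrad_def
  proof (intro conjI allI impI u'(1) iG')
    fix \<phi> i j assume \<phi>: "test_function \<Omega>' \<phi>"
    have "test_function \<Omega> \<phi>" using test_function_mono[OF \<phi>] \<Omega>'(2) T(2) by blast
    then have "(LINT x:\<Omega>|lebesgue. u x $ i * partial_deriv j \<phi> x) = - (LINT x:\<Omega>|lebesgue. G x $ i $ j * \<phi> x)"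
      using h unfolding has_weak_gradient_def by blast
    then show "(LINT x|lborel. u' x $ i * partial_deriv j \<phi> x) = - (LINT x|lborel. G' x $ i $ j * \<phi> x)"
      by (simp add: tu[OF partial_deriv_test_function[OF \<phi>]] tG[OF \<phi>])
  qed
  have "AE x in lebesgue. x \<in> \<Omega>' \<longrightarrow> G' x = G x"
    using g(2)
  proof eventually_elim
    case (elim x)
    then show ?case using \<Omega>'(2) by (auto simp: G'_def indicator_def split: if_splits)
  qed
  then have "AE x in lborel. x \<in> \<Omega>' \<longrightarrow> G' x = G x" by (simp add: AE_completion_iff)
  with w tu show ?thesis by (intro that[of u' G']) (auto simp: G'_def)
qed

section \<open>From compact subsets to the whole domain\<close>

lemma gradient_integral_lborel:
  "open \<Omega> \<Longrightarrow> gradient_integral L \<Omega> u = (\<integral>\<^sup>+x. indicator \<Omega> x * L (weak_gradient \<Omega> u x) \<partial>lborel)"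
  unfolding gradient_integral_def by (rule nn_integral_lebesgue_on) simp

text \<open>The indicators of an increasing compact exhaustion converge pointwise, and the bound c
  is the same for all members, so Fatou's lemma applies.\<close>

lemma nn_integral_compact_exhaustion:
  fixes f :: "'a::euclidean_space \<Rightarrow> ennreal"
  assumes \<Omega>: "open \<Omega>" and f: "f \<in> borel_measurable borel"
    and le: "\<And>K. compact K \<Longrightarrow> K \<subseteq> \<Omega> \<Longrightarrow> (\<integral>\<^sup>+x. indicator K x * f x \<partial>lborel) \<le> c"
  shows "(\<integral>\<^sup>+x. indicator \<Omega> x * f x \<partial>lborel) \<le> c"
proof -
  obtain C where C: "\<And>n. compact (C n)" "\<And>n. C n \<subseteq> \<Omega>" "\<And>n. C n \<subseteq> interior (C (Suc n))" "\<Union>(range C) = \<Omega>"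
    by (rule open_Union_compact_subsets[OF \<Omega>]) blast
  note [measurable] = f borel_compact[OF C(1)]
  have mono: "incseq C"
    using C(3) interior_subset by (intro incseq_SucI) blast
  show ?thesis
  proof (rule nn_integral_Fatou_le[where f = "\<lambda>n x. indicator (C n) x * f x"])
    show "AE x in lborel. (\<lambda>n. indicator (C n) x * f x) \<longlonglongrightarrow> indicator \<Omega> x * f x"
    proof (rule AE_I2)
      fix x
      show "(\<lambda>n. indicator (C n) x * f x) \<longlonglongrightarrow> indicator \<Omega> x * f x"
      proof (cases "x \<in> \<Omega>")
        case True
        then obtain N where "x \<in> C N" using C(4) by blast
        then have "x \<in> C n" if "n \<ge> N" for n using incseqD[OF mono that] by blast
        then show ?thesis
          using True by (intro tendsto_eventually eventually_sequentiallyI[of N]) simp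
      next
        case False
        then have "x \<notin> C n" for n using C(2) by blast
        then show ?thesis using False by simp
      qed
    qed
    show "(\<integral>\<^sup>+x. indicator (C n) x * f x \<partial>lborel) \<le> c" for n by (rule le[OF C(1,2)])
  qed measurable
qed

text \<open>Uniqueness identifies the chosen \<open>weak_gradient\<close> on \<Omega> with the
  gradient in \<open>Lp_space\<close>, whose measurability yields a Borel function. The compact
  exhaustion needs such an integrand.\<close>

lemma borel_weak_gradient_representative:
  assumes \<Omega>: "open \<Omega>" and u: "u \<in> W1p p \<Omega>"
  shows "\<exists>H. H \<in> borel_measurable borel \<and> (AE x in lborel. x \<in> \<Omega> \<longrightarrow> H x = weak_gradient \<Omega> u x)"
proof -
  obtain G where G: "has_weak_gradient \<Omega> u G" "G \<in> Lp_space p \<Omega>" using u by (auto simp: W1p_def)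
  have "G \<in> borel_measurable (lebesgue_on \<Omega>)" using G(2) by (simp add: Lp_space_def)
  then have "(\<lambda>x. indicator \<Omega> x *\<^sub>R G x) \<in> borel_measurable lebesgue"
    using \<Omega> by (subst (asm) borel_measurable_restrict_space_iff) auto
  then obtain H where H: "H \<in> borel_measurable borel" "AE x in lebesgue. indicator \<Omega> x *\<^sub>R G x = H x"
    using borel_representative by blast
  have "AE x in lebesgue. x \<in> \<Omega> \<longrightarrow> G x = weak_gradient \<Omega> u x"
    by (rule AE_weak_gradient_unique[OF \<Omega> G(1) weak_gradient_has_weak_gradient[OF G(1)]])
  with H(2) have "AE x in lebesgue. x \<in> \<Omega> \<longrightarrow> H x = weak_gradient \<Omega> u x"
    by eventually_elim auto
  with H(1) show ?thesis by (auto simp: AE_completion_iff)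
qed

text \<open>Around \<open>K\<close> there is an open set contained in a compact subset of \<Omega>.
  On it the sequence and its limit are replaced by Borel representatives, to which the locale
  applies with the same level \<open>c\<close>.\<close>

lemma weak_limit_energy_on_compact:
  fixes L :: "real^'n^'m \<Rightarrow> ennreal"
  assumes \<Omega>: "open \<Omega>" "bounded \<Omega>" and p: "1 < p" and q: "1 \<le> q" and \<alpha>: "0 < \<alpha>" and \<beta>: "0 < \<beta>"
    and cont: "continuous_on UNIV L" and quasiconvex: "W1q_quasiconvex q L"
    and growth: "\<And>\<xi>. L \<xi> \<le> ennreal \<alpha> * (1 + pw q \<xi>)" and coercive: "\<And>\<xi>. ennreal \<beta> * pw q \<xi> \<le> L \<xi>"
    and conv: "W1p_weakly_tendsto p \<Omega> u v" and c: "0 \<le> c"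
    and le: "\<And>n. gradient_integral L \<Omega> (u n) \<le> ennreal c"
    and K: "compact K" "K \<subseteq> \<Omega>"
  shows "(\<integral>\<^sup>+x. indicator K x * L (weak_gradient \<Omega> v x) \<partial>lborel) \<le> ennreal c"
proof -
  have W: "u n \<in> W1p p \<Omega>" "v \<in> W1p p \<Omega>" for n using conv by (auto simp: W1p_weakly_tendsto_def)
  have wg: "has_weak_gradient \<Omega> w (weak_gradient \<Omega> w)" if "w \<in> W1p p \<Omega>" for w :: "real^'n \<Rightarrow> real^'m"
    using that weak_gradient_has_weak_gradient by (auto simp: W1p_def)
  obtain r where r: "0 < r" "\<And>x. x \<in> K \<Longrightarrow> cball x r \<subseteq> \<Omega>"
    using compact_neighbourhood[OF K(1) \<Omega>(1) K(2)] by metis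
  define T where "T = nbhd K r"
  have T: "compact T" "T \<subseteq> \<Omega>"
  proof -
    show "compact T" unfolding T_def by (rule compact_nbhd[OF K(1)])
    show "T \<subseteq> \<Omega>"
    proof
      fix x assume "x \<in> T"
      then obtain k z where "x = k + z" "k \<in> K" "norm z \<le> r" by (auto simp: T_def nbhd_def)
      then have "x \<in> cball k r" by (simp add: dist_norm)
      then show "x \<in> \<Omega>" using r(2) \<open>k \<in> K\<close> by blast
    qed
  qed
  \<comment> \<open>The open neighbourhood is the new domain, and its compact hull \<open>T\<close>
    provides the integrability of the representatives.\<close>
  define \<Omega>' where "\<Omega>' = (\<Union>x\<in>K. ball x r)"
  have \<Omega>': "open \<Omega>'" "\<Omega>' \<subseteq> T" "K \<subseteq> \<Omega>'"
  proof -
    show "open \<Omega>'" by (auto simp: \<Omega>'_def)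
    show "K \<subseteq> \<Omega>'" using r(1) by (auto simp: \<Omega>'_def)
    show "\<Omega>' \<subseteq> T"
    proof
      fix x assume "x \<in> \<Omega>'"
      then obtain k where k: "k \<in> K" "dist k x < r" by (auto simp: \<Omega>'_def)
      then have "k + (x - k) \<in> nbhd K r" by (intro nbhdI) (auto simp: dist_norm norm_minus_commute)
      then show "x \<in> T" by (simp add: T_def)
    qed
  qed
  \<comment> \<open>The requirements are bundled so that representatives can be chosen for all n at
    once.\<close>
  define rep where "rep w w' G' \<longleftrightarrow> wgrad \<Omega>' w' G' \<and> (\<forall>x. x \<notin> \<Omega>' \<longrightarrow> G' x = 0) \<and>
     (AE x in lborel. x \<in> \<Omega>' \<longrightarrow> G' x = weak_gradient \<Omega> w x) \<and>
     (\<forall>\<phi> i. test_function \<Omega>' \<phi> \<longrightarrow> (LINT x|lborel. w' x $ i * \<phi> x) = (LINT x:\<Omega>|lebesgue. w x $ i * \<phi> x))"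
    for w w' :: "real^'n \<Rightarrow> real^'m" and G'
  have ex: "\<exists>w' G'. rep w w' G'" if "w \<in> W1p p \<Omega>" for w
    unfolding rep_def by (rule borel_weak_gradient[OF wg[OF that] T \<Omega>'(1,2)]) blast
  obtain v' H' where v': "rep v v' H'" using ex[OF W(2)] by blast
  have "\<forall>n. \<exists>w' G'. rep (u n) w' G'" using ex[OF W(1)] by blast
  then obtain u' G' where u': "\<And>n. rep (u n) (u' n) (G' n)" by metis
  interpret bounded_energy_sequence \<Omega>' L q \<alpha> \<beta> c u' G' v' H'
  proof
    show "bounded \<Omega>'" using bounded_subset[OF \<Omega>(2)] \<Omega>'(2) T(2) by blast
    show "(\<integral>\<^sup>+x. indicator \<Omega>' x * L (G' n x) \<partial>lborel) \<le> ennreal c" for n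
    proof -
      have "(\<integral>\<^sup>+x. indicator \<Omega>' x * L (G' n x) \<partial>lborel) = (\<integral>\<^sup>+x. indicator \<Omega>' x * L (weak_gradient \<Omega> (u n) x) \<partial>lborel)"
      proof (rule nn_integral_cong_AE)
        have "AE x in lborel. x \<in> \<Omega>' \<longrightarrow> G' n x = weak_gradient \<Omega> (u n) x" using u'[of n] by (simp add: rep_def)
        then show "AE x in lborel. indicator \<Omega>' x * L (G' n x) = indicator \<Omega>' x * L (weak_gradient \<Omega> (u n) x)"
          by eventually_elim (auto simp: indicator_def)
      qed
      also have "\<dots> \<le> (\<integral>\<^sup>+x. indicator \<Omega> x * L (weak_gradient \<Omega> (u n) x) \<partial>lborel)"
        using \<Omega>'(2) T(2) by (intro nn_integral_mono) (auto simp: indicator_def)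
      also have "\<dots> \<le> ennreal c" using le[of n] by (simp add: gradient_integral_lborel[OF \<Omega>(1)])
      finally show ?thesis .
    qed
    show "(\<lambda>n. LINT x|lborel. u' n x $ i * \<phi> x) \<longlonglongrightarrow> (LINT x|lborel. v' x $ i * \<phi> x)" if \<phi>: "test_function \<Omega>' \<phi>" for \<phi> i
    proof -
      have "test_function \<Omega> \<phi>" using test_function_mono[OF \<phi>] \<Omega>'(2) T(2) by blast
      then have dual: "(\<lambda>w. LINT x|lebesgue_on \<Omega>. (w x :: real^'m) $ i * \<phi> x) \<in> W1p_dual p \<Omega>"
        by (rule test_function_integral_in_dual[OF \<Omega> p])
      have lim: "\<forall>F\<in>W1p_dual p \<Omega>. (\<lambda>n. F (u n)) \<longlonglongrightarrow> F v"
        using conv by (simp add: W1p_weakly_tendsto_def)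
      have "(\<lambda>n. LINT x|lebesgue_on \<Omega>. u n x $ i * \<phi> x) \<longlonglongrightarrow> (LINT x|lebesgue_on \<Omega>. v x $ i * \<phi> x)"
        by (rule bspec[OF lim dual])
      moreover have "(LINT x|lebesgue_on \<Omega>. w x $ i * \<phi> x) = (LINT x:\<Omega>|lebesgue. w x $ i * \<phi> x)" for w :: "real^'n \<Rightarrow> real^'m"
        using \<Omega>(1) by (subst integral_restrict_space) (auto simp: set_lebesgue_integral_def)
      ultimately show ?thesis using u' v' \<phi> by (simp add: rep_def)
    qed
  qed (use u' v' \<Omega>' q \<alpha> \<beta> c cont quasiconvex growth coercive in \<open>auto simp: rep_def\<close>)
  have "(\<integral>\<^sup>+x. indicator K x * L (weak_gradient \<Omega> v x) \<partial>lborel) = (\<integral>\<^sup>+x. indicator K x * L (H' x) \<partial>lborel)"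
  proof (rule nn_integral_cong_AE)
    have "AE x in lborel. x \<in> \<Omega>' \<longrightarrow> H' x = weak_gradient \<Omega> v x" using v' by (simp add: rep_def)
    then show "AE x in lborel. indicator K x * L (weak_gradient \<Omega> v x) = indicator K x * L (H' x)"
      by eventually_elim (use \<Omega>'(3) in \<open>auto simp: indicator_def\<close>)
  qed
  also have "\<dots> \<le> ennreal c" by (rule energy_on_compact[OF K(1) \<Omega>'(3)])
  finally show ?thesis .
qed

text \<open>If lower semicontinuity failed, a level c strictly between the two sides would bound the
  energies of a subsequence. That level then bounds the limit energy on every compact subset, and by
  exhaustion on \<Omega>, which is a contradiction.\<close>

lemma seq_weakly_lsc_gradient_integral:
  fixes L :: "real^'n^'m \<Rightarrow> ennreal"
  assumes \<Omega>: "open \<Omega>" "bounded \<Omega>" and p: "1 < p" and q: "1 \<le> q" and \<alpha>: "0 < \<alpha>" and \<beta>: "0 < \<beta>"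
    and cont: "continuous_on UNIV L" and quasiconvex: "W1q_quasiconvex q L"
    and growth: "\<And>\<xi>. L \<xi> \<le> ennreal \<alpha> * (1 + pw q \<xi>)" and coercive: "\<And>\<xi>. ennreal \<beta> * pw q \<xi> \<le> L \<xi>"
  shows "seq_weakly_lsc_W1p p \<Omega> (gradient_integral L \<Omega>)"
  unfolding seq_weakly_lsc_W1p_def
proof (intro allI impI)
  fix u :: "nat \<Rightarrow> real^'n \<Rightarrow> real^'m" and v assume conv: "W1p_weakly_tendsto p \<Omega> u v"
  let ?J = "gradient_integral L \<Omega>"
  show "?J v \<le> liminf (\<lambda>n. ?J (u n))"
  proof (rule ccontr)
    assume "\<not> ?J v \<le> liminf (\<lambda>n. ?J (u n))"
    then obtain c' where c': "liminf (\<lambda>n. ?J (u n)) < c'" "c' < ?J v" using dense not_le by metis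
    \<comment> \<open>The level is finite because it lies strictly below the energy of
      \<open>v\<close>, even when that energy is infinite.\<close>
    obtain c where c: "c' = ennreal c" "0 \<le> c"
      using c'(2) by (cases c') auto
    have "infinite {n. ?J (u n) \<le> ennreal c}"
    proof
      assume "finite {n. ?J (u n) \<le> ennreal c}"
      then have "\<forall>\<^sub>F n in sequentially. \<not> ?J (u n) \<le> ennreal c"
        by (simp add: eventually_cofinite flip: cofinite_eq_sequentially)
      then have "\<forall>\<^sub>F n in sequentially. ennreal c \<le> ?J (u n)" by (rule eventually_mono) simp
      then have "ennreal c \<le> liminf (\<lambda>n. ?J (u n))" by (rule Liminf_bounded)
      with c'(1) c(1) show False by simp
    qed
    then obtain s :: "nat \<Rightarrow> nat" where s: "strict_mono s" "\<And>n. ?J (u (s n)) \<le> ennreal c"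
      using infinite_enumerate by blast
    have conv': "W1p_weakly_tendsto p \<Omega> (\<lambda>n. u (s n)) v"
      using conv LIMSEQ_subseq_LIMSEQ[OF _ s(1)] unfolding W1p_weakly_tendsto_def by (auto simp: o_def)
    have "v \<in> W1p p \<Omega>" using conv by (simp add: W1p_weakly_tendsto_def)
    then obtain H where H: "H \<in> borel_measurable borel" "AE x in lborel. x \<in> \<Omega> \<longrightarrow> H x = weak_gradient \<Omega> v x"
      using borel_weak_gradient_representative[OF \<Omega>(1)] by blast
    have eq: "(\<integral>\<^sup>+x. indicator A x * L (H x) \<partial>lborel) = (\<integral>\<^sup>+x. indicator A x * L (weak_gradient \<Omega> v x) \<partial>lborel)"
      if "A \<subseteq> \<Omega>" for A
    proof (rule nn_integral_cong_AE)
      show "AE x in lborel. indicator A x * L (H x) = indicator A x * L (weak_gradient \<Omega> v x)"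
        using H(2) by eventually_elim (use that in \<open>auto simp: indicator_def\<close>)
    qed
    have Lm: "L \<in> borel_measurable borel" by (rule borel_measurable_continuous_onI[OF cont])
    have "(\<integral>\<^sup>+x. indicator \<Omega> x * L (H x) \<partial>lborel) \<le> ennreal c"
    proof (rule nn_integral_compact_exhaustion[OF \<Omega>(1)])
      show "(\<lambda>x. L (H x)) \<in> borel_measurable borel" using measurable_compose[OF H(1) Lm] .
      fix K assume K: "compact K" "K \<subseteq> \<Omega>"
      show "(\<integral>\<^sup>+x. indicator K x * L (H x) \<partial>lborel) \<le> ennreal c"
        unfolding eq[OF K(2)]
        by (rule weak_limit_energy_on_compact[OF \<Omega> p q \<alpha> \<beta> cont quasiconvex growth coercive conv' c(2) s(2) K])
    qed
    then have "?J v \<le> ennreal c" by (simp add: eq gradient_integral_lborel[OF \<Omega>(1)])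
    with c'(2) c(1) show False by simp
  qed
qed

theorem corollary1p4:
  fixes \<Omega> :: "(real^'n) set"
    and L :: "real^'n^'m \<Rightarrow> ennreal"
    and p q \<alpha> \<beta> :: real
  assumes "open \<Omega>" and "bounded \<Omega>" and "lipschitz_boundary \<Omega>"
    and "1 < p"
    and "continuous_on UNIV L"
    and "W1q_quasiconvex q L"
    and "0 < \<alpha>" and "0 < \<beta>"
    and "\<And>\<xi>. ennreal (\<beta> * norm \<xi> powr q) \<le> L \<xi>"
    and "\<And>\<xi>. L \<xi> \<le> ennreal (\<alpha> * (1 + norm \<xi> powr q))"
  shows "(p < real CARD('n) \<and> 1 < q \<and> q \<le> real CARD('n) * p / (real CARD('n) - p) \<longrightarrow>
            seq_weakly_lsc_W1p p \<Omega> (gradient_integral L \<Omega>)) \<and>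
         (real CARD('n) \<le> p \<and> 1 < q \<longrightarrow>
            seq_weakly_lsc_W1p p \<Omega> (gradient_integral L \<Omega>))"
proof -
  have "seq_weakly_lsc_W1p p \<Omega> (gradient_integral L \<Omega>)" if "1 < q"
  proof (rule seq_weakly_lsc_gradient_integral)
    show "L \<xi> \<le> ennreal \<alpha> * (1 + pw q \<xi>)" for \<xi>
      using assms(7) assms(10)[of \<xi>] by (simp add: pw_def ennreal_mult)
    show "ennreal \<beta> * pw q \<xi> \<le> L \<xi>" for \<xi>
      using assms(8) assms(9)[of \<xi>] by (simp add: pw_def ennreal_mult)
  qed (use assms that in auto)
  then show ?thesis by blast
qed

end
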